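(* Let $V$ be a finite-dimensional $\mathfrak g$-module with $\operatorname{wt}V\ne\{0\}$, and let $\mathbb F\subseteq\mathbb R$ be a subfield. Then for a nonempty proper subset $Y\subsetneq\operatorname{wt}V$, the following are equivalent: (i) $Y$ is a positive weak $\mathbb F$-face of $\operatorname{wt}V$; (ii) $Y$ is a weak $\mathbb F$-face of $\operatorname{wt}V$; (iii) $Y=F\cap\operatorname{wt}V$ for some proper face $F$ of $\operatorname{conv}_{\mathbb R}(\operatorname{wt}V)$.
   Context: $\mathfrak g$ is a complex semisimple Lie algebra with Cartan subalgebra $\mathfrak h$; $\operatorname{wt}V\subseteq\mathfrak h_{\mathbb R}^*\cong\mathbb R^n$ is the set of weights of $V$ ($\mathfrak h^*_{\mathbb R}$ = real span of the roots). For $X\subseteq\mathbb R^n$ and a subfield $\mathbb F\subseteq\mathbb R$: $\operatorname{conv}_{\mathbb F}(X)$ is the set of finite combinations $\sum r_sx_s$ with $x_s\in X$, $r_s\in\mathbb F\cap[0,\infty)$, $\sum r_s=1$. The $\mathbb F$-relative interior of $Y=\operatorname{conv}_{\mathbb F}(X)$ is $\operatorname{relint}_{\mathbb F}(Y)=\{x\in Y:\forall y\in Y\ \exists z\in Y,\ t\in\mathbb F\cap(0,1)\text{ with }x=ty+(1-t)z\}$. A subset $Y\subseteq X$ is a weak $\mathbb F$-face of $X$ if for every $U\subseteq X$, $\operatorname{conv}_{\mathbb F}(Y)\cap\operatorname{relint}_{\mathbb F}(\operatorname{conv}_{\mathbb F}(U))\ne\emptyset$ implies $U\subseteq Y$.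 A weak $\mathbb F$-face $Y$ of $X$ is a positive weak $\mathbb F$-face if for every $U\subseteq X$, $\operatorname{conv}_{\mathbb F}(Y)\cap\operatorname{relint}_{\mathbb F}(\operatorname{conv}_{\mathbb F}(U\cup\{0\}))=\emptyset$. A face of $\mathcal P\subseteq\mathbb R^n$ is $\mathcal P$ itself or $\mathcal P\cap H(v,w)$ where $H(v,w)=\{u:v\cdot(u-w)=0\}$, $\mathcal P\subseteq\{u:v\cdot(u-w)\ge0\}$, $\mathcal P\cap H(v,w)\ne\emptyset$; a proper face is a face different from $\mathcal P$. *)

theory Defs
  imports "HOL-Analysis.Analysis" "HOL-Library.Function_Algebras"
begin

instantiation "fun" :: (type, real_vector) real_vector
begin
definition scaleR_fun :: "real \<Rightarrow> ('a \<Rightarrow> 'b) \<Rightarrow> 'a \<Rightarrow> 'b"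
  where "scaleR_fun r f = (\<lambda>x. r *\<^sub>R f x)"
instance
  by standard (auto simp: scaleR_fun_def fun_eq_iff scaleR_add_right scaleR_add_left)
end

definition fin_dim :: "(complex \<Rightarrow> 'a \<Rightarrow> 'a::ab_group_add) \<Rightarrow> bool" where
  "fin_dim s \<longleftrightarrow> vector_space s \<and> (\<exists>B. finite B \<and> module.span s B = UNIV)"

definition lie_algebra ::
  "(complex \<Rightarrow> 'g \<Rightarrow> 'g::ab_group_add) \<Rightarrow> ('g \<Rightarrow> 'g \<Rightarrow> 'g) \<Rightarrow> bool" where
  "lie_algebra s br \<longleftrightarrow> vector_space s
     \<and> (\<forall>a b x y z. br (s a x + s b y) z = s a (br x z) + s b (br y z))
     \<and> (\<forall>x. br x x = 0)
     \<and> (\<forall>x y z. br x (br y z) + br y (br z x) + br z (br x y) = 0)"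

definition lie_subalgebra ::
  "(complex \<Rightarrow> 'g \<Rightarrow> 'g::ab_group_add) \<Rightarrow> ('g \<Rightarrow> 'g \<Rightarrow> 'g) \<Rightarrow> 'g set \<Rightarrow> bool" where
  "lie_subalgebra s br S \<longleftrightarrow> module.subspace s S \<and> (\<forall>x\<in>S. \<forall>y\<in>S. br x y \<in> S)"

definition lie_ideal ::
  "(complex \<Rightarrow> 'g \<Rightarrow> 'g::ab_group_add) \<Rightarrow> ('g \<Rightarrow> 'g \<Rightarrow> 'g) \<Rightarrow> 'g set \<Rightarrow> bool" where
  "lie_ideal s br I \<longleftrightarrow> module.subspace s I \<and> (\<forall>x y. y \<in> I \<longrightarrow> br x y \<in> I)"

definition derived ::
  "(complex \<Rightarrow> 'g \<Rightarrow> 'g::ab_group_add) \<Rightarrow> ('g \<Rightarrow> 'g \<Rightarrow> 'g) \<Rightarrow> 'g set \<Rightarrow> 'g set" where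
  "derived s br S = module.span s {br x y | x y. x \<in> S \<and> y \<in> S}"

definition lie_solvable ::
  "(complex \<Rightarrow> 'g \<Rightarrow> 'g::ab_group_add) \<Rightarrow> ('g \<Rightarrow> 'g \<Rightarrow> 'g) \<Rightarrow> 'g set \<Rightarrow> bool" where
  "lie_solvable s br S \<longleftrightarrow> (\<exists>k. (derived s br ^^ k) S = {0})"

definition semisimple ::
  "(complex \<Rightarrow> 'g \<Rightarrow> 'g::ab_group_add) \<Rightarrow> ('g \<Rightarrow> 'g \<Rightarrow> 'g) \<Rightarrow> bool" where
  "semisimple s br \<longleftrightarrow> lie_algebra s br \<and> fin_dim s
     \<and> (\<forall>I. lie_ideal s br I \<and> lie_solvable s br I \<longrightarrow> I = {0})"

definition ad_semisimple ::
  "(complex \<Rightarrow> 'g \<Rightarrow> 'g::ab_group_add) \<Rightarrow> ('g \<Rightarrow> 'g \<Rightarrow> 'g) \<Rightarrow> 'g \<Rightarrow> bool" where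
  "ad_semisimple s br x \<longleftrightarrow> module.span s {y. \<exists>c. br x y = s c y} = UNIV"

definition toral ::
  "(complex \<Rightarrow> 'g \<Rightarrow> 'g::ab_group_add) \<Rightarrow> ('g \<Rightarrow> 'g \<Rightarrow> 'g) \<Rightarrow> 'g set \<Rightarrow> bool" where
  "toral s br T \<longleftrightarrow> lie_subalgebra s br T \<and> (\<forall>t\<in>T. ad_semisimple s br t)"

text \<open>Cartan subalgebra of a semisimple Lie algebra = maximal toral subalgebra.\<close>
definition cartan_subalgebra ::
  "(complex \<Rightarrow> 'g \<Rightarrow> 'g::ab_group_add) \<Rightarrow> ('g \<Rightarrow> 'g \<Rightarrow> 'g) \<Rightarrow> 'g set \<Rightarrow> bool" where
  "cartan_subalgebra s br H \<longleftrightarrow> toral s br H \<and> (\<forall>T. toral s br T \<and> H \<subseteq> T \<longrightarrow> T = H)"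

definition lie_module ::
  "(complex \<Rightarrow> 'g \<Rightarrow> 'g::ab_group_add) \<Rightarrow> ('g \<Rightarrow> 'g \<Rightarrow> 'g) \<Rightarrow>
   (complex \<Rightarrow> 'v \<Rightarrow> 'v::ab_group_add) \<Rightarrow> ('g \<Rightarrow> 'v \<Rightarrow> 'v) \<Rightarrow> bool" where
  "lie_module s br sv act \<longleftrightarrow> vector_space sv
     \<and> (\<forall>a b x y v. act (s a x + s b y) v = sv a (act x v) + sv b (act y v))
     \<and> (\<forall>a b x v w. act x (sv a v + sv b w) = sv a (act x v) + sv b (act x w))
     \<and> (\<forall>x y v. act (br x y) v = act x (act y v) - act y (act x v))"

text \<open>Weights of V with respect to H: functionals on H (extended by 0 outside H,
  so that they are elements of the real vector space of functions 'g \<Rightarrow> complex)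
  admitting a nonzero simultaneous eigenvector. Linearity on H is automatic.\<close>
definition weights ::
  "(complex \<Rightarrow> 'v \<Rightarrow> 'v::ab_group_add) \<Rightarrow> ('g \<Rightarrow> 'v \<Rightarrow> 'v) \<Rightarrow> 'g set \<Rightarrow> ('g \<Rightarrow> complex) set" where
  "weights sv act H = {w. (\<forall>x. x \<notin> H \<longrightarrow> w x = 0)
       \<and> (\<exists>v. v \<noteq> 0 \<and> (\<forall>h\<in>H. act h v = sv (w h) v))}"

definition real_subfield :: "real set \<Rightarrow> bool" where
  "real_subfield K \<longleftrightarrow> 0 \<in> K \<and> 1 \<in> K \<and> (\<forall>x\<in>K. \<forall>y\<in>K. x + y \<in> K \<and> x * y \<in> K)
     \<and> (\<forall>x\<in>K. - x \<in> K) \<and> (\<forall>x\<in>K. x \<noteq> 0 \<longrightarrow> inverse x \<in> K)"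

definition conv_F :: "real set \<Rightarrow> 'a::real_vector set \<Rightarrow> 'a set" where
  "conv_F K X = {y. \<exists>S r. finite S \<and> S \<subseteq> X \<and> (\<forall>s\<in>S. r s \<in> K \<and> 0 \<le> r s)
      \<and> sum r S = 1 \<and> y = (\<Sum>s\<in>S. r s *\<^sub>R s)}"

definition relint_F :: "real set \<Rightarrow> 'a::real_vector set \<Rightarrow> 'a set" where
  "relint_F K Y = {x\<in>Y. \<forall>y\<in>Y. \<exists>z\<in>Y. \<exists>t\<in>K. 0 < t \<and> t < 1 \<and> x = t *\<^sub>R y + (1 - t) *\<^sub>R z}"

definition weak_F_face :: "real set \<Rightarrow> 'a::real_vector set \<Rightarrow> 'a set \<Rightarrow> bool" where
  "weak_F_face K X Y \<longleftrightarrow> Y \<subseteq> X \<and>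
     (\<forall>U. U \<subseteq> X \<longrightarrow> conv_F K Y \<inter> relint_F K (conv_F K U) \<noteq> {} \<longrightarrow> U \<subseteq> Y)"

definition pos_weak_F_face :: "real set \<Rightarrow> 'a::real_vector set \<Rightarrow> 'a set \<Rightarrow> bool" where
  "pos_weak_F_face K X Y \<longleftrightarrow> weak_F_face K X Y \<and>
     (\<forall>U. U \<subseteq> X \<longrightarrow> conv_F K Y \<inter> relint_F K (conv_F K (U \<union> {0})) = {})"

definition is_face :: "'a::real_vector set \<Rightarrow> 'a set \<Rightarrow> bool" where
  "is_face P F \<longleftrightarrow> F = P \<or>
     (\<exists>f::'a \<Rightarrow> real. \<exists>c. linear f \<and> (\<forall>u\<in>P. c \<le> f u) \<and> F = {u\<in>P. f u = c} \<and> F \<noteq> {})"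

end

theory Submission
  imports Defs "HOL-Computational_Algebra.Fundamental_Theorem_Algebra"
begin

text \<open>The affine geometry of a finite set \<open>X\<close> of real vectors is governed by rational
  coefficients as soon as rational-valued functionals separate the rational span of \<open>X\<close>: Farkas'
  lemma over \<open>\<rat>\<close> then turns a weak face into a proper face. If moreover every functional which is
  nonnegative on \<open>X\<close> vanishes there, Farkas' lemma also exhibits \<open>0\<close> as a positive combination of
  \<open>X\<close>, so that proper faces are positive weak faces.

  For the weights of a module, rational functionals are obtained without root theory. Given
  \<open>h \<in> H\<close> and a \<open>\<rat>\<close>-linear \<open>\<phi> : \<complex> \<rightarrow> \<rat>\<close>, replace every eigenvalue \<open>c\<close> of \<open>ad h\<close> by \<open>\<phi> c\<close>. The
  resulting operator (the replica) is a derivation, hence inner, say \<open>ad h'\<close>, and \<open>h' \<in> H\<close> by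
  maximality of \<open>H\<close>. Comparing traces on \<open>V\<close> gives \<open>\<lambda> h' = \<phi> (\<lambda> h)\<close> for every weight \<open>\<lambda>\<close>. The same
  device, together with Engel's theorem, shows that the Killing form is nondegenerate. Finally the
  trace of \<open>h\<close> on \<open>V\<close> vanishes, so the values \<open>\<lambda> h\<close> cannot be nonnegative unless they are all \<open>0\<close>.\<close>

section \<open>Right linearity of the bracket\<close>

text \<open>\<open>K\<close> may be as small as the rationals, and a weak face only tests convex
  combinations with coefficients in \<open>K\<close>. Separation over the reals would give real
  coefficients, about which the hypothesis says nothing; so the certificates in Farkas' lemma must
  be rational. The values of the weights at an element of \<open>H\<close>, however, are arbitrary
  complex numbers, which is why all \<rat>-linear maps from \<complex> to \<rat> enter: some such
  map is nonzero at any given nonzero number. A second obstacle is that a weight is given by one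
  joint eigenvector, while \<open>act h\<close> is not known to be diagonalizable. Every operator is
  therefore split by the projections onto its generalized eigenspaces, and traces of commuting
  projections, which are natural numbers, serve as multiplicities. A vanishing sum of eigenvalues
  with natural multiplicities still vanishes after applying \<phi> to each eigenvalue; this is why a
  trace identity for \<open>h\<close> carries over to its replica. The trace identities on V come
  from one source: a linear functional on the Lie algebra that vanishes on brackets is zero.\<close>

locale left_lie = vector_space s for s :: "complex \<Rightarrow> 'g \<Rightarrow> 'g::ab_group_add" +
  fixes br :: "'g \<Rightarrow> 'g \<Rightarrow> 'g"
  assumes add_left: "br (x + y) z = br x z + br y z"
    and scale_left: "br (s a x) z = s a (br x z)"
    and alt: "br x x = 0"
    and jacobi: "br x (br y z) + br y (br z x) + br z (br x y) = 0"
begin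

lemma double_eq_0: "x + x = 0 \<Longrightarrow> x = (0::'g)"
proof -
  assume "x + x = 0"
  then have "s 2 x = 0" using scale_left_distrib[of 1 1 x] by simp
  then show ?thesis by simp
qed

lemma triple_eq_0: "x + x + x = 0 \<Longrightarrow> x = (0::'g)"
proof -
  assume "x + x + x = 0"
  moreover have "s 3 x = x + x + x"
    using scale_left_distrib[of 2 1 x] scale_left_distrib[of 1 1 x] by simp
  ultimately show ?thesis by simp
qed

lemma zero_left: "br 0 z = 0"
  using scale_left[of 0 0 z] by simp

lemma minus_left: "br (- x) z = - br x z"
  using scale_left[of "-1" x z] by simp

lemma diff_left: "br (x - y) z = br x z - br y z"
  using add_left[of x "-y" z] by (simp add: minus_left)

lemma zero_right: "br x 0 = 0"
  using triple_eq_0[OF jacobi[of x x x]] by (simp add: alt)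

lemma double_swap: "br y (br y z) = - br y (br z y)"
  using jacobi[of y y z] by (simp add: alt zero_right eq_neg_iff_add_eq_0)

lemma jacobi': "br y (br z x) = - br x (br y z) - br z (br x y)"
proof -
  have "br y (br z x) + (br x (br y z) + br z (br x y)) = 0"
    unfolding jacobi[of x y z, symmetric] by (simp only: add.assoc add.left_commute)
  then have "br y (br z x) = - (br x (br y z) + br z (br x y))"
    by (rule eq_neg_iff_add_eq_0[THEN iffD2])
  also have "\<dots> = - br x (br y z) - br z (br x y)"
    by (rule minus_add_distrib[THEN trans]) (rule diff_conv_add_uminus[symmetric])
  finally show ?thesis .
qed

text \<open>\<open>jacobi'\<close> moves the innermost argument into left slots, where it is linear;
  in \<open>br (x + s t y) y\<close> the second summand disappears by \<open>alt\<close>.\<close>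

lemma inner_shift: "br y (br z (x + s t y)) = br y (br z x) + s t (br y (br z y))"
proof -
  have "br y (br z (x + s t y)) = - br x (br y z) - br z (br x y) - s t (br y (br y z))"
    by (subst jacobi') (simp add: add_left scale_left alt)
  also have "\<dots> = br y (br z x) - s t (br y (br y z))"
    by (simp add: jacobi'[of y z x])
  finally show ?thesis by (simp add: double_swap)
qed

text \<open>The sum \<open>w b a + w b (- a)\<close> is even in \<open>a\<close> and odd in
  \<open>b\<close>. Comparing \<open>E2\<close> with \<open>a\<close> and \<open>b\<close> exchanged
  shows that it is symmetric, hence both even and odd, hence zero. The expansion of
  \<open>w (a + b) (a + b)\<close> is then \<open>E2\<close> itself.\<close>

lemma inner_minus_and_sum:
  fixes z
  defines "w \<equiv> \<lambda>u a. br u (br z a)"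
  shows "w b (- a) = - w b a" and "w (a + b) (a + b) = w a a + w b b + w a b + w b a"
proof -
  have diffw: "w (u - v) a = w u a - w v a" for u v a by (simp add: w_def diff_left)
  have minw: "w (- u) a = - w u a" for u a by (simp add: w_def minus_left)
  have sh: "w u (a + u) = w u a + w u u" for u a using inner_shift[of u z a 1] by (simp add: w_def)
  have sm: "w u (- u) = - w u u" for u
    using inner_shift[of u z 0 "-1"] by (simp add: w_def zero_right)
  have E1: "w b b - w a b - w b a + w a a = w (b - a) (b - a)" for a b
    using sh[of "b - a" a] by (simp add: diffw algebra_simps)
  have E2: "w b b + w a b - w b (- a) + w a a = w (a + b) (a + b)" for a b
    using E1[of b "- a"] by (simp add: minw sm add.commute)
  have sym: "w a b + w a (- b) = w b a + w b (- a)" for a b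
  proof -
    have "w a b - w b (- a) = w (a + b) (a + b) - w a a - w b b"
      using E2[of b a] by (simp add: algebra_simps)
    moreover have "w b a - w a (- b) = w (a + b) (a + b) - w a a - w b b"
      using E2[of a b] by (simp add: algebra_simps)
    ultimately have "w a b - w b (- a) = w b a - w a (- b)" by simp
    then show ?thesis by (simp add: algebra_simps)
  qed
  have "w b a + w b (- a) = - (w b a + w b (- a))"
    using sym[of a "- b"] sym[of a b] by (simp add: minw) (simp only: add.commute)
  then have "w b a + w b (- a) = 0"
    using double_eq_0 by (metis add.right_inverse)
  then show odd: "w b (- a) = - w b a" by (simp add: eq_neg_iff_add_eq_0 add.commute)
  show "w (a + b) (a + b) = w a a + w b b + w a b + w b a"
    using E2[of b a] odd by (simp add: algebra_simps)
qed

text \<open>The defect \<open>d\<close> is a third polarization of \<open>Q\<close>, hence symmetric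
  in its three arguments. Being odd in the first, it is odd in each, so negating the last two
  preserves it; but this also reverses its sign, because \<open>w u\<close> is odd.\<close>

lemma inner_add: "br u (br z (a + c)) = br u (br z a) + br u (br z c)"
proof -
  define w where "w = (\<lambda>u a. br u (br z a))"
  define Q where "Q a = w a a" for a
  define d where "d u a c = w u (a + c) - w u a - w u c" for u a c
  have addw: "w (u + v) a = w u a + w v a" for u v a by (simp add: w_def add_left)
  have minw: "w (- u) a = - w u a" for u a by (simp add: w_def minus_left)
  have odd: "w u (- a) = - w u a" for u a
    using inner_minus_and_sum(1) by (simp add: w_def)
  have Q: "Q (a + b) = Q a + Q b + w a b + w b a" for a b
    using inner_minus_and_sum(2)[of a b z] by (simp add: Q_def w_def)
  have d: "d u a c = Q (a + c + u) - Q (a + c) - Q (c + u) - Q (a + u) + Q a + Q c + Q u" for u a c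
    unfolding d_def Q by (simp add: addw algebra_simps)
  have swap: "d u a c = d a u c" "d u a c = d u c a" for u a c
    by (simp_all add: d algebra_simps)
  have m1: "d (- u) a c = - d u a c" for u a c by (simp add: d_def minw)
  have m3: "d u (- a) (- c) = - d u a c" for u a c
    using odd[of u "a + c"] odd[of u a] odd[of u c] by (simp add: d_def)
  have "d u (- a) (- c) = d u a c" using swap m1 by (metis minus_minus)
  then have "d u a c = 0" using m3[of u a c] double_eq_0 by (metis add.right_inverse)
  then show ?thesis by (simp add: d_def w_def algebra_simps)
qed

text \<open>After \<open>jacobi'\<close> the middle argument is innermost in one term and leftmost
  in the other.\<close>

lemma middle_add: "br u (br (z + z') a) = br u (br z a) + br u (br z' a)"
proof -
  have "br u (br y a) = - br a (br u y) - br y (br a u)" for y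
    by (rule jacobi')
  note J = this
  show ?thesis
    unfolding J[of "z + z'"] J[of z] J[of z'] by (simp add: add_left inner_add)
qed

text \<open>\<open>S\<close> is symmetric in its last two arguments and antisymmetric in its first
  two. The two transpositions are conjugate in the symmetric group on three letters, so
  \<open>S\<close> equals its own negative.\<close>

lemma inner_swap: "br x (br y z) = - br x (br z y)"
proof -
  define S where "S x y z = br x (br y z) + br x (br z y)" for x y z
  have s23: "S x y z = S x z y" for x y z by (simp add: S_def add.commute)
  have S0: "S x x z = 0" for x z by (simp add: S_def double_swap)
  have a12: "S x y z = - S y x z" for x y z
  proof -
    have "S (x + y) (x + y) z = S x x z + S x y z + S y x z + S y y z"
      by (simp add: S_def add_left middle_add[unfolded add_left] inner_add)
    then show ?thesis using S0 by (simp add: eq_neg_iff_add_eq_0)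
  qed
  have "S x y z = - S x y z" by (metis s23 a12 minus_minus)
  then have "S x y z = 0" using double_eq_0 by (metis add.right_inverse)
  then show ?thesis by (simp add: S_def eq_neg_iff_add_eq_0)
qed

text \<open>The same sign conflict for the defect \<open>e\<close>: it is antisymmetric in the outer
  two arguments by \<open>inner_shift\<close>, and symmetric in the first two because
  \<open>s t z\<close> stands on the left in the remaining term of the Jacobi identity.\<close>

lemma inner_scale: "br x (br y (s t z)) = s t (br x (br y z))"
proof -
  define e where "e x y z = br x (br y (s t z)) - s t (br x (br y z))" for x y z
  have e0: "e x y x = 0" for x y
    using inner_shift[of x y 0 t] by (simp add: e_def zero_right)
  have a13: "e x y z = - e z y x" for x y z
  proof -
    have "e (x + z) y (x + z) = e x y x + e x y z + e z y x + e z y z"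
      by (simp add: e_def add_left inner_add scale_right_distrib algebra_simps)
    then show ?thesis using e0 by (simp add: eq_neg_iff_add_eq_0)
  qed
  have s12: "e x y z = e y x z" for x y z
  proof -
    have "br x (br y (s t z)) - br y (br x (s t z)) + s t (br z (br x y)) = 0"
      using jacobi[of x y "s t z"] inner_swap[of y x "s t z"]
      by (simp add: scale_left)
    moreover have "s t (br x (br y z) - br y (br x z) + br z (br x y)) = 0"
      using jacobi[of x y z] inner_swap[of y x z] by simp
    ultimately show ?thesis
      by (simp add: e_def scale_right_distrib scale_right_diff_distrib algebra_simps)
        (metis add_right_cancel add.assoc add.commute add_left_cancel)
  qed
  have "e x y z = - e x y z" by (metis a13 s12 minus_minus)
  then have "e x y z = 0" using double_eq_0 by (metis add.right_inverse)
  then show ?thesis by (simp add: e_def)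
qed

lemma abelian_ideal_solvable:
  assumes "\<And>x y. x \<in> I \<Longrightarrow> y \<in> I \<Longrightarrow> br x y = 0"
  shows "lie_solvable s br I"
proof -
  have "{br x y |x y. x \<in> I \<and> y \<in> I} \<subseteq> {0}" using assms(1) by blast
  then have "derived s br I \<subseteq> {0}"
    unfolding derived_def by (intro span_minimal subspace_single_0)
  then have "derived s br I = {0}" unfolding derived_def using span_zero by blast
  then have "(derived s br ^^ 1) I = {0}" by simp
  then show ?thesis unfolding lie_solvable_def by blast
qed

text \<open>A pitfall of \<^const>\<open>lie_algebra\<close>: only linearity in the first argument is demanded, and without
  further hypotheses the bracket need not be additive in the second one. The double bracket
  \<open>[y, [z, w]]\<close> nevertheless is trilinear, so the elements \<open>w\<close> which it annihilates form an ideal; this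
  ideal contains every additivity defect \<open>[z, a + b] - [z, a] - [z, b]\<close>, and it is \<open>{0}\<close> because the
  lines \<open>\<complex> [z, w]\<close> with \<open>w\<close> in it, and then the ideal itself, are abelian ideals.\<close>
lemma additive_right_if_no_solvable_ideals:
  assumes ss: "\<And>I. lie_ideal s br I \<Longrightarrow> lie_solvable s br I \<Longrightarrow> I = {0}"
  shows "br z (a + b) = br z a + br z b"
proof -
  define Ann where "Ann = {w. \<forall>y z. br y (br z w) = 0}"
  have sub: "subspace Ann"
    by (rule subspaceI) (auto simp: Ann_def zero_right inner_add inner_scale)
  have prod0: "br z w = 0" if w: "w \<in> Ann" for z w
  proof -
    have z: "br x (s t (br z w)) = 0" for x t
      using w scale_left[of t z w] by (auto simp: Ann_def simp flip: scale_left)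
    have "lie_ideal s br (span {br z w})"
      unfolding lie_ideal_def using z subspace_span[of "{br z w}"] span_zero[of "{br z w}"]
      by (auto simp: span_singleton)
    moreover have "lie_solvable s br (span {br z w})"
      using z by (intro abelian_ideal_solvable) (auto simp: span_singleton)
    ultimately have "span {br z w} = {0}" by (rule ss)
    then show ?thesis using span_base[of "br z w" "{br z w}"] by auto
  qed
  have "lie_ideal s br Ann"
    unfolding lie_ideal_def using sub prod0 by (auto simp: subspace_0)
  moreover have "lie_solvable s br Ann"
    using prod0 by (intro abelian_ideal_solvable) auto
  ultimately have Ann0: "Ann = {0}" by (rule ss)
  define d where "d = br z (a + b) - br z a - br z b"
  have "br y (br x d) = 0" for x y
  proof -
    have third_diff: "br y (br x (p - q)) = br y (br x p) - br y (br x q)" for p q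
      using inner_add[of y x "p - q" q] by simp
    \<comment> \<open>Under an outer bracket \<open>c\<close> can be moved to the left slot, where
      additivity is available.\<close>
    have sw: "br x (br z c) = br x (br (- c) z)" for c
    proof -
      have "br x (br (- c) z) = - br x (br c z)"
        using middle_add[of x c "- c" z] by (simp add: zero_left zero_right eq_neg_iff_add_eq_0 add.commute)
      then show ?thesis using inner_swap[of x z c] by simp
    qed
    have "br x (br z (a + b)) = br x (br (- a) z + br (- b) z)"
      using sw[of "a + b"] by (simp add: minus_left diff_left)
    then have "br y (br x (br z (a + b))) = br y (br x (br (- a) z)) + br y (br x (br (- b) z))"
      by (simp add: inner_add)
    then show ?thesis using sw[of a] sw[of b] by (simp add: d_def third_diff)
  qed
  then have "d \<in> Ann" by (simp add: Ann_def)
  then show ?thesis using Ann0 by (simp add: d_def algebra_simps)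
qed

end

lemma left_lieI:
  assumes "lie_algebra s br"
  shows "left_lie s br"
proof -
  have v: "vector_space s"
    and l: "br (s a x + s b y) z = s a (br x z) + s b (br y z)"
    and a: "br x x = 0"
    and j: "br x (br y z) + br y (br z x) + br z (br x y) = 0" for a b x y z
    using assms unfolding lie_algebra_def by simp_all
  interpret vector_space s by (rule v)
  show ?thesis
  proof
    show "br (x + y) z = br x z + br y z" for x y z using l[of 1 x 1 y z] by simp
    show "br (s a x) z = s a (br x z)" for a x z using l[of a x 0 0 z] by simp
  qed (fact a j)+
qed

section \<open>Linear algebra over the complex numbers\<close>

text \<open>By division with remainder, a nonzero element of least degree in the ideal generated by
  the family divides every member.\<close>

lemma bezout_family:
  fixes f :: "'i \<Rightarrow> complex poly"
  assumes I: "finite I"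
  shows "\<exists>u. \<forall>j\<in>I. (\<Sum>i\<in>I. u i * f i) dvd f j"
proof (cases "\<forall>j\<in>I. f j = 0")
  case False
  define J where "J = {g. \<exists>u. g = (\<Sum>i\<in>I. u i * f i)}"
  have unit: "q * f j \<in> J" if "j \<in> I" for q j
  proof -
    have "(\<Sum>i\<in>I. (if i = j then q else 0) * f i) = q * f j"
      using that I by (simp add: if_distrib[of "\<lambda>x. x * _"] cong: if_cong)
    then show ?thesis unfolding J_def by (intro CollectI exI[of _ "\<lambda>i. if i = j then q else 0"]) simp
  qed
  have closed: "g - q * h \<in> J" if gh: "g \<in> J" "h \<in> J" for g h q
  proof -
    obtain u v where "g = (\<Sum>i\<in>I. u i * f i)" "h = (\<Sum>i\<in>I. v i * f i)"
      using gh by (auto simp: J_def)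
    then have "g - q * h = (\<Sum>i\<in>I. (u i - q * v i) * f i)"
      by (simp add: sum_distrib_left sum_subtractf left_diff_distrib mult.assoc)
    then show ?thesis unfolding J_def by (intro CollectI exI[of _ "\<lambda>i. u i - q * v i"])
  qed
  obtain k where "k \<in> I" "f k \<noteq> 0" using False by blast
  then have "\<exists>g. g \<in> J \<and> g \<noteq> 0" using unit[of k 1] by auto
  then obtain g where g: "g \<in> J" "g \<noteq> 0"
    and min: "\<And>h. h \<in> J \<Longrightarrow> h \<noteq> 0 \<Longrightarrow> degree g \<le> degree h"
    using ex_has_least_nat[of "\<lambda>g. g \<in> J \<and> g \<noteq> 0" _ degree] by blast
  have "g dvd f j" if "j \<in> I" for j
  proof (rule ccontr)
    assume n: "\<not> g dvd f j"
    have "f j mod g = 1 * f j - (f j div g) * g" by (simp add: minus_div_mult_eq_mod)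
    then have "f j mod g \<in> J" using closed[OF unit[OF that, of 1] g(1)] by simp
    moreover have "f j mod g \<noteq> 0" using n by (simp add: mod_eq_0_iff_dvd)
    ultimately show False
      using min[of "f j mod g"] degree_mod_less'[of g "f j"] g(2) by (meson not_less)
  qed
  then show ?thesis using g(1) unfolding J_def by auto
qed simp

text \<open>The idempotents of the Chinese remainder theorem for \<open>\<complex>[X]/(p)\<close>.\<close>
lemma polynomial_idempotents:
  fixes p :: "complex poly"
  assumes p: "p \<noteq> 0"
  shows "\<exists>A e. finite A \<and> p dvd (\<Sum>a\<in>A. e a) - 1
    \<and> (\<forall>a\<in>A. \<forall>b\<in>A. a \<noteq> b \<longrightarrow> p dvd e a * e b) \<and> (\<forall>a\<in>A. \<exists>n. p dvd [:- a, 1:] ^ n * e a)"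
proof -
  define A where "A = {a. poly p a = 0}"
  have fin: "finite A" unfolding A_def using p by (rule poly_roots_finite)
  \<comment> \<open>The cofactor of the primary part of \<open>p\<close> at \<open>a\<close>: it
    vanishes to full order at every other root of \<open>p\<close>, but not at
    \<open>a\<close>.\<close>
  define f where "f a = p div [:- a, 1:] ^ order a p" for a
  have f: "[:- a, 1:] ^ order a p * f a = p" for a
    unfolding f_def using order_1[of a p] by simp
  have f0: "f a \<noteq> 0" for a using f[of a] p by auto
  have ord: "order b p = order b ([:- a, 1:] ^ order a p) + order b (f a)" for a b
    using order_mult[of "[:- a, 1:] ^ order a p" "f a" b] f[of a] p by simp
  have ord0: "order a (f a) = 0" for a
    using ord[of a a] by (simp add: order_power_n_n)
  have orde: "order b (f a) = order b p" if "a \<noteq> b" for a b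
    using ord[of b a] that by (simp add: order_0I)
  have ff: "p dvd f a * f b" if "a \<noteq> b" for a b
  proof -
    have "[:- b, 1:] ^ order b p dvd f a"
      using order_1[of b "f a"] orde[OF that] by simp
    then have "[:- b, 1:] ^ order b p * f b dvd f a * f b" by (rule mult_dvd_mono) simp
    then show ?thesis by (simp add: f)
  qed
  obtain u where u: "\<And>j. j \<in> A \<Longrightarrow> (\<Sum>i\<in>A. u i * f i) dvd f j"
    using bezout_family[OF fin, of f] by blast
  define g where "g = (\<Sum>i\<in>A. u i * f i)"
  show ?thesis
  proof (cases "A = {}")
    case True
    then have "degree p = 0"
      using alg_closed_imp_poly_has_root[of p] by (auto simp: A_def)
    then have "p dvd 1" using p by (simp add: is_unit_iff_degree)
    then have "p dvd - 1" by simp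
    then show ?thesis using True by (intro exI[of _ "{}"]) simp
  next
    case False
    \<comment> \<open>A root \<open>c\<close> of \<open>g\<close> would be a common root of all
      cofactors, hence a root of \<open>p\<close>; yet \<open>f c\<close> does not vanish at
      \<open>c\<close>.\<close>
    have "degree g = 0"
    proof (rule ccontr)
      assume "degree g \<noteq> 0"
      then obtain c where c: "poly g c = 0" using alg_closed_imp_poly_has_root[of g] by auto
      have root: "poly (f a) c = 0" if "a \<in> A" for a
        using u[OF that] c by (auto simp: g_def elim!: dvdE)
      obtain a where "a \<in> A" using False by blast
      then have "c \<in> A" using f[of a] root[of a] by (auto simp: A_def) (metis poly_mult mult_zero_right)
      then show False using root[of c] ord0[of c] f0[of c] by (simp add: order_root)
    qed
    moreover have "g \<noteq> 0" using u f0 False by (auto simp: g_def)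
    ultimately have "g dvd 1" by (simp add: is_unit_iff_degree)
    then obtain h where h: "g * h = 1" by (metis dvdE)
    show ?thesis
    proof (intro exI[of _ A] exI[of _ "\<lambda>a. h * u a * f a"] conjI ballI impI)
      have "(\<Sum>a\<in>A. h * u a * f a) = h * g" by (simp add: g_def sum_distrib_left mult.assoc)
      then show "p dvd (\<Sum>a\<in>A. h * u a * f a) - 1" using h by (simp add: mult.commute)
      show "p dvd (h * u a * f a) * (h * u b * f b)" if "a \<noteq> b" for a b
      proof -
        have "(h * u a * f a) * (h * u b * f b) = (h * u a * h * u b) * (f a * f b)"
          by (simp add: ac_simps)
        then show ?thesis using ff[OF that] by (metis dvd_mult)
      qed
      show "\<exists>n. p dvd [:- a, 1:] ^ n * (h * u a * f a)" for a
      proof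
        have "[:- a, 1:] ^ order a p * (h * u a * f a) = (h * u a) * ([:- a, 1:] ^ order a p * f a)"
          by (simp only: ac_simps)
        then show "p dvd [:- a, 1:] ^ order a p * (h * u a * f a)" by (simp only: f) simp
      qed
    qed (fact fin)
  qed
qed

locale fd_cspace = finite_dimensional_vector_space scale Basis
  for scale :: "complex \<Rightarrow> 'v \<Rightarrow> 'v::ab_group_add" and Basis
begin

sublocale self: finite_dimensional_vector_space_pair scale Basis scale Basis ..

definition lin :: "('v \<Rightarrow> 'v) \<Rightarrow> bool" where
  "lin f \<longleftrightarrow> (\<forall>x y. f (x + y) = f x + f y) \<and> (\<forall>c x. f (scale c x) = scale c (f x))"

lemma linI: "(\<And>x y. f (x + y) = f x + f y) \<Longrightarrow> (\<And>c x. f (scale c x) = scale c (f x)) \<Longrightarrow> lin f"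
  by (simp add: lin_def)

lemma lin_add: "lin f \<Longrightarrow> f (x + y) = f x + f y"
  and lin_scale: "lin f \<Longrightarrow> f (scale c x) = scale c (f x)"
  by (simp_all add: lin_def)

lemma lin_linear: "lin f \<longleftrightarrow> Vector_Spaces.linear scale scale f"
  by (auto simp: lin_def Vector_Spaces.linear_iff vector_space_axioms)

lemma lin_zero: "lin f \<Longrightarrow> f 0 = 0"
  using lin_scale[of f 0 0] by simp

lemma lin_minus: "lin f \<Longrightarrow> f (- x) = - f x"
  using lin_scale[of f "-1" x] by simp

lemma lin_diff: "lin f \<Longrightarrow> f (x - y) = f x - f y"
  using lin_add[of f x "- y"] by (simp add: lin_minus)

lemma lin_sum: "lin f \<Longrightarrow> f (\<Sum>i\<in>I. g i) = (\<Sum>i\<in>I. f (g i))"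
  by (induction I rule: infinite_finite_induct) (auto simp: lin_zero lin_add)

lemma lin_comp: "lin f \<Longrightarrow> lin g \<Longrightarrow> lin (\<lambda>x. f (g x))"
  and lin_sum_fun: "(\<And>i. i \<in> I \<Longrightarrow> lin (F i)) \<Longrightarrow> lin (\<lambda>x. \<Sum>i\<in>I. F i x)"
  and lin_diff_fun: "lin f \<Longrightarrow> lin g \<Longrightarrow> lin (\<lambda>x. f x - g x)"
  and lin_scale_fun: "lin f \<Longrightarrow> lin (\<lambda>x. scale c (f x))"
  and lin_id: "lin (\<lambda>x. x)"
  by (auto simp: lin_def sum.distrib scale_right_distrib scale_sum_right scale_right_diff_distrib
      algebra_simps)

lemma lin_funpow: "lin f \<Longrightarrow> lin (f ^^ n)"
  by (induction n) (auto simp: lin_def)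

lemma lin_subspaces:
  assumes "lin f"
  shows "subspace (range f)" "subspace {x. f x = scale c x}"
proof -
  show "subspace (range f)"
  proof (rule subspaceI)
    show "0 \<in> range f" using lin_zero[OF assms] by (metis rangeI)
  qed (use lin_add[OF assms, symmetric] lin_scale[OF assms, symmetric] in auto)
  show "subspace {x. f x = scale c x}"
    using assms by (intro subspaceI) (auto simp: lin_zero lin_add lin_scale scale_right_distrib mult.commute)
qed

abbreviation coord :: "'v \<Rightarrow> 'v \<Rightarrow> complex" where
  "coord v b \<equiv> representation Basis v b"

lemma coord_add: "coord (x + y) b = coord x b + coord y b"
  by (simp add: representation_add independent_Basis span_Basis)

lemma coord_scale: "coord (scale c x) b = c * coord x b"
  by (simp add: representation_scale independent_Basis span_Basis)

lemma coord_0: "coord 0 b = 0"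
  by (simp add: representation_zero)

lemma coord_diff: "coord (x - y) b = coord x b - coord y b"
  by (simp add: representation_diff independent_Basis span_Basis)

lemma coord_sum: "coord (\<Sum>i\<in>I. g i) b = (\<Sum>i\<in>I. coord (g i) b)"
  by (induction I rule: infinite_finite_induct) (auto simp: coord_0 coord_add)

lemma coord_expand: "(\<Sum>b\<in>Basis. scale (coord x b) b) = x"
  by (rule sum_representation_eq) (auto simp: independent_Basis span_Basis finite_Basis)

section \<open>Traces\<close>

definition tr :: "('v \<Rightarrow> 'v) \<Rightarrow> complex" where
  "tr f = (\<Sum>b\<in>Basis. coord (f b) b)"

lemma tr_add: "tr (\<lambda>x. f x + g x) = tr f + tr g"
  and tr_diff: "tr (\<lambda>x. f x - g x) = tr f - tr g"
  and tr_scale: "tr (\<lambda>x. scale c (f x)) = c * tr f"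
  and tr_zero: "tr (\<lambda>x. 0) = 0"
  by (simp_all add: tr_def coord_add coord_diff coord_scale coord_0 sum.distrib sum_subtractf
      sum_distrib_left)

lemma tr_sum: "tr (\<lambda>x. \<Sum>i\<in>I. F i x) = (\<Sum>i\<in>I. tr (F i))"
  unfolding tr_def coord_sum by (rule sum.swap)

lemma coord_comp:
  assumes "lin f"
  shows "coord (f x) b = (\<Sum>c\<in>Basis. coord x c * coord (f c) b)"
proof -
  have "f x = (\<Sum>c\<in>Basis. scale (coord x c) (f c))"
    by (subst (1) coord_expand[of x, symmetric]) (simp add: assms lin_sum lin_scale)
  then show ?thesis by (simp add: coord_sum coord_scale)
qed

lemma tr_comm:
  assumes "lin f" "lin g"
  shows "tr (\<lambda>x. f (g x)) = tr (\<lambda>x. g (f x))"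
proof -
  have "tr (\<lambda>x. f (g x)) = (\<Sum>b\<in>Basis. \<Sum>c\<in>Basis. coord (g b) c * coord (f c) b)"
    unfolding tr_def by (subst coord_comp[OF assms(1)]) simp
  also have "\<dots> = (\<Sum>c\<in>Basis. \<Sum>b\<in>Basis. coord (f c) b * coord (g b) c)"
    by (subst sum.swap) (simp add: mult.commute)
  also have "\<dots> = tr (\<lambda>x. g (f x))"
    unfolding tr_def by (simp add: coord_comp[OF assms(2), of "f _"])
  finally show ?thesis .
qed

lemma tr_rank_one:
  assumes "\<And>x y. h (x + y) = h x + h y" "\<And>c x. h (scale c x) = c * h x"
  shows "tr (\<lambda>x. scale (h x) v) = h v"
proof -
  have h0: "h 0 = 0" using assms(2)[of 0 0] by simp
  have "h (\<Sum>i\<in>I. g i) = (\<Sum>i\<in>I. h (g i))" for I and g :: "'v \<Rightarrow> 'v"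
    by (induction I rule: infinite_finite_induct) (auto simp: h0 assms)
  then have "h v = (\<Sum>b\<in>Basis. coord v b * h b)"
    by (subst coord_expand[of v, symmetric]) (simp add: assms)
  then show ?thesis by (simp add: tr_def coord_scale mult.commute)
qed

lemma projection_exists:
  assumes "subspace U"
  obtains P where "lin P" "\<And>x. P x \<in> U" "\<And>u. u \<in> U \<Longrightarrow> P u = u"
proof -
  have "Vector_Spaces.linear scale scale (\<lambda>x. x)" using lin_id lin_linear by simp
  from self.linear_exists_left_inverse_on[OF this assms] obtain g
    where "g ` UNIV \<subseteq> U" "Vector_Spaces.linear scale scale g" "\<forall>v\<in>U. g v = v" by auto
  then show thesis using that lin_linear by blast
qed

text \<open>With a projection \<open>P\<close> onto the kernel of \<open>N\<close>, the map \<open>(1 - P) N\<close> has the same trace as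
  \<open>N\<close> and a smaller nilpotency index.\<close>
lemma tr_nilpotent:
  assumes "lin N" "\<And>x. (N ^^ k) x = 0"
  shows "tr N = 0"
  using assms
proof (induction k arbitrary: N)
  case 0
  then have "N x = 0" for x by simp
  then show ?case using tr_zero by (simp add: tr_def)
next
  case (Suc k)
  obtain P where P: "lin P" "\<And>x. N (P x) = 0" "\<And>u. N u = 0 \<Longrightarrow> P u = u"
  proof -
    have sub: "subspace {x. N x = 0}" using lin_subspaces(2)[OF Suc.prems(1), of 0] by simp
    show thesis by (rule projection_exists[OF sub]) (rule that, assumption, simp, simp)
  qed
  define M where "M x = N x - P (N x)" for x
  have linM: "lin M" unfolding M_def by (rule lin_diff_fun[OF Suc.prems(1) lin_comp[OF P(1) Suc.prems(1)]])
  have pw: "(M ^^ Suc j) x = (N ^^ Suc j) x - P ((N ^^ Suc j) x)" for j x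
    by (induction j) (simp_all add: M_def lin_diff[OF Suc.prems(1)] P(2))
  have "tr (\<lambda>x. P (N x)) = tr (\<lambda>x. N (P x))" using P(1) Suc.prems(1) by (rule tr_comm)
  also have "\<dots> = 0" by (simp add: P(2) tr_zero)
  finally have "tr M = tr N" unfolding M_def by (simp add: tr_diff)
  moreover have "tr M = 0"
  proof (cases k)
    case 0
    then have "M x = 0" for x using Suc.prems(2)[of x] lin_zero[OF P(1)] by (simp add: M_def)
    then show ?thesis by (simp add: tr_def coord_0)
  next
    case (Suc j)
    have "(M ^^ k) x = 0" for x
      unfolding Suc pw using P(3)[of "(N ^^ Suc j) x"] Suc.prems Suc
      by simp
    then show ?thesis using Suc.IH linM by blast
  qed
  ultimately show ?case by simp
qed

text \<open>\<open>n\<close> is the rank. For \<open>v\<close> in the range and a functional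
  \<open>f\<close> with \<open>f v = 1\<close>, subtracting the rank-one map
  \<open>scale (f (P x)) v\<close> leaves an idempotent with smaller range and lowers the trace by
  \<open>f (P v) = 1\<close>. The clause on \<open>n = 0\<close> later turns a vanishing
  multiplicity into a vanishing projection.\<close>

lemma tr_idempotent:
  assumes "lin P" "\<And>x. P (P x) = P x"
  shows "\<exists>n. tr P = of_nat n \<and> (n = 0 \<longrightarrow> (\<forall>x. P x = 0))"
  using assms
proof (induction "dim (range P)" arbitrary: P rule: less_induct)
  case less
  note P = less.prems
  show ?case
  proof (cases "\<forall>x. P x = 0")
    case True
    then show ?thesis by (intro exI[of _ 0]) (simp add: tr_def coord_0)
  next
    case False
    then obtain v where v: "v \<noteq> 0" "P v = v" using P(2) by metis
    define B where "B = extend_basis {v}"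
    have ind: "independent {v}" using v by simp
    have B: "independent B" "v \<in> B" "span B = UNIV"
      using independent_extend_basis[OF ind] extend_basis_superset[OF ind] span_extend_basis[OF ind]
      by (auto simp: B_def)
    define f where "f x = representation B x v" for x
    have f: "f (x + y) = f x + f y" "f (scale c x) = c * f x" "f v = 1" for x y c
      using B by (simp_all add: f_def representation_add representation_scale representation_basis)
    have fd: "f (x - y) = f x - f y" for x y
      using B by (simp add: f_def representation_diff)
    define P' where "P' x = P x - scale (f (P x)) v" for x
    have linP': "lin P'"
      using P(1) f unfolding P'_def
      by (intro linI) (auto simp: lin_add lin_scale scale_right_diff_distrib scale_left_distrib)
    have idP': "P' (P' x) = P' x" for x
      using v P by (simp add: P'_def lin_diff lin_scale fd f)
    have PP': "P (P' x) = P' x" for x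
      using v P by (simp add: P'_def lin_diff lin_scale)
    have "v \<notin> range P'"
    proof
      assume "v \<in> range P'"
      then have "P' v = v" using idP' by auto
      then show False using v by (simp add: P'_def f)
    qed
    moreover have "range P' \<subseteq> range P" using PP' by (metis image_subsetI rangeI)
    moreover have "v \<in> range P" using v(2) by (metis rangeI)
    ultimately have "range P' \<subset> range P" by blast
    then have "dim (range P') < dim (range P)"
      using lin_subspaces(1)[OF linP'] lin_subspaces(1)[OF P(1)]
      by (intro dim_psubset) (simp add: span_eq_iff[THEN iffD2])
    from less.hyps[OF this linP' idP'] obtain n where n: "tr P' = of_nat n" by blast
    have "tr (\<lambda>x. scale (f (P x)) v) = f (P v)"
      using P f by (intro tr_rank_one) (auto simp: lin_add lin_scale)
    then have "tr P = of_nat (Suc n)"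
      using n v f unfolding P'_def by (simp add: tr_diff diff_eq_eq add.commute)
    then show ?thesis by blast
  qed
qed

section \<open>Generalized eigenspaces\<close>

definition shift :: "('v \<Rightarrow> 'v) \<Rightarrow> complex \<Rightarrow> 'v \<Rightarrow> 'v" where
  "shift T a x = T x - scale a x"

lemma lin_shift: "lin T \<Longrightarrow> lin (shift T a)"
  unfolding shift_def by (intro linI) (auto simp: lin_add lin_scale algebra_simps scale_right_distrib mult.commute)

lemma commute_funpow: "(\<And>x. f (g x) = g (f x)) \<Longrightarrow> f ((g ^^ n) x) = (g ^^ n) (f x)"
  by (induction n) auto

lemma commute_shift: "lin f \<Longrightarrow> f (T x) = T (f x) \<Longrightarrow> f (shift T a x) = shift T a (f x)"
  by (simp add: shift_def lin_diff lin_scale)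

lemma shift_shift: "lin T \<Longrightarrow> shift T a (shift T b x) = shift T b (shift T a x)"
  by (simp add: shift_def lin_diff lin_scale algebra_simps scale_right_diff_distrib)

text \<open>The shifts commute, so \<open>shift T a w\<close> and \<open>shift T b w\<close> satisfy
  the hypotheses with a smaller \<open>m + n\<close>. Both are thus zero, and \<open>w\<close> is an
  eigenvector for \<open>a\<close> and for \<open>b\<close>.\<close>

lemma generalized_eigenvalue_unique:
  assumes T: "lin T" and ab: "a \<noteq> b"
    and "(shift T a ^^ m) w = 0" "(shift T b ^^ n) w = 0"
  shows "w = 0"
  using assms(3,4)
proof (induction "m + n" arbitrary: m n w rule: less_induct)
  case less
  show ?case
  proof (cases "m = 0 \<or> n = 0")
    case True
    then show ?thesis using less.prems by auto
  next
    case False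
    then obtain m' n' where mn: "m = Suc m'" "n = Suc n'" by (metis not0_implies_Suc)
    have "shift T a w = 0"
    proof (rule less.hyps[of m' n])
      show "(shift T a ^^ m') (shift T a w) = 0" using less.prems(1) by (simp add: mn funpow_swap1)
      have "(shift T b ^^ n) (shift T a w) = shift T a ((shift T b ^^ n) w)"
        by (rule commute_funpow[symmetric]) (rule shift_shift[OF T])
      then show "(shift T b ^^ n) (shift T a w) = 0" using less.prems(2) lin_zero[OF lin_shift[OF T]] by simp
    qed (simp add: mn)
    moreover have "shift T b w = 0"
    proof (rule less.hyps[of m n'])
      show "(shift T b ^^ n') (shift T b w) = 0" using less.prems(2) by (simp add: mn funpow_swap1)
      have "(shift T a ^^ m) (shift T b w) = shift T b ((shift T a ^^ m) w)"
        by (rule commute_funpow[symmetric]) (rule shift_shift[OF T])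
      then show "(shift T a ^^ m) (shift T b w) = 0" using less.prems(1) lin_zero[OF lin_shift[OF T]] by simp
    qed (simp add: mn)
    ultimately have "scale a w = scale b w" by (simp add: shift_def)
    then show ?thesis using ab by (metis scale_right_imp_eq)
  qed
qed

section \<open>Polynomials in an operator\<close>

definition pev :: "complex poly \<Rightarrow> ('v \<Rightarrow> 'v) \<Rightarrow> 'v \<Rightarrow> 'v" where
  "pev p T x = (\<Sum>i\<le>degree p. scale (coeff p i) ((T ^^ i) x))"

lemma pev_bound:
  assumes "degree p \<le> n"
  shows "pev p T x = (\<Sum>i\<le>n. scale (coeff p i) ((T ^^ i) x))"
  unfolding pev_def using assms
  by (intro sum.mono_neutral_left) (auto simp: coeff_eq_0)

lemma pev_0: "pev 0 T x = 0"
  by (simp add: pev_def)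

lemma pev_add: "pev (p + q) T x = pev p T x + pev q T x"
  by (subst (1 2 3) pev_bound[of _ "max (degree p) (degree q)"])
    (auto simp: degree_add_le_max scale_left_distrib sum.distrib)

lemma pev_smult: "pev (smult c p) T x = scale c (pev p T x)"
  by (subst (1 2) pev_bound[of _ "degree p"]) (auto simp: degree_smult_le scale_sum_right)

lemma pev_pCons:
  assumes "lin T"
  shows "pev (pCons c p) T x = scale c x + T (pev p T x)"
proof -
  have "pev (pCons c p) T x = (\<Sum>i\<le>Suc (degree p). scale (coeff (pCons c p) i) ((T ^^ i) x))"
    by (rule pev_bound) (rule degree_pCons_le)
  also have "\<dots> = scale c x + (\<Sum>i\<le>degree p. scale (coeff p i) (T ((T ^^ i) x)))"
    by (subst sum.atMost_Suc_shift) simp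
  also have "(\<Sum>i\<le>degree p. scale (coeff p i) (T ((T ^^ i) x))) = T (pev p T x)"
    unfolding pev_def using assms by (simp add: lin_sum lin_scale)
  finally show ?thesis .
qed

lemma lin_pev: "lin T \<Longrightarrow> lin (pev p T)"
  unfolding pev_def by (intro lin_sum_fun lin_scale_fun lin_funpow)

lemma pev_mult: "lin T \<Longrightarrow> pev (p * q) T x = pev p T (pev q T x)"
  by (induction p arbitrary: x) (simp_all add: pev_0 pev_pCons pev_add pev_smult)

lemma pev_1: "pev 1 T x = x"
  by (simp add: pev_def)

lemma pev_diff: "pev (p - q) T x = pev p T x - pev q T x"
  using pev_add[of "p - q" q T x] by simp

lemma pev_sum: "pev (\<Sum>i\<in>I. f i) T x = (\<Sum>i\<in>I. pev (f i) T x)"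
  by (induction I rule: infinite_finite_induct) (auto simp: pev_0 pev_add)

lemma pev_linear_power: "lin T \<Longrightarrow> pev ([:- a, 1:] ^ n) T x = (shift T a ^^ n) x"
proof (induction n arbitrary: x)
  case (Suc n)
  have "pev [:- a, 1:] T y = shift T a y" for y
    using Suc.prems by (simp add: pev_pCons pev_0 lin_zero shift_def)
  then show ?case using Suc by (simp add: pev_mult del: mult_pCons_left)
qed (simp add: pev_1)

lemma pev_commute:
  assumes "lin f" "lin T" "\<And>x. f (T x) = T (f x)"
  shows "f (pev p T x) = pev p T (f x)"
  by (induction p) (simp_all add: assms pev_0 pev_pCons lin_zero lin_add lin_scale)

lemma pev_in_subspace:
  assumes "subspace W" "lin T" "\<And>x. x \<in> W \<Longrightarrow> T x \<in> W" "x \<in> W"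
  shows "pev p T x \<in> W"
  by (induction p) (simp_all add: assms pev_0 pev_pCons subspace_0 subspace_add subspace_scale)

text \<open>The \<open>n + 1\<close> iterates \<open>g i\<close> cannot be independent in dimension
  \<open>n\<close>. A repetition among them is treated apart, because dependence is a property of
  the set of values and would not see it.\<close>

lemma local_annihilator_exists: "\<exists>p. p \<noteq> 0 \<and> pev p T v = 0"
proof -
  define n where "n = card Basis"
  define g where "g i = (T ^^ i) v" for i :: nat
  obtain c where c: "\<exists>i\<le>n. c i \<noteq> 0" "(\<Sum>i\<le>n. scale (c i) (g i)) = 0"
  proof (cases "inj_on g {..n}")
    case True
    have "card (g ` {..n}) > card Basis" using True by (simp add: card_image n_def)
    then have "dependent (g ` {..n})"
      using independent_bound_general[of "g ` {..n}"] dim_subset_UNIV[of "g ` {..n}"]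
      by (auto simp: dimension_def)
    then obtain u where u: "\<exists>w\<in>g ` {..n}. u w \<noteq> 0" "(\<Sum>w\<in>g ` {..n}. scale (u w) w) = 0"
      using dependent_finite[of "g ` {..n}"] by auto
    then show thesis using that[of "\<lambda>i. u (g i)"] by (auto simp: sum.reindex[OF True])
  next
    case False
    then obtain i j where ij: "i \<le> n" "j \<le> n" "i \<noteq> j" "g i = g j" by (auto simp: inj_on_def)
    define c :: "nat \<Rightarrow> complex" where "c k = (if k = i then 1 else 0) - (if k = j then 1 else 0)" for k
    have "(\<Sum>k\<le>n. scale (c k) (g k)) =
        (\<Sum>k\<le>n. if k = i then g k else 0) - (\<Sum>k\<le>n. if k = j then g k else 0)"
      unfolding sum_subtractf[symmetric] by (rule sum.cong) (auto simp: c_def)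
    also have "\<dots> = 0" using ij by simp
    finally show thesis using ij by (intro that[of c] exI[of _ i]) (auto simp: c_def)
  qed
  define p where "p = (\<Sum>i\<le>n. monom (c i) i)"
  have co: "coeff p j = (if j \<le> n then c j else 0)" for j
    by (auto simp: p_def coeff_sum coeff_monom sum.delta)
  have "degree p \<le> n" by (rule degree_le) (simp add: co)
  then have "pev p T v = 0" using c(2) by (simp add: pev_bound co g_def)
  moreover have "p \<noteq> 0" using c(1) co by (metis coeff_0)
  ultimately show ?thesis by blast
qed

lemma annihilator_exists:
  assumes "lin T"
  shows "\<exists>p. p \<noteq> 0 \<and> (\<forall>x. pev p T x = 0)"
proof -
  obtain q where q: "\<And>b. q b \<noteq> 0 \<and> pev (q b) T b = 0"
    using local_annihilator_exists by metis
  define p where "p = (\<Prod>b\<in>Basis. q b)"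
  have b: "pev p T b = 0" if "b \<in> Basis" for b
  proof -
    have "p = (\<Prod>b\<in>Basis - {b}. q b) * q b"
      unfolding p_def by (subst prod.remove[OF finite_Basis that]) (simp add: mult.commute)
    then show ?thesis using q by (simp add: pev_mult assms lin_zero[OF lin_pev])
  qed
  have "pev p T x = 0" for x
    by (subst coord_expand[of x, symmetric])
      (simp add: lin_sum[OF lin_pev[OF assms]] lin_scale[OF lin_pev[OF assms]] b)
  moreover have "p \<noteq> 0" using q by (simp add: p_def finite_Basis)
  ultimately show ?thesis by blast
qed

text \<open>A polynomial of least degree annihilating \<open>w\<close> has a root \<open>a\<close>.
  Its cofactor \<open>q\<close> does not annihilate \<open>w\<close>, so \<open>pev q T w\<close> is
  an eigenvector, and it stays in \<open>W\<close>.\<close>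

lemma eigenvector_exists:
  assumes T: "lin T" and W: "subspace W" "\<And>x. x \<in> W \<Longrightarrow> T x \<in> W" and w: "w \<in> W" "w \<noteq> 0"
  obtains v c where "v \<in> W" "v \<noteq> 0" "T v = scale c v"
proof -
  define d where "d = (LEAST d. \<exists>p. p \<noteq> 0 \<and> pev p T w = 0 \<and> degree p = d)"
  have "\<exists>p. p \<noteq> 0 \<and> pev p T w = 0 \<and> degree p = d"
    unfolding d_def by (rule LeastI_ex) (use local_annihilator_exists in blast)
  then obtain p where p: "p \<noteq> 0" "pev p T w = 0" "degree p = d" by blast
  have "degree p > 0"
  proof (rule ccontr)
    assume "\<not> degree p > 0"
    then have "pev p T w = scale (coeff p 0) w" "coeff p 0 \<noteq> 0"
      using p(1) by (auto simp: pev_def leading_coeff_0_iff[symmetric] simp del: leading_coeff_0_iff)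
    then show False using p(2) w(2) by simp
  qed
  then obtain a where "poly p a = 0" using alg_closed_imp_poly_has_root by blast
  then obtain q where q: "p = [:- a, 1:] * q" by (auto simp: poly_eq_0_iff_dvd elim: dvdE)
  then have "q \<noteq> 0" using p(1) by auto
  then have "degree q < d"
    using p(3) unfolding q by (subst (asm) degree_mult_eq) auto
  then have "pev q T w \<noteq> 0"
    using \<open>q \<noteq> 0\<close> not_less_Least[of "degree q" "\<lambda>d. \<exists>p. p \<noteq> 0 \<and> pev p T w = 0 \<and> degree p = d"]
    unfolding d_def by blast
  moreover have "shift T a (pev q T w) = 0"
    using p(2) pev_linear_power[OF T, of a 1] unfolding q pev_mult[OF T] by simp
  moreover have "pev q T w \<in> W" using W(1) T W(2) w(1) by (rule pev_in_subspace)
  ultimately show thesis using that by (simp add: shift_def)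
qed

text \<open>If some \<open>f\<close> is not scalar on \<open>W\<close>, it has a nonzero proper
  eigenspace in \<open>W\<close>; commutativity makes this eigenspace stable under \<open>F\<close>,
  so its dimension can be used for induction.\<close>

lemma joint_eigenvector_exists:
  assumes F: "\<And>f. f \<in> F \<Longrightarrow> lin f" "\<And>f g x. f \<in> F \<Longrightarrow> g \<in> F \<Longrightarrow> f (g x) = g (f x)"
    and "subspace W" "\<And>f x. f \<in> F \<Longrightarrow> x \<in> W \<Longrightarrow> f x \<in> W" "w \<in> W" "w \<noteq> 0"
  shows "\<exists>v\<in>W. v \<noteq> 0 \<and> (\<forall>f\<in>F. \<exists>c. f v = scale c v)"
  using assms(3-6)
proof (induction "dim W" arbitrary: W w rule: less_induct)
  case less
  show ?case
  proof (cases "\<forall>f\<in>F. \<exists>c. \<forall>x\<in>W. f x = scale c x")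
    case True
    then show ?thesis using less.prems by blast
  next
    case False
    then obtain f where f: "f \<in> F" "\<And>c. \<exists>x\<in>W. f x \<noteq> scale c x" by blast
    obtain v c where v: "v \<in> W" "v \<noteq> 0" "f v = scale c v"
      using eigenvector_exists[OF F(1)[OF f(1)] less.prems(1) less.prems(2)[OF f(1)] less.prems(3,4)]
      by blast
    define W' where "W' = W \<inter> {x. f x = scale c x}"
    have sub: "subspace W'"
      unfolding W'_def using less.prems(1) lin_subspaces(2)[OF F(1)[OF f(1)]] by (rule subspace_inter)
    have "W' \<subset> W" using f(2)[of c] by (auto simp: W'_def)
    then have "dim W' < dim W"
      using sub less.prems(1) by (intro dim_psubset) (simp add: span_eq_iff[THEN iffD2])
    moreover have "g x \<in> W'" if "g \<in> F" "x \<in> W'" for g x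
      using that less.prems(2)[of g x] F(1)[of g] F(2)[OF f(1), of g x] by (auto simp: W'_def lin_scale)
    moreover have "v \<in> W'" using v by (simp add: W'_def)
    ultimately show ?thesis using less.hyps[of W' v] sub v(2) by (auto simp: W'_def)
  qed
qed

text \<open>\<open>Q a\<close> is the projection onto the generalized eigenspace of
  \<open>a\<close>. It may be zero: \<open>A\<close> can contain numbers that are not eigenvalues.
  The last clause stands in for the fact that \<open>Q a\<close> is a polynomial in
  \<open>T\<close>.\<close>

definition spectral :: "('v \<Rightarrow> 'v) \<Rightarrow> complex set \<Rightarrow> (complex \<Rightarrow> 'v \<Rightarrow> 'v) \<Rightarrow> bool" where
  "spectral T A Q \<longleftrightarrow> finite A \<and> (\<forall>a\<in>A. lin (Q a)) \<and> (\<forall>x. (\<Sum>a\<in>A. Q a x) = x)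
    \<and> (\<forall>a\<in>A. \<forall>b\<in>A. \<forall>x. Q a (Q b x) = (if a = b then Q b x else 0))
    \<and> (\<forall>a\<in>A. \<exists>n. \<forall>x. (shift T a ^^ n) (Q a x) = 0)
    \<and> (\<forall>f. lin f \<longrightarrow> (\<forall>x. f (T x) = T (f x)) \<longrightarrow> (\<forall>a\<in>A. \<forall>x. f (Q a x) = Q a (f x)))"

text \<open>Substituting \<open>T\<close> into the idempotents for an annihilating polynomial
  \<open>p\<close> turns congruences modulo \<open>p\<close> into equations between
  operators.\<close>

lemma spectral_exists:
  assumes T: "lin T"
  obtains A Q where "spectral T A Q"
proof -
  obtain p where p: "p \<noteq> 0" "\<And>x. pev p T x = 0" using annihilator_exists[OF T] by blast
  obtain A e where "finite A \<and> p dvd (\<Sum>a\<in>A. e a) - 1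
    \<and> (\<forall>a\<in>A. \<forall>b\<in>A. a \<noteq> b \<longrightarrow> p dvd e a * e b) \<and> (\<forall>a\<in>A. \<exists>n. p dvd [:- a, 1:] ^ n * e a)"
    using polynomial_idempotents[OF p(1)] by (elim exE)
  then have A: "finite A" and e1: "p dvd (\<Sum>a\<in>A. e a) - 1"
    and e2: "\<And>a b. a \<in> A \<Longrightarrow> b \<in> A \<Longrightarrow> a \<noteq> b \<Longrightarrow> p dvd e a * e b"
    and e3: "\<And>a. a \<in> A \<Longrightarrow> \<exists>n. p dvd [:- a, 1:] ^ n * e a"
    by simp_all
  have dvd0: "pev q T x = 0" if "p dvd q" for q x
  proof -
    obtain r where "q = p * r" using \<open>p dvd q\<close> unfolding dvd_def by (elim exE)
    then show ?thesis using p(2) by (simp add: pev_mult[OF T])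
  qed
  have sum: "(\<Sum>a\<in>A. pev (e a) T x) = x" for x
    using dvd0[OF e1, of x] by (simp add: pev_diff pev_sum pev_1)
  have orth: "pev (e a) T (pev (e b) T x) = 0" if "a \<in> A" "b \<in> A" "a \<noteq> b" for a b x
    using dvd0[OF e2[OF that], of x] by (simp add: pev_mult[OF T])
  have idem: "pev (e b) T (pev (e b) T x) = pev (e b) T x" if "b \<in> A" for b x
  proof -
    have "pev (e b) T x = (\<Sum>a\<in>A. pev (e a) T (pev (e b) T x))" by (simp add: sum)
    also have "\<dots> = pev (e b) T (pev (e b) T x) + (\<Sum>a\<in>A - {b}. pev (e a) T (pev (e b) T x))"
      by (rule sum.remove[OF A that])
    also have "(\<Sum>a\<in>A - {b}. pev (e a) T (pev (e b) T x)) = 0"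
      using orth that by (intro sum.neutral) auto
    finally show ?thesis unfolding add_0_right by (rule sym)
  qed
  have "spectral T A (\<lambda>a. pev (e a) T)"
    unfolding spectral_def
  proof (intro conjI ballI allI impI)
    show "\<exists>n. \<forall>x. (shift T a ^^ n) (pev (e a) T x) = 0" if "a \<in> A" for a
    proof -
      obtain n where "p dvd [:- a, 1:] ^ n * e a" using e3[OF \<open>a \<in> A\<close>] by blast
      from dvd0[OF this] show ?thesis by (auto simp: pev_mult[OF T] pev_linear_power[OF T])
    qed
  qed (use A sum orth idem T in \<open>auto intro: lin_pev pev_commute\<close>)
  then show thesis by (rule that)
qed

context
  fixes T A Q
  assumes T: "lin T" and spec: "spectral T A Q"
begin

lemma spectral_finite: "finite A"
  and spectral_lin: "a \<in> A \<Longrightarrow> lin (Q a)"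
  and spectral_sum: "(\<Sum>a\<in>A. Q a x) = x"
  and spectral_orth: "a \<in> A \<Longrightarrow> b \<in> A \<Longrightarrow> Q a (Q b x) = (if a = b then Q b x else 0)"
  and spectral_nilp: "a \<in> A \<Longrightarrow> \<exists>n. \<forall>x. (shift T a ^^ n) (Q a x) = 0"
  and spectral_commute: "a \<in> A \<Longrightarrow> lin f \<Longrightarrow> (\<And>x. f (T x) = T (f x)) \<Longrightarrow> f (Q a x) = Q a (f x)"
  using spec unfolding spectral_def by blast+

text \<open>\<open>Q b w\<close> is annihilated by powers of both \<open>shift T b\<close> and
  \<open>shift T d\<close>, hence zero for \<open>b \<noteq> d\<close>; only the component at
  \<open>d\<close> is left to sum up to \<open>w\<close>.\<close>

lemma spectral_eigen:
  assumes "(shift T d ^^ n) w = 0" "b \<in> A"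
  shows "Q b w = (if b = d then w else 0)"
proof -
  have z: "Q b w = 0" if "b \<in> A" "b \<noteq> d" for b
  proof -
    obtain m where m: "(shift T b ^^ m) (Q b w) = 0" using spectral_nilp[OF \<open>b \<in> A\<close>] by blast
    have "Q b ((shift T d ^^ n) w) = (shift T d ^^ n) (Q b w)"
      using spectral_lin[OF \<open>b \<in> A\<close>] spectral_commute[OF \<open>b \<in> A\<close> T]
      by (intro commute_funpow commute_shift) auto
    then have "(shift T d ^^ n) (Q b w) = 0" using assms(1) lin_zero[OF spectral_lin[OF \<open>b \<in> A\<close>]] by simp
    then show ?thesis using generalized_eigenvalue_unique[OF T that(2) m] by blast
  qed
  have "(\<Sum>a\<in>A. Q a w) = Q d w" if "d \<in> A"
  proof -
    have "(\<Sum>a\<in>A. Q a w) = (\<Sum>a\<in>{d}. Q a w)"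
      using that z spectral_finite by (intro sum.mono_neutral_right) auto
    then show ?thesis by simp
  qed
  then show ?thesis using z[OF assms(2)] assms(2) by (auto simp: spectral_sum)
qed

text \<open>On the range of \<open>Q a\<close> the operator \<open>T\<close> is the scalar
  \<open>a\<close> plus a nilpotent part. Composition with the commuting maps \<open>P\<close> and
  \<open>Q a\<close> keeps that part nilpotent, so it contributes nothing to the trace.\<close>

lemma tr_spectral:
  assumes P: "lin P" "\<And>x. P (T x) = T (P x)"
  shows "tr (\<lambda>x. P (T x)) = (\<Sum>a\<in>A. a * tr (\<lambda>x. P (Q a x)))"
proof -
  have nil: "tr (\<lambda>x. P (shift T a (Q a x))) = 0" if a: "a \<in> A" for a
  proof -
    define N where "N x = P (shift T a (Q a x))" for x
    have linN: "lin N" unfolding N_def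
      by (rule lin_comp[OF P(1)], rule lin_comp[OF lin_shift[OF T] spectral_lin[OF a]])
    have cQ: "Q a (shift T a x) = shift T a (Q a x)" "Q a (P x) = P (Q a x)" for x
      using spectral_lin[OF a] spectral_commute[OF a T] spectral_commute[OF a P(1)] P
      by (auto intro: commute_shift)
    have cP: "P (shift T a x) = shift T a (P x)" for x by (rule commute_shift) (use P in auto)
    have pw: "(N ^^ Suc k) x = (P ^^ Suc k) ((shift T a ^^ Suc k) (Q a x))" for k x
    proof (induction k)
      case (Suc k)
      have Qpow: "Q a ((P ^^ i) ((shift T a ^^ j) (Q a x))) = (P ^^ i) ((shift T a ^^ j) (Q a x))" for i j
        using commute_funpow[of "Q a" P i] commute_funpow[of "Q a" "shift T a" j] cQ
          spectral_orth[OF a a, of x] by simp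
      have "(N ^^ Suc (Suc k)) x = N ((P ^^ Suc k) ((shift T a ^^ Suc k) (Q a x)))"
        using Suc by simp
      also have "\<dots> = P (shift T a ((P ^^ Suc k) ((shift T a ^^ Suc k) (Q a x))))"
        unfolding N_def by (simp only: Qpow)
      also have "shift T a ((P ^^ Suc k) ((shift T a ^^ Suc k) (Q a x))) =
          (P ^^ Suc k) (shift T a ((shift T a ^^ Suc k) (Q a x)))"
        by (rule commute_funpow) (simp add: cP)
      finally show ?case by simp
    qed (simp add: N_def)
    obtain n where n: "\<And>x. (shift T a ^^ n) (Q a x) = 0" using spectral_nilp[OF a] by blast
    have "(shift T a ^^ Suc n) (Q a x) = 0" for x
      using n lin_zero[OF lin_shift[OF T]] by simp
    then have "(N ^^ Suc n) x = 0" for x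
      unfolding pw using lin_zero[OF lin_funpow[OF P(1)], of "Suc n"] by (simp only:)
    then have "tr N = 0" using linN by (rule tr_nilpotent[rotated])
    then show ?thesis unfolding N_def[abs_def] .
  qed
  have "P (T x) = (\<Sum>a\<in>A. scale a (P (Q a x)) + P (shift T a (Q a x)))" for x
  proof -
    have "P (T x) = P (T (\<Sum>a\<in>A. Q a x))" by (simp add: spectral_sum)
    also have "\<dots> = (\<Sum>a\<in>A. P (T (Q a x)))" by (simp add: lin_sum[OF T] lin_sum[OF P(1)])
    also have "\<dots> = (\<Sum>a\<in>A. scale a (P (Q a x)) + P (shift T a (Q a x)))"
      by (rule sum.cong) (auto simp: shift_def lin_diff[OF P(1)] lin_scale[OF P(1)])
    finally show ?thesis .
  qed
  then have "tr (\<lambda>x. P (T x)) = (\<Sum>a\<in>A. a * tr (\<lambda>x. P (Q a x)) + tr (\<lambda>x. P (shift T a (Q a x))))"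
    by (simp add: tr_sum tr_add tr_scale)
  then show ?thesis by (simp add: nil)
qed

lemma tr_spectral_projection:
  assumes "a \<in> A"
  shows "\<exists>n. tr (Q a) = of_nat n \<and> (n = 0 \<longrightarrow> (\<forall>x. Q a x = 0))"
  using assms by (intro tr_idempotent) (auto simp: spectral_lin spectral_orth)

end

end

section \<open>Lie algebras and their representations\<close>

definition rat_functional :: "(complex \<Rightarrow> rat) \<Rightarrow> bool" where
  "rat_functional \<phi> \<longleftrightarrow> (\<forall>x y. \<phi> (x + y) = \<phi> x + \<phi> y) \<and> (\<forall>q x. \<phi> (of_rat q * x) = q * \<phi> x)"

text \<open>The \<open>a\<close>-coordinate in a Hamel basis of \<complex> over \<rat> that contains
  \<open>a\<close>.\<close>

lemma rat_functional_separates: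
  assumes "a \<noteq> 0"
  obtains \<phi> where "rat_functional \<phi>" "\<phi> a \<noteq> 0"
proof -
  interpret R: vector_space "\<lambda>(q::rat) (z::complex). of_rat q * z"
    by unfold_locales (auto simp: algebra_simps of_rat_add of_rat_mult)
  have ind: "R.independent {a}" using assms by simp
  define B where "B = R.extend_basis {a}"
  have B: "R.independent B" "a \<in> B" "R.span B = UNIV"
    using R.independent_extend_basis[OF ind] R.extend_basis_superset[OF ind]
      R.span_extend_basis[OF ind] by (auto simp: B_def)
  show thesis
  proof (rule that[of "\<lambda>z. R.representation B z a"])
    show "rat_functional (\<lambda>z. R.representation B z a)"
      unfolding rat_functional_def using B
      by (simp add: R.representation_add R.representation_scale)
    show "R.representation B a a \<noteq> 0" using B by (simp add: R.representation_basis)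
  qed
qed

lemma rat_functional_add: "rat_functional \<phi> \<Longrightarrow> \<phi> (x + y) = \<phi> x + \<phi> y"
  and rat_functional_scale: "rat_functional \<phi> \<Longrightarrow> \<phi> (x * of_rat q) = \<phi> x * q"
  unfolding rat_functional_def by (auto simp: mult.commute)

lemma rat_functional_0: "rat_functional \<phi> \<Longrightarrow> \<phi> 0 = 0"
  using rat_functional_scale[of \<phi> 0 0] by simp

lemma rat_functional_sum: "rat_functional \<phi> \<Longrightarrow> \<phi> (\<Sum>i\<in>I. f i) = (\<Sum>i\<in>I. \<phi> (f i))"
  by (induction I rule: infinite_finite_induct) (auto simp: rat_functional_0 rat_functional_add)

lemma rat_functional_nat: "rat_functional \<phi> \<Longrightarrow> \<phi> (x * of_nat n) = \<phi> x * of_nat n"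
  using rat_functional_scale[of \<phi> x "of_nat n"] by simp

section \<open>Replicas of an operator\<close>

context fd_cspace
begin

text \<open>The nilpotent part of the underlying operator is dropped: the replica is the scalar
  \<open>\<phi> a\<close> on the whole generalized eigenspace of \<open>a\<close>.\<close>

definition replica :: "(complex \<Rightarrow> complex) \<Rightarrow> complex set \<Rightarrow> (complex \<Rightarrow> 'v \<Rightarrow> 'v) \<Rightarrow> 'v \<Rightarrow> 'v" where
  "replica \<phi> A Q x = (\<Sum>a\<in>A. scale (\<phi> a) (Q a x))"

lemma spectral_eigen_mem:
  assumes "lin T" "spectral T A Q" "(shift T d ^^ n) w = 0" "w \<noteq> 0"
  shows "d \<in> A" "Q d w = w"
proof -
  show "d \<in> A"
  proof (rule ccontr)
    assume "d \<notin> A"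
    then have "(\<Sum>a\<in>A. Q a w) = 0"
      using spectral_eigen[OF assms(1-3)] by (intro sum.neutral) auto
    then show False using spectral_sum[OF assms(1,2)] assms(4) by simp
  qed
  then show "Q d w = w" using spectral_eigen[OF assms(1-3)] by simp
qed

lemma replica_eigen:
  assumes "lin T" "spectral T A Q" "(shift T d ^^ n) w = 0"
  shows "replica \<phi> A Q w = scale (\<phi> d) w"
proof (cases "w = 0")
  case True
  then show ?thesis
    using spectral_lin[OF assms(1,2)] by (simp add: replica_def lin_zero)
next
  case False
  note d = spectral_eigen_mem[OF assms False]
  have "replica \<phi> A Q w = (\<Sum>a\<in>{d}. scale (\<phi> a) (Q a w))"
    unfolding replica_def using d spectral_finite[OF assms(1,2)] spectral_eigen[OF assms]
    by (intro sum.mono_neutral_right) auto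
  then show ?thesis using d by simp
qed

lemma lin_replica: "lin T \<Longrightarrow> spectral T A Q \<Longrightarrow> lin (replica \<phi> A Q)"
  unfolding replica_def[abs_def] by (intro lin_sum_fun lin_scale_fun spectral_lin)

lemma replica_projection:
  assumes "lin T" "spectral T A Q" "a \<in> A"
  shows "replica \<phi> A Q (Q a x) = scale (\<phi> a) (Q a x)"
  using spectral_nilp[OF assms] replica_eigen[OF assms(1,2)] by blast

lemma tr_comp_replica:
  assumes "lin P"
  shows "tr (\<lambda>x. P (replica \<phi> A Q x)) = (\<Sum>a\<in>A. \<phi> a * tr (\<lambda>x. P (Q a x)))"
  unfolding replica_def using assms by (simp add: lin_sum lin_scale tr_sum tr_scale)

text \<open>The vectors whose \<open>a\<close>-component is a true eigenvector form a subspace that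
  contains all eigenvectors, hence everything.\<close>

lemma diagonalizable_eigen:
  assumes T: "lin T" and sp: "span {y. \<exists>c. T y = scale c y} = UNIV"
    and "(shift T a ^^ n) z = 0"
  shows "T z = scale a z"
proof (cases "z = 0")
  case False
  obtain A Q where s: "spectral T A Q" using spectral_exists[OF T] .
  have a: "a \<in> A" and z: "Q a z = z" using spectral_eigen_mem[OF T s assms(3) False] .
  define W where "W = {x. T (Q a x) = scale a (Q a x)}"
  have "subspace W"
    unfolding W_def using T spectral_lin[OF T s a]
    by (intro subspaceI) (auto simp: lin_zero lin_add lin_scale scale_right_distrib mult.commute)
  moreover have "{y. \<exists>c. T y = scale c y} \<subseteq> W"
  proof
    fix y assume "y \<in> {y. \<exists>c. T y = scale c y}"
    then obtain c where c: "T y = scale c y" by blast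
    then have "(shift T c ^^ 1) y = 0" by (simp add: shift_def)
    from spectral_eigen[OF T s this a] show "y \<in> W" using c T by (auto simp: W_def lin_zero)
  qed
  ultimately have "span {y. \<exists>c. T y = scale c y} \<subseteq> W" by (rule span_minimal[rotated])
  then have "z \<in> W" using sp by blast
  then show ?thesis using z by (simp add: W_def)
qed (simp add: lin_zero[OF T])

end

section \<open>Bilinear brackets and representations\<close>

locale lie_alg = fd_cspace sg Bg + left_lie sg br
  for sg :: "complex \<Rightarrow> 'g \<Rightarrow> 'g::ab_group_add" and Bg br +
  assumes add_right: "br z (a + b) = br z a + br z b"
begin

lemma antisym: "br x y = - br y x"
proof -
  have "br (x + y) (x + y) = br x y + br y x"
    unfolding add_left add_right by (simp add: alt)
  then have "br x y + br y x = 0" by (simp add: alt)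
  then show ?thesis by (rule eq_neg_iff_add_eq_0[THEN iffD2])
qed

lemma scale_right: "br x (sg c y) = sg c (br x y)"
  by (subst (1 2) antisym) (simp add: scale_left)

lemma lin_ad: "lin (br x)"
  by (rule linI) (simp_all add: add_right scale_right)

lemma minus_right: "br x (- y) = - br x y"
  and diff_right: "br x (y - z) = br x y - br x z"
  using lin_minus[OF lin_ad] lin_diff[OF lin_ad] by auto

lemma leibniz: "br x (br y z) = br (br x y) z + br y (br x z)"
  unfolding jacobi'[of x y z] antisym[of z "br x y"] antisym[of z x] by (simp add: minus_right)

lemma ad_br: "br (br x y) z = br x (br y z) - br y (br x z)"
  by (simp add: leibniz[of x y z])

end

locale lie_rep = lie_alg sg Bg br + V: fd_cspace sv Bv
  for sg :: "complex \<Rightarrow> 'g \<Rightarrow> 'g::ab_group_add" and Bg br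
    and sv :: "complex \<Rightarrow> 'v \<Rightarrow> 'v::ab_group_add" and Bv +
  fixes act :: "'g \<Rightarrow> 'v \<Rightarrow> 'v"
  assumes act_add: "act (x + y) v = act x v + act y v"
    and act_scale: "act (sg c x) v = sv c (act x v)"
    and lin_act: "V.lin (act x)"
    and act_br: "act (br x y) v = act x (act y v) - act y (act x v)"
begin

lemma act_zero: "act 0 v = 0"
  using act_scale[of 0 0 v] by simp

lemma act_sum: "act (\<Sum>i\<in>I. f i) v = (\<Sum>i\<in>I. act (f i) v)"
  by (induction I rule: infinite_finite_induct) (auto simp: act_zero act_add)

lemma act_diff: "act (x - y) v = act x v - act y v"
  using act_add[of "x - y" y v] by simp

text \<open>By the Leibniz rule, the shift by \<open>a + b\<close> of \<open>act x v\<close> is the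
  sum of two terms in which one factor is shifted by its own eigenvalue. Each term has one exponent
  lowered, and an exponent 0 means that \<open>x\<close> or \<open>v\<close> is zero.\<close>

lemma act_generalized_eigen:
  assumes "(shift (br h) a ^^ m) x = 0" "(V.shift (act h) b ^^ n) v = 0"
  shows "(V.shift (act h) (a + b) ^^ (m + n)) (act x v) = 0"
  using assms
proof (induction "m + n" arbitrary: m n x v rule: less_induct)
  case less
  have zero: "(V.shift (act h) (a + b) ^^ k) 0 = 0" for k
    by (rule V.lin_zero[OF V.lin_funpow[OF V.lin_shift[OF lin_act]]])
  show ?case
  proof (cases "m = 0 \<or> n = 0")
    case True
    then have "act x v = 0" using less.prems V.lin_zero[OF lin_act] by (auto simp: act_zero)
    then show ?thesis by (simp add: zero)
  next
    case False
    then obtain m' n' where mn: "m = Suc m'" "n = Suc n'" by (metis not0_implies_Suc)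
    have "V.shift (act h) (a + b) (act x v) =
        act (shift (br h) a x) v + act x (V.shift (act h) b v)"
      unfolding shift_def V.shift_def
      by (simp add: act_br act_diff act_scale V.lin_diff[OF lin_act] V.lin_scale[OF lin_act]
          V.scale_left_distrib)
    moreover have "(V.shift (act h) (a + b) ^^ (m' + n)) (act (shift (br h) a x) v) = 0"
      using less.prems by (intro less.hyps) (auto simp: mn funpow_swap1)
    moreover have "(V.shift (act h) (a + b) ^^ (m + n')) (act x (V.shift (act h) b v)) = 0"
      using less.prems by (intro less.hyps) (auto simp: mn funpow_swap1)
    moreover have "m + n' = m' + n" "m + n = Suc (m' + n)" by (simp_all add: mn)
    ultimately show ?thesis
      by (simp only: funpow_Suc_right comp_apply V.lin_add[OF V.lin_funpow[OF V.lin_shift[OF lin_act]]]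
          add_0_left)
  qed
qed

text \<open>When \<open>x\<close> and \<open>v\<close> are generalized eigenvectors for
  \<open>a\<close> and \<open>b\<close>, \<open>act x v\<close> is one for \<open>a + b\<close>, and
  additivity of \<open>\<phi>\<close> is the Leibniz rule. The general case follows by decomposing
  \<open>x\<close> and \<open>v\<close>.\<close>

lemma replica_act:
  assumes \<phi>: "\<And>a b. \<phi> (a + b) = \<phi> a + \<phi> b"
    and s: "spectral (br h) A Q" and s': "V.spectral (act h) A' Q'"
  shows "V.replica \<phi> A' Q' (act x v) = act (replica \<phi> A Q x) v + act x (V.replica \<phi> A' Q' v)"
proof -
  let ?D = "replica \<phi> A Q" and ?E = "V.replica \<phi> A' Q'"
  have E: "V.lin ?E" by (rule V.lin_replica[OF lin_act s'])
  have D: "lin ?D" by (rule lin_replica[OF lin_ad s])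
  have pair: "?E (act (Q a x) (Q' b v)) = act (?D (Q a x)) (Q' b v) + act (Q a x) (?E (Q' b v))"
    if ab: "a \<in> A" "b \<in> A'" for a b
  proof -
    obtain m where m: "(shift (br h) a ^^ m) (Q a x) = 0"
      using spectral_nilp[OF lin_ad s ab(1)] by blast
    obtain n where n: "(V.shift (act h) b ^^ n) (Q' b v) = 0"
      using V.spectral_nilp[OF lin_act s' ab(2)] by blast
    show ?thesis
      using V.replica_eigen[OF lin_act s' act_generalized_eigen[OF m n], of \<phi>]
        replica_eigen[OF lin_ad s m, of \<phi>] V.replica_eigen[OF lin_act s' n, of \<phi>]
      by (simp add: \<phi> act_scale V.lin_scale[OF lin_act] V.scale_left_distrib)
  qed
  have x: "(\<Sum>a\<in>A. Q a x) = x" and v: "(\<Sum>b\<in>A'. Q' b v) = v"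
    by (rule spectral_sum[OF lin_ad s], rule V.spectral_sum[OF lin_act s'])
  have "?E (act (\<Sum>a\<in>A. Q a x) (\<Sum>b\<in>A'. Q' b v)) =
      (\<Sum>a\<in>A. \<Sum>b\<in>A'. act (?D (Q a x)) (Q' b v) + act (Q a x) (?E (Q' b v)))"
    by (simp add: act_sum V.lin_sum[OF lin_act] V.lin_sum[OF E] pair) (rule sum.swap)
  also have "\<dots> = act (?D (\<Sum>a\<in>A. Q a x)) (\<Sum>b\<in>A'. Q' b v)
      + act (\<Sum>a\<in>A. Q a x) (?E (\<Sum>b\<in>A'. Q' b v))"
    unfolding lin_sum[OF D] V.lin_sum[OF E] act_sum V.lin_sum[OF lin_act]
    by (simp add: sum.distrib sum.swap[of _ A' A])
  finally show ?thesis unfolding x v .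
qed

end

context lie_alg
begin

lemma adjoint: "lie_rep sg Bg br sg Bg br"
  by unfold_locales (auto simp: add_left scale_left lin_ad ad_br)

definition derivation :: "('g \<Rightarrow> 'g) \<Rightarrow> bool" where
  "derivation D \<longleftrightarrow> lin D \<and> (\<forall>x y. D (br x y) = br (D x) y + br x (D y))"

lemma derivation_ad: "derivation (br x)"
  unfolding derivation_def using lin_ad leibniz by blast

lemma derivation_replica:
  assumes "\<And>a b. \<phi> (a + b) = \<phi> a + \<phi> b" "spectral (br h) A Q"
  shows "derivation (replica \<phi> A Q)"
proof -
  interpret ad: lie_rep sg Bg br sg Bg br by (rule adjoint)
  show ?thesis
    unfolding derivation_def
    using lin_replica[OF lin_ad assms(2)] ad.replica_act[OF assms(1) assms(2) assms(2)] by blast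
qed

section \<open>The Killing form\<close>

definition killing :: "'g \<Rightarrow> 'g \<Rightarrow> complex" where
  "killing x y = tr (\<lambda>z. br x (br y z))"

lemma killing_add_left: "killing (x + y) z = killing x z + killing y z"
  and killing_scale_left: "killing (sg c x) z = c * killing x z"
  and killing_add_right: "killing z (x + y) = killing z x + killing z y"
  and killing_scale_right: "killing z (sg c x) = c * killing z x"
  by (simp_all add: killing_def add_left scale_left add_right scale_right tr_add tr_scale)

lemma killing_derivation:
  assumes "derivation D"
  shows "killing (D x) y = - killing x (D y)"
proof -
  have lin: "lin D" and D: "\<And>x y. D (br x y) = br (D x) y + br x (D y)"
    using assms by (auto simp: derivation_def)
  have "br (D x) (br y z) = D (br x (br y z)) - br x (br (D y) z) - br x (br y (D z))" for z
    by (simp add: D add_right)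
  then have "killing (D x) y = tr (\<lambda>z. D (br x (br y z))) - killing x (D y)
      - tr (\<lambda>z. br x (br y (D z)))"
    unfolding killing_def by (simp add: tr_diff)
  moreover have "tr (\<lambda>z. D (br x (br y z))) = tr (\<lambda>z. br x (br y (D z)))"
    by (rule tr_comm[OF lin lin_comp[OF lin_ad lin_ad]])
  ultimately show ?thesis by simp
qed

text \<open>Cyclicity of the trace moves the commutator from ad u, ad v to D, ad u, and for a
  derivation the commutator of D and ad u is ad (D u).\<close>

lemma tr_derivation_ad_br:
  assumes "derivation D"
  shows "tr (\<lambda>z. D (br (br u v) z)) = killing (D u) v"
proof -
  have lin: "lin D" and D: "\<And>x y. D (br x y) = br (D x) y + br x (D y)"
    using assms by (auto simp: derivation_def)
  have "tr (\<lambda>z. D (br (br u v) z)) = tr (\<lambda>z. D (br u (br v z))) - tr (\<lambda>z. D (br v (br u z)))"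
    unfolding ad_br by (simp add: lin_diff[OF lin] tr_diff)
  also have "tr (\<lambda>z. D (br v (br u z))) = tr (\<lambda>z. br u (D (br v z)))"
    by (rule tr_comm[OF lin_comp[OF lin lin_ad] lin_ad])
  also have "tr (\<lambda>z. D (br u (br v z))) - tr (\<lambda>z. br u (D (br v z))) =
      tr (\<lambda>z. br (D u) (br v z))"
    by (simp add: D flip: tr_diff)
  finally show ?thesis by (simp add: killing_def)
qed

section \<open>Engel's theorem\<close>

definition step :: "'g set \<Rightarrow> 'g set \<Rightarrow> 'g set" where
  "step S X = span {br s x |s x. s \<in> S \<and> x \<in> X}"

lemma step_mono: "X \<subseteq> Y \<Longrightarrow> step S X \<subseteq> step S Y"
  unfolding step_def by (intro span_mono) blast

lemma step_pow_mono: "X \<subseteq> Y \<Longrightarrow> (step S ^^ n) X \<subseteq> (step S ^^ n) Y"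
  by (induction n) (auto intro: step_mono[THEN subsetD])

lemma step_base: "s \<in> S \<Longrightarrow> x \<in> X \<Longrightarrow> br s x \<in> step S X"
  unfolding step_def by (intro span_base) blast

lemma step_least: "subspace Z \<Longrightarrow> (\<And>s x. s \<in> S \<Longrightarrow> x \<in> X \<Longrightarrow> br s x \<in> Z) \<Longrightarrow> step S X \<subseteq> Z"
  unfolding step_def by (intro span_minimal) auto

lemma subspace_step_pow: "subspace X \<Longrightarrow> subspace ((step S ^^ n) X)"
  by (cases n) (auto simp: step_def)

lemma step_pow_decreasing: "(step S ^^ Suc n) UNIV \<subseteq> (step S ^^ n) UNIV"
proof (induction n)
  case (Suc n)
  show ?case using step_mono[OF Suc] by simp
qed simp

text \<open>One \<open>n\<close> kills all products of \<open>n\<close> maps \<open>br s\<close>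
  with \<open>s \<in> S\<close>, whereas the hypothesis of Engel's theorem concerns the powers of
  one map at a time.\<close>

definition ad_nilpotent_set :: "'g set \<Rightarrow> bool" where
  "ad_nilpotent_set S \<longleftrightarrow> (\<exists>n. (step S ^^ n) UNIV = {0})"

text \<open>The filtration of \<open>g\<close> by the products of \<open>k\<close> elements of \<open>S\<close> is stable under \<open>y\<close>, and on its
  quotients \<open>S + \<complex> y\<close> acts through the nilpotent map \<open>ad y\<close>.\<close>
lemma ad_nilpotent_set_extend:
  assumes nil: "ad_nilpotent_set S" and y: "\<And>z. (br y ^^ m) z = 0"
    and norm: "\<And>s. s \<in> S \<Longrightarrow> br s y \<in> S" and S: "subspace S"
  shows "ad_nilpotent_set {s + sg c y |s c. s \<in> S}" (is "ad_nilpotent_set ?S'")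
proof -
  define U where "U k = (step S ^^ k) UNIV" for k
  have sub: "subspace (U k)" for k unfolding U_def by (rule subspace_step_pow) (simp add: subspace_UNIV)
  have dec: "U (Suc k) \<subseteq> U k" for k unfolding U_def by (rule step_pow_decreasing)
  have base: "br s u \<in> U (Suc k)" if "s \<in> S" "u \<in> U k" for s u k
    using step_base[OF that] by (simp add: U_def)
  have least: "U (Suc k) \<subseteq> Z" if "subspace Z" "\<And>s x. s \<in> S \<Longrightarrow> x \<in> U k \<Longrightarrow> br s x \<in> Z" for Z k
    using step_least[OF that] by (simp add: U_def)
  \<comment> \<open>Leibniz rule, using that \<open>br y s\<close> is again in
    \<open>S\<close>.\<close>
  have yU: "br y u \<in> U k" if "u \<in> U k" for u k
    using that
  proof (induction k arbitrary: u)
    case 0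
    then show ?case by (simp add: U_def)
  next
    case (Suc k)
    have "U (Suc k) \<subseteq> {u. br y u \<in> U (Suc k)}"
    proof (rule least)
      show "subspace {u. br y u \<in> U (Suc k)}"
        using sub[of "Suc k"]
        by (intro subspaceI) (auto simp: zero_right add_right scale_right subspace_0 subspace_add subspace_scale)
      fix s x assume s: "s \<in> S" and x: "x \<in> U k"
      have "br y s \<in> S" using antisym[of y s] norm[OF s] subspace_neg[OF S] by simp
      then show "br s x \<in> {u. br y u \<in> U (Suc k)}"
        using leibniz[of y s x] base[of "br y s" x k] base[OF s Suc.IH[OF x]] x
          subspace_add[OF sub] by simp
    qed
    then show ?case using Suc.prems by blast
  qed
  have yUpow: "(br y ^^ l) u \<in> U k" if "u \<in> U k" for u k l
    by (induction l) (auto simp: that yU)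
  \<comment> \<open>Modulo \<open>U (Suc k)\<close> only the multiple of \<open>y\<close> in each
    factor acts, so \<open>l\<close> factors amount to an \<open>l\<close>-fold bracket with
    \<open>y\<close>; for \<open>l = m\<close> nothing remains.\<close>
  have chain: "(step ?S' ^^ l) (U k) \<subseteq> {x + w |x w. x \<in> (br y ^^ l) ` U k \<and> w \<in> U (Suc k)}" for k l
  proof (induction l)
    case 0
    have "u \<in> {x + w |x w. x \<in> U k \<and> w \<in> U (Suc k)}" if "u \<in> U k" for u
      using that subspace_0[OF sub[of "Suc k"]] by (intro CollectI exI[of _ u] exI[of _ 0]) simp
    then show ?case by auto
  next
    case (Suc l)
    have im: "subspace ((br y ^^ Suc l) ` U k)"
    proof -
      have "lin (br y ^^ Suc l)" by (rule lin_funpow[OF lin_ad])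
      then interpret Vector_Spaces.linear sg sg "br y ^^ Suc l" unfolding lin_linear .
      show ?thesis by (rule subspace_image) (rule sub)
    qed
    have "(step ?S' ^^ Suc l) (U k) = step ?S' ((step ?S' ^^ l) (U k))" by simp
    also have "\<dots> \<subseteq> step ?S' {x + w |x w. x \<in> (br y ^^ l) ` U k \<and> w \<in> U (Suc k)}"
      by (rule step_mono[OF Suc])
    also have "\<dots> \<subseteq> {x + w |x w. x \<in> (br y ^^ Suc l) ` U k \<and> w \<in> U (Suc k)}"
    proof (rule step_least[OF subspace_sums[OF im sub]])
      fix t z assume "t \<in> ?S'" and "z \<in> {x + w |x w. x \<in> (br y ^^ l) ` U k \<and> w \<in> U (Suc k)}"
      then obtain s c u w where t: "t = s + sg c y" "s \<in> S"
        and z: "z = (br y ^^ l) u + w" "u \<in> U k" "w \<in> U (Suc k)" by auto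
      have "br t z = (br y ^^ Suc l) (sg c u) + (br s ((br y ^^ l) u) + br s w + sg c (br y w))"
        unfolding t z
        by (simp add: add_left add_right scale_left lin_scale[OF lin_funpow[OF lin_ad]]
            lin_scale[OF lin_ad] scale_right_distrib algebra_simps)
      moreover have "br s ((br y ^^ l) u) + br s w + sg c (br y w) \<in> U (Suc k)"
        using base[OF t(2) yUpow[OF z(2)]] base[OF t(2), of w k] dec[of k] z(3) yU[OF z(3)] sub[of "Suc k"]
        by (intro subspace_add subspace_scale) auto
      moreover have "sg c u \<in> U k" using sub z(2) by (rule subspace_scale)
      ultimately show "br t z \<in> {x + w |x w. x \<in> (br y ^^ Suc l) ` U k \<and> w \<in> U (Suc k)}"
        by blast
    qed
    finally show ?case .
  qed
  have block: "(step ?S' ^^ m) (U k) \<subseteq> U (Suc k)" for k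
    using chain[of m k] y by auto
  have powers: "(step ?S' ^^ (m * k)) UNIV \<subseteq> U k" for k
  proof (induction k)
    case (Suc k)
    have "(step ?S' ^^ (m * Suc k)) UNIV = (step ?S' ^^ m) ((step ?S' ^^ (m * k)) UNIV)"
      by (simp add: funpow_add)
    also have "\<dots> \<subseteq> U (Suc k)" using step_pow_mono[OF Suc] block by blast
    finally show ?case .
  qed (simp add: U_def)
  obtain n where "U n = {0}" using nil by (auto simp: ad_nilpotent_set_def U_def)
  then have "(step ?S' ^^ (m * n)) UNIV \<subseteq> {0}" using powers[of n] by simp
  moreover have "0 \<in> (step ?S' ^^ (m * n)) UNIV"
    by (intro subspace_0 subspace_step_pow) (simp add: subspace_UNIV)
  ultimately show ?thesis unfolding ad_nilpotent_set_def by blast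
qed

text \<open>A good subalgebra \<open>S\<close> of greatest dimension is all of \<open>J\<close>.
  Otherwise apply \<open>S\<close> repeatedly to \<open>J\<close>: the stage just before the first
  one inside \<open>S\<close> contains some \<open>y\<close> outside \<open>S\<close> with
  \<open>br s y\<close> in \<open>S\<close>, and \<open>ad_nilpotent_set_extend\<close> allows
  \<open>y\<close> to be adjoined to \<open>S\<close>.\<close>

lemma engel:
  assumes J: "subspace J" "\<And>x y. x \<in> J \<Longrightarrow> y \<in> J \<Longrightarrow> br x y \<in> J"
    and nil: "\<And>x. x \<in> J \<Longrightarrow> \<exists>n. \<forall>z. (br x ^^ n) z = 0"
  shows "ad_nilpotent_set J"
proof -
  define good where "good S \<longleftrightarrow> subspace S \<and> S \<subseteq> J \<and> (\<forall>x\<in>S. \<forall>y\<in>S. br x y \<in> S) \<and> ad_nilpotent_set S" for S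
  have "step {0} UNIV \<subseteq> {0}" by (rule step_least) (auto simp: zero_left)
  moreover have "0 \<in> step {0} UNIV" by (simp add: step_def span_zero)
  ultimately have "(step {0} ^^ 1) UNIV = {0}" by auto
  then have "ad_nilpotent_set {0}" unfolding ad_nilpotent_set_def by blast
  then have good0: "good {0}" using J(1) by (auto simp: good_def subspace_0 zero_left)
  have "\<forall>S. good S \<longrightarrow> dim S < Suc dimension"
    using dim_subset_UNIV by (auto simp: less_Suc_eq_le)
  then obtain S where S: "good S" and max: "\<And>S'. good S' \<Longrightarrow> dim S' \<le> dim S"
    using ex_has_greatest_nat[of good "{0}" dim "Suc dimension"] good0 by (metis less_imp_le)
  have Ss: "subspace S" "S \<subseteq> J" "\<And>x y. x \<in> S \<Longrightarrow> y \<in> S \<Longrightarrow> br x y \<in> S" "ad_nilpotent_set S"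
    using S by (auto simp: good_def)
  have "J \<subseteq> S"
  proof (rule ccontr)
    assume not: "\<not> J \<subseteq> S"
    obtain n where "(step S ^^ n) UNIV = {0}" using Ss(4) by (auto simp: ad_nilpotent_set_def)
    then have "(step S ^^ n) J \<subseteq> S"
      using step_pow_mono[of J UNIV n S] subspace_0[OF Ss(1)] by auto
    then obtain k where k: "(step S ^^ k) J \<subseteq> S" "\<And>j. j < k \<Longrightarrow> \<not> (step S ^^ j) J \<subseteq> S"
      using exists_least_iff[of "\<lambda>k. (step S ^^ k) J \<subseteq> S"] by blast
    obtain j where j: "k = Suc j" using k(1) not by (cases k) auto
    then obtain y where y: "y \<in> (step S ^^ j) J" "y \<notin> S" using k(2)[of j] by auto
    have "(step S ^^ i) J \<subseteq> J" for i
    proof (induction i)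
      case (Suc i)
      then show ?case using step_least[of J S "(step S ^^ i) J"] J Ss(2) by auto
    qed simp
    then have yJ: "y \<in> J" using y(1) by blast
    have norm: "br s y \<in> S" if "s \<in> S" for s
      using step_base[OF that y(1)] k(1) j by auto
    obtain m where m: "\<And>z. (br y ^^ m) z = 0" using nil[OF yJ] by blast
    define S' where "S' = {s + sg c y |s c. s \<in> S}"
    have SS': "S \<subseteq> S'"
    proof
      fix s assume "s \<in> S"
      then show "s \<in> S'" unfolding S'_def by (intro CollectI exI[of _ s] exI[of _ 0]) simp
    qed
    have "y \<in> S'"
      unfolding S'_def using subspace_0[OF Ss(1)] by (intro CollectI exI[of _ 0] exI[of _ 1]) simp
    have S'_span: "S' = {x + z |x z. x \<in> S \<and> z \<in> span {y}}"
      unfolding S'_def by (auto simp: span_singleton)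
    have sub': "subspace S'" unfolding S'_span by (rule subspace_sums[OF Ss(1) subspace_span])
    have "good S'"
      unfolding good_def
    proof (intro conjI ballI)
      show "S' \<subseteq> J"
        unfolding S'_def using Ss(2) yJ J(1) by (auto intro: subspace_add subspace_scale)
      show "ad_nilpotent_set S'"
        unfolding S'_def by (rule ad_nilpotent_set_extend[OF Ss(4) m norm Ss(1)])
      fix a b assume "a \<in> S'" "b \<in> S'"
      then obtain s c t d where ab: "a = s + sg c y" "b = t + sg d y" "s \<in> S" "t \<in> S"
        by (auto simp: S'_def)
      have "br a b = br s t + sg d (br s y) - sg c (br t y)"
        unfolding ab using antisym[of y t]
        by (simp add: add_left add_right scale_left scale_right alt)
      then have "br a b \<in> S"
        using ab Ss norm by (auto intro!: subspace_add subspace_diff subspace_scale)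
      then show "br a b \<in> S'" using SS' by blast
    qed (rule sub')
    then have "dim S' \<le> dim S" by (rule max)
    moreover have "dim S < dim S'"
      using SS' \<open>y \<in> S'\<close> y(2) Ss(1) sub' by (intro dim_psubset) (auto simp: span_eq_iff[THEN iffD2])
    ultimately show False by simp
  qed
  then show ?thesis using Ss by auto
qed

text \<open>The derived series stays in \<open>J\<close>, so each bracket in it is also a
  \<open>step J\<close> product: its \<open>k\<close>-th term lies in stage \<open>k\<close> of the
  filtration.\<close>

lemma solvable_if_ad_nilpotent_set:
  assumes J: "subspace J" "\<And>x y. x \<in> J \<Longrightarrow> y \<in> J \<Longrightarrow> br x y \<in> J" and nil: "ad_nilpotent_set J"
  shows "lie_solvable sg br J"
proof -
  have "(derived sg br ^^ k) J \<subseteq> J \<inter> (step J ^^ k) UNIV" for k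
  proof (induction k)
    case (Suc k)
    let ?X = "(derived sg br ^^ k) J"
    have "derived sg br ?X \<subseteq> J" unfolding derived_def[of sg br ?X]
      using Suc J by (intro span_minimal) auto
    moreover have "derived sg br ?X \<subseteq> step J ((step J ^^ k) UNIV)"
      unfolding derived_def[of sg br ?X] step_def[of J "(step J ^^ k) UNIV"] using Suc by (intro span_mono) blast
    ultimately show ?case by simp
  qed simp
  moreover have "0 \<in> (derived sg br ^^ k) J" for k
    by (cases k) (auto simp: derived_def span_zero subspace_0[OF J(1)])
  moreover obtain n where "(step J ^^ n) UNIV = {0}" using nil by (auto simp: ad_nilpotent_set_def)
  ultimately have "(derived sg br ^^ n) J = {0}" by fastforce
  then show ?thesis unfolding lie_solvable_def by blast
qed

end

section \<open>Semisimple Lie algebras and weights\<close>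

locale ss_lie_alg = lie_alg +
  assumes no_solvable_ideal: "lie_ideal sg br I \<Longrightarrow> lie_solvable sg br I \<Longrightarrow> I = {0}"
begin

lemma center_zero:
  assumes "\<And>x. br x z = 0"
  shows "z = 0"
proof -
  have z: "br x y = 0" if "y \<in> span {z}" for x y
    using that assms by (auto simp: span_singleton scale_right)
  have "lie_ideal sg br (span {z})"
    unfolding lie_ideal_def using z by (auto simp: span_zero)
  moreover have "lie_solvable sg br (span {z})" using z by (intro abelian_ideal_solvable) auto
  ultimately have "span {z} = {0}" by (rule no_solvable_ideal)
  then show ?thesis using span_base[of z "{z}"] by auto
qed

text \<open>For such \<open>x\<close> the trace of \<open>D (br x z)\<close> as a map of
  \<open>z\<close> vanishes for each rational replica \<open>D\<close> of \<open>br x\<close>, by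
  \<open>tr_derivation_ad_br\<close> and invariance of the Killing form. The trace is also the sum
  of b \<phi>(b) m(b) over the eigenvalues b with multiplicities m(b). Applying \<phi> gives a
  vanishing sum of the nonnegative terms \<phi>(b)^2 m(b), so an eigenvalue \<open>a\<close> with
  \<open>\<phi> a \<noteq> 0\<close> has multiplicity 0.\<close>

lemma ad_nilpotent_of_killing_radical:
  assumes I: "I = {x. \<forall>y. killing x y = 0}" and x: "x \<in> span {br u v |u v. u \<in> I}"
  shows "\<exists>n. \<forall>z. (br x ^^ n) z = 0"
proof -
  obtain A Q where s: "spectral (br x) A Q" using spectral_exists[OF lin_ad] .
  have Q0: "Q a z = 0" if a: "a \<in> A" "a \<noteq> 0" for a z
  proof -
    obtain \<phi> where \<phi>: "rat_functional \<phi>" "\<phi> a \<noteq> 0" using rat_functional_separates[OF a(2)] .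
    define D where "D = replica (\<lambda>c. of_rat (\<phi> c)) A Q"
    have der: "derivation D"
      unfolding D_def by (rule derivation_replica[OF _ s]) (simp add: rat_functional_add[OF \<phi>(1)] of_rat_add)
    have lin: "lin D" using der by (simp add: derivation_def)
    have "span {br u v |u v. u \<in> I} \<subseteq> {w. tr (\<lambda>z. D (br w z)) = 0}"
    proof (rule span_minimal)
      show "{br u v |u v. u \<in> I} \<subseteq> {w. tr (\<lambda>z. D (br w z)) = 0}"
        using I by (auto simp: tr_derivation_ad_br[OF der] killing_derivation[OF der])
      show "subspace {w. tr (\<lambda>z. D (br w z)) = 0}"
        by (intro subspaceI) (auto simp: zero_left lin_zero[OF lin] tr_zero add_left lin_add[OF lin]
            tr_add scale_left lin_scale[OF lin] tr_scale)
    qed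
    then have "tr (\<lambda>z. D (br x z)) = 0" using x by blast
    moreover have "tr (\<lambda>z. D (br x z)) = (\<Sum>a\<in>A. a * tr (\<lambda>z. D (Q a z)))"
    proof (rule tr_spectral[OF lin_ad s lin])
      \<comment> \<open>\<open>x\<close> is in the kernel of \<open>br x\<close>, so
        \<open>D x = 0\<close>; the derivation \<open>D\<close> therefore commutes with
        \<open>br x\<close>.\<close>
      have "(shift (br x) 0 ^^ 1) x = 0" by (simp add: shift_def alt)
      from replica_eigen[OF lin_ad s this] have "D x = 0"
        by (simp add: D_def rat_functional_0[OF \<phi>(1)])
      then show "D (br x z) = br x (D z)" for z
        using der by (simp add: derivation_def zero_left)
    qed
    moreover have "tr (\<lambda>z. D (Q b z)) = of_rat (\<phi> b) * tr (Q b)" if "b \<in> A" for b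
      unfolding D_def replica_projection[OF lin_ad s that] by (rule tr_scale)
    ultimately have eq: "(\<Sum>b\<in>A. b * (of_rat (\<phi> b) * tr (Q b))) = 0" by simp
    have "\<forall>b\<in>A. \<exists>n. tr (Q b) = of_nat n \<and> (n = 0 \<longrightarrow> (\<forall>x. Q b x = 0))"
      using tr_spectral_projection[OF lin_ad s] by blast
    then obtain m where m: "\<And>b. b \<in> A \<Longrightarrow> tr (Q b) = of_nat (m b)"
      and m0: "\<And>b x. b \<in> A \<Longrightarrow> m b = 0 \<Longrightarrow> Q b x = 0" by metis
    have "(\<Sum>b\<in>A. b * of_rat (\<phi> b * of_nat (m b))) = (\<Sum>b\<in>A. b * (of_rat (\<phi> b) * tr (Q b)))"
      using m by (intro sum.cong) (simp_all add: of_rat_mult)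
    then have "(\<Sum>b\<in>A. b * of_rat (\<phi> b * of_nat (m b))) = 0" unfolding eq .
    then have "\<phi> (\<Sum>b\<in>A. b * of_rat (\<phi> b * of_nat (m b))) = 0"
      by (simp add: rat_functional_0[OF \<phi>(1)])
    then have "(\<Sum>b\<in>A. \<phi> b * (\<phi> b * of_nat (m b))) = 0"
      by (simp only: rat_functional_sum[OF \<phi>(1)] rat_functional_scale[OF \<phi>(1)])
    moreover have "\<phi> b * (\<phi> b * of_nat (m b)) \<ge> 0" for b
      by (simp flip: mult.assoc)
    ultimately have "\<phi> a * (\<phi> a * of_nat (m a)) = 0"
      using a(1) spectral_finite[OF lin_ad s] by (simp add: sum_nonneg_eq_0_iff)
    then show ?thesis using \<phi>(2) m0[OF a(1)] by simp
  qed
  show ?thesis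
  proof (cases "0 \<in> A")
    case True
    obtain n where n: "\<And>z. (shift (br x) 0 ^^ n) (Q 0 z) = 0"
      using spectral_nilp[OF lin_ad s True] by blast
    have "(\<Sum>a\<in>A. Q a z) = (\<Sum>a\<in>{0}. Q a z)" for z
      using True Q0 spectral_finite[OF lin_ad s] by (intro sum.mono_neutral_right) auto
    then have "Q 0 z = z" for z by (simp add: spectral_sum[OF lin_ad s])
    moreover have "shift (br x) 0 = br x" by (rule ext) (simp add: shift_def)
    ultimately show ?thesis using n by auto
  next
    case False
    have "(\<Sum>a\<in>A. Q a z) = 0" for z using False Q0 by (intro sum.neutral) auto
    then have "z = 0" for z :: 'a by (metis spectral_sum[OF lin_ad s])
    then show ?thesis by blast
  qed
qed

text \<open>Nilpotency is available for brackets with the radical \<open>I\<close>, so Engel's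
  theorem is applied to the ideal \<open>J\<close> that they span. \<open>J\<close> is solvable,
  hence zero, and this makes \<open>I\<close> central.\<close>

lemma killing_nondegenerate:
  assumes "\<And>y. killing x y = 0"
  shows "x = 0"
proof -
  define I where "I = {x. \<forall>y. killing x y = 0}"
  define J where "J = span {br u v |u v. u \<in> I}"
  have I_br: "br w u \<in> I" if "u \<in> I" for w u
    using that killing_derivation[OF derivation_ad[of w]] by (simp add: I_def)
  have subJ: "subspace J" by (simp add: J_def)
  have ideal: "br w z \<in> J" if "z \<in> J" for w z
  proof -
    have "J \<subseteq> {z. br w z \<in> J}"
      unfolding J_def
    proof (rule span_minimal)
      show "subspace {z. br w z \<in> span {br u v |u v. u \<in> I}}"
        by (intro subspaceI) (auto simp: zero_right span_zero add_right span_add scale_right span_scale)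
      have "br w (br u v) \<in> span {br u v |u v. u \<in> I}" if "u \<in> I" for u v
        unfolding leibniz[of w u v] using that I_br by (intro span_add span_base) blast+
      then show "{br u v |u v. u \<in> I} \<subseteq> {z. br w z \<in> span {br u v |u v. u \<in> I}}" by blast
    qed
    then show ?thesis using that by blast
  qed
  have "\<exists>n. \<forall>z. (br x ^^ n) z = 0" if "x \<in> J" for x
    using ad_nilpotent_of_killing_radical[OF I_def] that by (simp add: J_def)
  then have "ad_nilpotent_set J" by (intro engel subJ ideal)
  then have "lie_solvable sg br J" by (intro solvable_if_ad_nilpotent_set subJ ideal)
  moreover have "lie_ideal sg br J" using subJ ideal by (auto simp: lie_ideal_def)
  ultimately have J0: "J = {0}" by (rule no_solvable_ideal[rotated])
  have "x \<in> I" using assms by (simp add: I_def)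
  then have "br x v \<in> J" for v unfolding J_def by (intro span_base) blast
  then have "br v x = 0" for v using J0 antisym[of v x] by simp
  then show ?thesis by (rule center_zero)
qed

text \<open>\<open>\<Phi>\<close> encodes the values of \<open>killing x\<close> on the basis; it is
  injective by nondegeneracy, hence surjective by dimension.\<close>

lemma killing_represents:
  assumes f: "\<And>x y. f (x + y) = f x + f y" "\<And>c x. f (sg c x) = c * f x"
  shows "\<exists>x. \<forall>y. f y = killing x y"
proof -
  define \<Phi> where "\<Phi> x = (\<Sum>b\<in>Bg. sg (killing x b) b)" for x
  have lin: "lin \<Phi>"
    by (rule linI) (simp_all add: \<Phi>_def killing_add_left killing_scale_left scale_left_distrib
        sum.distrib scale_sum_right)
  have coord: "coord (\<Sum>b\<in>Bg. sg (c b) b) b = c b" if b: "b \<in> Bg" for c b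
  proof -
    have "coord (\<Sum>b\<in>Bg. sg (c b) b) b = (\<Sum>d\<in>Bg. if d = b then c d else 0)"
      unfolding coord_sum coord_scale using independent_Basis
      by (intro sum.cong) (auto simp: representation_basis)
    then show ?thesis using b finite_Basis by simp
  qed
  have ext: "g y = h y" if "\<And>x y. g (x + y) = g x + g y" "\<And>c x. g (sg c x) = c * g x"
    "\<And>x y. h (x + y) = h x + h y" "\<And>c x. h (sg c x) = c * h x" "\<And>b. b \<in> Bg \<Longrightarrow> g b = h b"
    for g h :: "'a \<Rightarrow> complex" and y
  proof -
    have "span Bg \<subseteq> {y. g y = h y}"
      using that that(2)[of 0 0] that(4)[of 0 0] by (intro span_minimal subspaceI) auto
    then show ?thesis using span_Basis by blast
  qed
  have "x = 0" if "\<Phi> x = 0" for x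
  proof (rule killing_nondegenerate)
    show "killing x y = 0" for y
    proof (rule ext[where g = "killing x" and h = "\<lambda>_. 0"])
      fix b assume "b \<in> Bg"
      then show "killing x b = 0" using coord[of b "killing x"] that by (simp add: \<Phi>_def coord_0)
    qed (simp_all add: killing_add_right killing_scale_right)
  qed
  then have "inj \<Phi>"
    using lin_diff[OF lin] by (intro injI) (metis eq_iff_diff_eq_0)
  then have "surj \<Phi>" using lin linear_inj_imp_surj lin_linear by blast
  then obtain x where x: "\<Phi> x = (\<Sum>b\<in>Bg. sg (f b) b)" by (metis surjD)
  have "f y = killing x y" for y
  proof (rule ext)
    show "f b = killing x b" if "b \<in> Bg" for b
      using coord[OF that, of f] coord[OF that, of "killing x"] x by (simp add: \<Phi>_def)
  qed (simp_all add: f killing_add_right killing_scale_right)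
  then show ?thesis by blast
qed

text \<open>The dual form of perfectness of the Lie algebra. If \<open>z\<close> represents
  \<open>f\<close>, invariance of the Killing form turns \<open>br0\<close> into
  \<open>br x z = 0\<close> for all \<open>x\<close>, so \<open>z\<close> is central.\<close>

lemma linear_functional_zero:
  assumes f: "\<And>x y. f (x + y) = f x + f y" "\<And>c x. f (sg c x) = c * f x"
    and br0: "\<And>x y. f (br x y) = 0"
  shows "f x = 0"
proof -
  obtain z where z: "\<And>y. f y = killing z y" using killing_represents[of f] f by blast
  have "br x z = 0" for x
  proof (rule killing_nondegenerate)
    show "killing (br x z) y = 0" for y
      using br0[of x y] by (simp add: z killing_derivation[OF derivation_ad])
  qed
  then have "z = 0" by (rule center_zero)
  then show ?thesis using killing_scale_left[of 0 0] by (simp add: z)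
qed

text \<open>Let \<open>h\<close> represent the traces of \<open>D\<close> against the maps
  \<open>br y\<close>. For \<open>E = D - br h\<close> these traces vanish, and
  \<open>killing (E y) z\<close> is one of them by \<open>tr_derivation_ad_br\<close>.\<close>

lemma derivation_inner:
  assumes "derivation D"
  shows "\<exists>h. \<forall>y. D y = br h y"
proof -
  have lin: "lin D" using assms by (simp add: derivation_def)
  obtain h where h: "\<And>y. tr (\<lambda>z. D (br y z)) = killing h y"
  proof -
    have "\<exists>h. \<forall>y. tr (\<lambda>z. D (br y z)) = killing h y"
      by (rule killing_represents)
        (simp_all add: add_left scale_left lin_add[OF lin] lin_scale[OF lin] tr_add tr_scale)
    then show thesis using that by blast
  qed
  define E where "E y = D y - br h y" for y
  have E: "derivation E"
    using assms lin_diff_fun[OF lin lin_ad] unfolding derivation_def E_def[abs_def]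
    by (auto simp: leibniz[of h] diff_left diff_right)
  have "tr (\<lambda>z. E (br y z)) = 0" for y
    using h[of y] by (simp add: E_def tr_diff killing_def)
  then have "killing (E y) z = 0" for y z
    using tr_derivation_ad_br[OF E, of y z] by simp
  then have "E y = 0" for y by (rule killing_nondegenerate)
  then have "\<forall>y. D y = br h y" by (simp add: E_def)
  then show ?thesis by blast
qed

end

section \<open>Cartan subalgebras\<close>

locale cartan = ss_lie_alg +
  fixes H
  assumes cartan: "cartan_subalgebra sg br H"
begin

lemma H_subspace: "subspace H" and H_br: "x \<in> H \<Longrightarrow> y \<in> H \<Longrightarrow> br x y \<in> H"
  and H_diag: "x \<in> H \<Longrightarrow> span {y. \<exists>c. br x y = sg c y} = UNIV"
  using cartan unfolding cartan_subalgebra_def toral_def lie_subalgebra_def ad_semisimple_def by auto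

lemma H_eigen: "x \<in> H \<Longrightarrow> (shift (br x) a ^^ n) z = 0 \<Longrightarrow> br x z = sg a z"
  by (rule diagonalizable_eigen[OF lin_ad H_diag])

text \<open>A nonzero bracket would give an eigenvector \<open>w = br x v\<close> of
  \<open>br x\<close> with \<open>v \<in> H\<close>. If its eigenvalue is 0, then \<open>v\<close>
  is a generalized but not a true eigenvector of \<open>br x\<close>; otherwise
  \<open>br w x\<close> is a nonzero multiple of \<open>w\<close>, and \<open>x\<close> is such a
  vector for \<open>br w\<close>. Both contradict diagonalizability.\<close>

lemma H_abelian:
  assumes x: "x \<in> H" and y: "y \<in> H"
  shows "br x y = 0"
proof (rule ccontr)
  assume n: "br x y \<noteq> 0"
  have "subspace (br x ` H)"
  proof -
    interpret Vector_Spaces.linear sg sg "br x" using lin_ad lin_linear by simp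
    show ?thesis by (rule subspace_image[OF H_subspace])
  qed
  then obtain w c where w: "w \<in> br x ` H" "w \<noteq> 0" "br x w = sg c w"
    by (rule eigenvector_exists[OF lin_ad, of "br x ` H" x "br x y"]) (use x y n H_br in auto)
  then obtain v where v: "v \<in> H" "w = br x v" by blast
  have wH: "w \<in> H" using v x H_br by simp
  show False
  proof (cases "c = 0")
    case True
    then have "(shift (br x) 0 ^^ 2) v = 0" using w(3) v by (simp add: shift_def numeral_2_eq_2)
    from H_eigen[OF x this] show False using w(2) v by simp
  next
    case False
    have wx: "br w x = - sg c w" using antisym[of w x] w(3) by simp
    then have "(shift (br w) 0 ^^ 2) x = 0"
      by (simp add: shift_def numeral_2_eq_2 minus_right scale_right alt)
    from H_eigen[OF wH this] show False using wx w(2) False by simp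
  qed
qed

text \<open>By maximality it suffices that \<open>H\<close> together with \<open>h'\<close> spans a
  toral subalgebra. \<open>h'\<close> commutes with \<open>H\<close> because
  \<open>\<phi> 0 = 0\<close>, and the projections \<open>Q b\<close> split an eigenvector of
  \<open>br t\<close> into joint eigenvectors of \<open>br t\<close> and
  \<open>br h'\<close>.\<close>

lemma replica_in_H:
  assumes h: "h \<in> H" and \<phi>: "\<And>a b. \<phi> (a + b) = \<phi> a + \<phi> b" and s: "spectral (br h) A Q"
  obtains h' where "h' \<in> H" "\<And>y. replica \<phi> A Q y = br h' y"
proof -
  have \<phi>0: "\<phi> 0 = 0" using \<phi>[of 0 0] by simp
  obtain h' where h': "\<And>y. replica \<phi> A Q y = br h' y"
    using derivation_inner[OF derivation_replica[OF \<phi> s]] by blast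
  have comm: "br h' t = 0" if "t \<in> H" for t
  proof -
    have "(shift (br h) 0 ^^ 1) t = 0" using H_abelian[OF h that] by (simp add: shift_def)
    from replica_eigen[OF lin_ad s this, of \<phi>] show ?thesis by (simp add: h' \<phi>0)
  qed
  define T where "T = {t + sg c h' |t c. t \<in> H}"
  have HT: "H \<subseteq> T"
  proof
    fix t assume "t \<in> H"
    then show "t \<in> T" unfolding T_def by (intro CollectI exI[of _ t] exI[of _ 0]) simp
  qed
  have "toral sg br T"
    unfolding toral_def lie_subalgebra_def
  proof (intro conjI ballI)
    have "T = {x + z |x z. x \<in> H \<and> z \<in> span {h'}}" unfolding T_def by (auto simp: span_singleton)
    then show subT: "subspace T" by (simp add: subspace_sums H_subspace)
    show "br a b \<in> T" if "a \<in> T" "b \<in> T" for a b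
    proof -
      obtain t c u d where ab: "a = t + sg c h'" "b = u + sg d h'" "t \<in> H" "u \<in> H"
        using \<open>a \<in> T\<close> \<open>b \<in> T\<close> by (auto simp: T_def)
      have "br a b = 0"
        unfolding ab using ab H_abelian comm antisym[of t h']
        by (simp add: add_left add_right scale_left scale_right alt)
      then show ?thesis using subT by (simp add: subspace_0)
    qed
    fix a assume "a \<in> T"
    then obtain t c where a: "a = t + sg c h'" "t \<in> H" by (auto simp: T_def)
    let ?E = "{y. \<exists>c. br a y = sg c y}"
    have "y \<in> span ?E" if y: "br t y = sg \<mu> y" for \<mu> y
    proof -
      have "Q b y \<in> ?E" if b: "b \<in> A" for b
      proof -
        have "br t (br h z) = br h (br t z)" for z
          using leibniz[of t h z] H_abelian[OF a(2) h] by (simp add: zero_left)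
        then have "br t (Q b y) = sg \<mu> (Q b y)"
          using spectral_commute[OF lin_ad s b lin_ad, of t y] y spectral_lin[OF lin_ad s b]
          by (simp add: lin_scale)
        moreover have "br h' (Q b y) = sg (\<phi> b) (Q b y)"
          using replica_projection[OF lin_ad s b, of \<phi> y] by (simp add: h')
        ultimately have "br a (Q b y) = sg (\<mu> + c * \<phi> b) (Q b y)"
          by (simp add: a add_left scale_left scale_left_distrib)
        then show ?thesis by blast
      qed
      then have "(\<Sum>b\<in>A. Q b y) \<in> span ?E" by (intro span_sum span_base) auto
      then show ?thesis by (simp add: spectral_sum[OF lin_ad s])
    qed
    then have "{y. \<exists>c. br t y = sg c y} \<subseteq> span ?E" by blast
    then have "span {y. \<exists>c. br t y = sg c y} \<subseteq> span ?E" by (rule span_minimal) simp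
    then show "ad_semisimple sg br a"
      unfolding ad_semisimple_def using H_diag[OF a(2)] by auto
  qed
  then have "T = H" using cartan HT unfolding cartan_subalgebra_def by blast
  moreover have "h' \<in> T"
    unfolding T_def using subspace_0[OF H_subspace] by (intro CollectI exI[of _ 0] exI[of _ 1]) simp
  ultimately show thesis using that h' by blast
qed

end

section \<open>Weights of a module\<close>

locale weight_setting = lie_rep sg Bg br sv Bv act + cartan sg Bg br H
  for sg :: "complex \<Rightarrow> 'g \<Rightarrow> 'g::ab_group_add" and Bg br
    and sv :: "complex \<Rightarrow> 'v \<Rightarrow> 'v::ab_group_add" and Bv act H
begin

abbreviation X where "X \<equiv> weights sv act H"

lemma weightE:
  assumes "x \<in> X"
  obtains v where "v \<noteq> 0" "\<And>h. h \<in> H \<Longrightarrow> act h v = sv (x h) v"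
  using assms unfolding weights_def by blast

lemma weight_outside: "x \<in> X \<Longrightarrow> h \<notin> H \<Longrightarrow> x h = 0"
  unfolding weights_def by blast

lemma weight_add:
  assumes "x \<in> X" "h \<in> H" "k \<in> H"
  shows "x (h + k) = x h + x k"
proof -
  obtain v where v: "v \<noteq> 0" "\<And>h. h \<in> H \<Longrightarrow> act h v = sv (x h) v" using weightE[OF assms(1)] by blast
  have "sv (x (h + k)) v = sv (x h + x k) v"
    using v(2)[of "h + k"] v(2)[OF assms(2)] v(2)[OF assms(3)] subspace_add[OF H_subspace assms(2,3)]
    by (simp add: act_add V.scale_left_distrib)
  then show ?thesis using v(1) by simp
qed

lemma weight_scale:
  assumes "x \<in> X" "h \<in> H"
  shows "x (sg c h) = c * x h"
proof -
  obtain v where v: "v \<noteq> 0" "\<And>h. h \<in> H \<Longrightarrow> act h v = sv (x h) v" using weightE[OF assms(1)] by blast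
  have "sv (x (sg c h)) v = act (sg c h) v"
    using v(2)[OF subspace_scale[OF H_subspace assms(2)]] by (rule sym)
  also have "\<dots> = sv (c * x h) v" using v(2)[OF assms(2)] by (simp add: act_scale)
  finally have "sv (x (sg c h)) v = sv (c * x h) v" .
  then show ?thesis using V.scale_right_imp_eq[OF v(1)] by blast
qed

text \<open>A weight is determined by its values on a basis of \<open>H\<close>, and its value at a
  basis element lies in the finite spectral set of that element.\<close>

lemma finite_weights: "finite X"
proof -
  obtain B where B: "B \<subseteq> H" "finite B" "span B = H"
    using basis_subspace_exists[OF H_subspace] by metis
  have "\<forall>b. \<exists>A. \<exists>Q. V.spectral (act b) A Q" using V.spectral_exists[OF lin_act] by metis
  then obtain A where A: "\<And>b. \<exists>Q. V.spectral (act b) (A b) Q" by metis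
  have "(\<lambda>x. restrict x B) ` X \<subseteq> PiE B A"
  proof (intro image_subsetI PiE_I)
    fix x b assume x: "x \<in> X" and b: "b \<in> B"
    obtain v where v: "v \<noteq> 0" "\<And>h. h \<in> H \<Longrightarrow> act h v = sv (x h) v" using weightE[OF x] by blast
    obtain Q where Q: "V.spectral (act b) (A b) Q" using A by blast
    have "(V.shift (act b) (x b) ^^ 1) v = 0" using v(2)[of b] b B by (auto simp: V.shift_def)
    from V.spectral_eigen_mem(1)[OF lin_act Q this v(1)] b show "restrict x B b \<in> A b" by simp
  qed auto
  moreover have "finite (PiE B A)"
    using B(2) A V.spectral_finite[OF lin_act] by (intro finite_PiE) blast+
  ultimately have fin: "finite ((\<lambda>x. restrict x B) ` X)" by (rule finite_subset)
  have "inj_on (\<lambda>x. restrict x B) X"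
  proof (intro inj_onI ext)
    fix x y h assume xy: "x \<in> X" "y \<in> X" "restrict x B = restrict y B"
    show "x h = y h"
    proof (cases "h \<in> H")
      case True
      have z: "x 0 = 0" "y 0 = 0"
        using weight_scale[OF xy(1) subspace_0[OF H_subspace], of 0]
          weight_scale[OF xy(2) subspace_0[OF H_subspace], of 0] by auto
      have "span B \<subseteq> {h \<in> H. x h = y h}"
      proof (rule span_minimal)
        show "B \<subseteq> {h \<in> H. x h = y h}" using B xy(3) by (auto dest: fun_cong)  (metis restrict_apply')
        show "subspace {h \<in> H. x h = y h}"
          using z by (intro subspaceI) (auto simp: subspace_0 subspace_add subspace_scale H_subspace
              weight_add weight_scale xy)
      qed
      then show ?thesis using True B by auto
    qed (simp add: weight_outside xy)
  qed
  then show ?thesis using fin finite_imageD by blast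
qed

text \<open>As a functional of \<open>z\<close>, the trace vanishes on brackets by cyclicity, so
  \<open>linear_functional_zero\<close> applies.\<close>

lemma tr_commutant_zero:
  assumes P: "V.lin P" "\<And>z v. P (act z v) = act z (P v)"
  shows "V.tr (\<lambda>v. P (act z v)) = 0"
proof (rule linear_functional_zero[where f = "\<lambda>z. V.tr (\<lambda>v. P (act z v))"])
  fix x y
  have "V.tr (\<lambda>v. P (act (br x y) v)) =
      V.tr (\<lambda>v. P (act x (act y v))) - V.tr (\<lambda>v. P (act y (act x v)))"
    unfolding act_br by (simp add: V.lin_diff[OF P(1)] V.tr_diff)
  also have "V.tr (\<lambda>v. P (act x (act y v))) = V.tr (\<lambda>v. act x (P (act y v)))"
    by (simp add: P(2))
  also have "\<dots> = V.tr (\<lambda>v. P (act y (act x v)))"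
    by (rule V.tr_comm[OF lin_act V.lin_comp[OF P(1) lin_act]])
  finally show "V.tr (\<lambda>v. P (act (br x y) v)) = 0" by simp
qed (simp_all add: act_add act_scale V.lin_add[OF P(1)] V.lin_scale[OF P(1)] V.tr_add V.tr_scale)

lemma tr_projection_multiplicity:
  assumes P: "V.lin P" "\<And>v. P (P v) = P v" "\<And>v. P (T v) = T (P v)"
    and T: "V.lin T" "V.spectral T A Q" "a \<in> A"
  shows "\<exists>n. V.tr (\<lambda>v. P (Q a v)) = of_nat n"
proof -
  have comm: "P (Q a v) = Q a (P v)" for v using V.spectral_commute[OF T P(1)] P(3) by blast
  have "P (Q a (P (Q a v))) = P (Q a v)" for v
    using V.spectral_orth[OF T(1,2) T(3) T(3)] by (simp add: comm P(2))
  then show ?thesis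
    using V.tr_idempotent[OF V.lin_comp[OF P(1) V.spectral_lin[OF T]]] by blast
qed

text \<open>If \<open>D\<close> denotes the replica of \<open>act h\<close>, and \<open>ad h'\<close> that of \<open>ad h\<close>, then \<open>S = D - act h'\<close>
  commutes with the action; comparing traces on an eigenspace of \<open>S\<close> shows that \<open>S\<close> is nilpotent.\<close>
lemma weight_replica:
  assumes h: "h \<in> H" and \<phi>: "rat_functional \<phi>"
  shows "\<exists>h'\<in>H. \<forall>x\<in>X. x h' = of_rat (\<phi> (x h))"
proof -
  let ?\<psi> = "\<lambda>c. of_rat (\<phi> c) :: complex"
  have \<psi>: "?\<psi> (a + b) = ?\<psi> a + ?\<psi> b" for a b by (simp add: rat_functional_add[OF \<phi>] of_rat_add)
  obtain A Q where s: "spectral (br h) A Q" using spectral_exists[OF lin_ad] .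
  obtain A' Q' where s': "V.spectral (act h) A' Q'" using V.spectral_exists[OF lin_act] .
  obtain h' where h': "h' \<in> H" "\<And>y. replica ?\<psi> A Q y = br h' y"
    using replica_in_H[OF h \<psi> s] by blast
  define D where "D = V.replica ?\<psi> A' Q'"
  have linD: "V.lin D" unfolding D_def by (rule V.lin_replica[OF lin_act s'])
  define S where "S v = D v - act h' v" for v
  have linS: "V.lin S" unfolding S_def by (rule V.lin_diff_fun[OF linD lin_act])
  have S_act: "S (act z v) = act z (S v)" for z v
  proof -
    have "D (act z v) = act (br h' z) v + act z (D v)"
      unfolding D_def replica_act[OF \<psi> s s'] h'(2) ..
    then show ?thesis
      by (simp add: S_def act_br V.lin_diff[OF lin_act])
  qed
  obtain B P where p: "V.spectral S B P" using V.spectral_exists[OF linS] .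
  have "x h' = of_rat (\<phi> (x h))" if x: "x \<in> X" for x
  proof -
    obtain v where v: "v \<noteq> 0" "\<And>h. h \<in> H \<Longrightarrow> act h v = sv (x h) v" using weightE[OF x] by blast
    \<comment> \<open>The weight vector \<open>v\<close> is an eigenvector of \<open>S\<close> for
      this number; the claim is that it is 0.\<close>
    define \<mu> where "\<mu> = ?\<psi> (x h) - x h'"
    have "(V.shift (act h) (x h) ^^ 1) v = 0" using v(2)[OF h] by (simp add: V.shift_def)
    from V.replica_eigen[OF lin_act s' this, of ?\<psi>] have "S v = sv \<mu> v"
      unfolding S_def D_def \<mu>_def using v(2)[OF h'(1)] by (simp add: V.scale_left_diff_distrib)
    then have "(V.shift S \<mu> ^^ 1) v = 0" by (simp add: V.shift_def)
    from V.spectral_eigen_mem[OF linS p this v(1)] have \<mu>: "\<mu> \<in> B" "P \<mu> v = v" .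
    have linP: "V.lin (P \<mu>)" by (rule V.spectral_lin[OF linS p \<mu>(1)])
    have P_act: "P \<mu> (act z u) = act z (P \<mu> u)" for z u
      using V.spectral_commute[OF linS p \<mu>(1) lin_act, of z] S_act by simp
    have PP: "P \<mu> (P b u) = (if \<mu> = b then P b u else 0)" if "b \<in> B" for b u
      by (rule V.spectral_orth[OF linS p \<mu>(1) that])
    have PS: "P \<mu> (S u) = S (P \<mu> u)" for u
      using V.spectral_commute[OF linS p \<mu>(1) linS, of u] by simp
    have "V.tr (\<lambda>u. P \<mu> (S u)) = (\<Sum>b\<in>B. b * V.tr (\<lambda>u. P \<mu> (P b u)))"
      by (rule V.tr_spectral[OF linS p linP PS])
    also have "\<dots> = (\<Sum>b\<in>B. if b = \<mu> then \<mu> * V.tr (P \<mu>) else 0)"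
      by (rule sum.cong) (auto simp: PP V.tr_zero)
    also have "\<dots> = \<mu> * V.tr (P \<mu>)" using \<mu>(1) V.spectral_finite[OF linS p] by simp
    finally have trS: "V.tr (\<lambda>u. P \<mu> (S u)) = \<mu> * V.tr (P \<mu>)" .
    have "\<forall>a\<in>A'. \<exists>n. V.tr (\<lambda>u. P \<mu> (Q' a u)) = of_nat n"
      using tr_projection_multiplicity[where T = "act h" and P = "P \<mu>" and A = A' and Q = Q']
        linP P_act lin_act s' PP[OF \<mu>(1)] by auto
    then obtain n where n: "\<And>a. a \<in> A' \<Longrightarrow> V.tr (\<lambda>u. P \<mu> (Q' a u)) = of_nat (n a)" by metis
    \<comment> \<open>The trace of \<open>act h\<close> on the range of \<open>P \<mu>\<close>
      vanishes. The multiplicities \<open>n a\<close> are natural numbers, so \<phi> can be applied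
      term by term, which yields a vanishing trace of \<open>D\<close> on the same space.
      Subtracting the trace of \<open>act h'\<close> leaves
      \<open>\<mu> * V.tr (P \<mu>) = 0\<close>.\<close>
    have "0 = V.tr (\<lambda>u. P \<mu> (act h u))" using tr_commutant_zero[OF linP P_act] by simp
    also have "\<dots> = (\<Sum>a\<in>A'. a * V.tr (\<lambda>u. P \<mu> (Q' a u)))"
      using lin_act s' linP P_act by (rule V.tr_spectral[where T = "act h" and P = "P \<mu>"])
    also have "\<dots> = (\<Sum>a\<in>A'. a * of_nat (n a))"
      by (rule sum.cong[OF refl]) (simp only: n)
    finally have "\<phi> (\<Sum>a\<in>A'. a * of_nat (n a)) = 0" by (simp add: rat_functional_0[OF \<phi>])
    then have "(\<Sum>a\<in>A'. \<phi> a * of_nat (n a)) = 0"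
      by (simp add: rat_functional_sum[OF \<phi>] rat_functional_nat[OF \<phi>])
    then have "of_rat (\<Sum>a\<in>A'. \<phi> a * of_nat (n a)) = (0::complex)" by simp
    then have "(\<Sum>a\<in>A'. ?\<psi> a * V.tr (\<lambda>u. P \<mu> (Q' a u))) = 0"
      using n by (simp add: of_rat_sum of_rat_mult)
    then have "V.tr (\<lambda>u. P \<mu> (D u)) = 0"
      unfolding D_def V.tr_comp_replica[OF linP] .
    then have "V.tr (\<lambda>u. P \<mu> (S u)) = 0"
      using tr_commutant_zero[OF linP P_act, of h']
      by (simp add: S_def V.lin_diff[OF linP] V.tr_diff)
    moreover have "V.tr (P \<mu>) \<noteq> 0"
      using V.tr_spectral_projection[OF linS p \<mu>(1)] \<mu>(2) v(1) by (metis of_nat_eq_0_iff)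
    ultimately have "\<mu> = 0" using trS by simp
    then show ?thesis by (simp add: \<mu>_def)
  qed
  then show ?thesis using h'(1) by blast
qed

text \<open>The trace of \<open>act h\<close> sums generalized eigenvalues with multiplicities
  \<open>n a\<close>. As \<open>H\<close> is abelian, it preserves the range of \<open>Q a\<close>
  and has a joint eigenvector there if \<open>n a \<noteq> 0\<close>; so \<open>a\<close> is then
  the value at \<open>h\<close> of some weight, hence nonnegative, and every term of the vanishing
  sum is 0.\<close>

lemma weights_zero_if_nonneg:
  assumes h: "h \<in> H" and r: "\<And>x. x \<in> X \<Longrightarrow> \<exists>r\<ge>0. x h = complex_of_real r" and x: "x \<in> X"
  shows "x h = 0"
proof -
  obtain A Q where s: "V.spectral (act h) A Q" using V.spectral_exists[OF lin_act] .
  have "\<forall>a\<in>A. \<exists>n. V.tr (Q a) = of_nat n \<and> (n = 0 \<longrightarrow> (\<forall>x. Q a x = 0))"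
    using V.tr_spectral_projection[OF lin_act s] by blast
  then obtain n where n: "\<And>a. a \<in> A \<Longrightarrow> V.tr (Q a) = of_nat (n a)"
    and n0: "\<And>a v. a \<in> A \<Longrightarrow> n a = 0 \<Longrightarrow> Q a v = 0" by metis
  have comm: "act k (act l v) = act l (act k v)" if "k \<in> H" "l \<in> H" for k l v
    using act_br[of k l v] H_abelian[OF that] by (simp add: act_zero)
  have nonneg: "\<exists>r\<ge>0. a = complex_of_real r" if a: "a \<in> A" "n a \<noteq> 0" for a
  proof -
    have "\<exists>w. Q a w \<noteq> 0"
    proof (rule ccontr)
      assume "\<not> (\<exists>w. Q a w \<noteq> 0)"
      then have "V.tr (Q a) = 0" by (simp add: V.tr_def V.coord_0)
      then show False using n[OF a(1)] a(2) by simp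
    qed
    then obtain w where w: "Q a w \<noteq> 0" by blast
    have "\<exists>v\<in>range (Q a). v \<noteq> 0 \<and> (\<forall>f\<in>act ` H. \<exists>c. f v = sv c v)"
    proof (rule V.joint_eigenvector_exists)
      show "V.subspace (range (Q a))" by (rule V.lin_subspaces(1)[OF V.spectral_lin[OF lin_act s a(1)]])
      fix f v assume f: "f \<in> act ` H" and "v \<in> range (Q a)"
      then obtain k u where k: "k \<in> H" "f = act k" "v = Q a u" by blast
      then have "f v = Q a (act k u)"
        using V.spectral_commute[OF lin_act s a(1) lin_act, of k u] comm[OF k(1) h] by simp
      then show "f v \<in> range (Q a)" by simp
    qed (use lin_act comm w in auto)
    then obtain v where v: "v \<in> range (Q a)" "v \<noteq> 0" "\<And>k. k \<in> H \<Longrightarrow> \<exists>c. act k v = sv c v"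
      by auto
    then obtain c where c: "\<And>k. k \<in> H \<Longrightarrow> act k v = sv (c k) v" by metis
    define y where "y k = (if k \<in> H then c k else 0)" for k
    have y: "y \<in> X" unfolding weights_def y_def using c v(2) by auto
    obtain m where "(V.shift (act h) a ^^ m) v = 0"
      using V.spectral_nilp[OF lin_act s a(1)] v(1) by blast
    moreover have "(V.shift (act h) (y h) ^^ 1) v = 0"
      using c[OF h] h by (simp add: V.shift_def y_def)
    ultimately have "a = y h" using V.generalized_eigenvalue_unique[OF lin_act] v(2) by blast
    then show ?thesis using r[OF y] by simp
  qed
  have "0 = V.tr (\<lambda>v. act h v)" using tr_commutant_zero[OF V.lin_id, of h] by simp
  also have "\<dots> = (\<Sum>a\<in>A. a * V.tr (Q a))"
    using V.tr_spectral[OF lin_act s V.lin_id] by simp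
  also have "\<dots> = (\<Sum>a\<in>A. a * of_nat (n a))" using n by simp
  finally have "Re (\<Sum>a\<in>A. a * of_nat (n a)) = 0" by simp
  then have "(\<Sum>a\<in>A. Re a * n a) = 0" by simp
  moreover have "Re a * n a \<ge> 0" if "a \<in> A" for a
    using nonneg[OF that] by (cases "n a = 0") auto
  ultimately have z: "Re a * n a = 0" if "a \<in> A" for a
    using that V.spectral_finite[OF lin_act s] by (simp add: sum_nonneg_eq_0_iff)
  obtain v where v: "v \<noteq> 0" "\<And>h. h \<in> H \<Longrightarrow> act h v = sv (x h) v" using weightE[OF x] by blast
  have "(V.shift (act h) (x h) ^^ 1) v = 0" using v(2)[OF h] by (simp add: V.shift_def)
  from V.spectral_eigen_mem[OF lin_act s this v(1)] have "x h \<in> A" "Q (x h) v = v" .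
  then have "Re (x h) = 0" using z[of "x h"] n0[of "x h" v] v(1) by auto
  then show ?thesis using r[OF x] by auto
qed

end

section \<open>Weak faces of rational configurations\<close>

lemma real_subfieldD:
  assumes "real_subfield K"
  shows "0 \<in> K" "1 \<in> K" "x \<in> K \<Longrightarrow> y \<in> K \<Longrightarrow> x + y \<in> K" "x \<in> K \<Longrightarrow> y \<in> K \<Longrightarrow> x * y \<in> K"
    "x \<in> K \<Longrightarrow> y \<in> K \<Longrightarrow> x - y \<in> K" "x \<in> K \<Longrightarrow> y \<in> K \<Longrightarrow> x / y \<in> K"
proof -
  have K: "0 \<in> K \<and> 1 \<in> K" "\<forall>x\<in>K. \<forall>y\<in>K. x + y \<in> K \<and> x * y \<in> K" "\<forall>x\<in>K. - x \<in> K"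
    "\<forall>x\<in>K. x \<noteq> 0 \<longrightarrow> inverse x \<in> K"
    using assms unfolding real_subfield_def by simp_all
  show "0 \<in> K" "1 \<in> K" "x \<in> K \<Longrightarrow> y \<in> K \<Longrightarrow> x + y \<in> K" "x \<in> K \<Longrightarrow> y \<in> K \<Longrightarrow> x * y \<in> K"
    using K by simp_all
  show "x - y \<in> K" if "x \<in> K" "y \<in> K"
  proof -
    have "x + - y \<in> K" using K(2,3) that by blast
    then show ?thesis by simp
  qed
  show "x / y \<in> K" if "x \<in> K" "y \<in> K"
    using K that by (cases "y = 0") (simp_all add: divide_inverse)
qed

lemma real_subfield_Rats:
  assumes K: "real_subfield K"
  shows "\<rat> \<subseteq> K"
proof
  note field = real_subfieldD[OF K]
  have nat: "of_nat n \<in> K" for n by (induction n) (auto intro: field)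
  have int: "of_int i \<in> K" for i
    using nat[of "nat i"] field(5)[OF field(1) nat[of "nat (- i)"]] by (cases "i \<ge> 0") auto
  fix x :: real assume "x \<in> \<rat>"
  then obtain a b where "x = of_int a / of_int b" by (auto elim: Rats_cases')
  then show "x \<in> K" using field(6)[OF int int] by simp
qed

lemma conv_F_finite:
  assumes U: "finite U" and "0 \<in> K"
  shows "conv_F K U = {y. \<exists>r. (\<forall>s\<in>U. r s \<in> K \<and> 0 \<le> r s) \<and> sum r U = 1 \<and> y = (\<Sum>s\<in>U. r s *\<^sub>R s)}"
    (is "_ = ?R")
proof
  show "?R \<subseteq> conv_F K U" unfolding conv_F_def using U by blast
  show "conv_F K U \<subseteq> ?R"
  proof
    fix y assume "y \<in> conv_F K U"
    then obtain S r where S: "finite S" "S \<subseteq> U" and r: "\<forall>s\<in>S. r s \<in> K \<and> 0 \<le> r s" "sum r S = 1"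
      and y: "y = (\<Sum>s\<in>S. r s *\<^sub>R s)" unfolding conv_F_def by blast
    define r' where "r' s = (if s \<in> S then r s else 0)" for s
    have "sum r' U = sum r S"
      unfolding r'_def using S U by (intro sum.mono_neutral_cong_right) auto
    moreover have "(\<Sum>s\<in>U. r' s *\<^sub>R s) = y"
      unfolding y r'_def using S U by (intro sum.mono_neutral_cong_right) auto
    moreover have "\<forall>s\<in>U. r' s \<in> K \<and> 0 \<le> r' s" using r assms(2) by (auto simp: r'_def)
    ultimately show "y \<in> ?R" using r(2) by (intro CollectI exI[of _ r']) simp
  qed
qed

lemma conv_F_base: "1 \<in> K \<Longrightarrow> u \<in> U \<Longrightarrow> u \<in> conv_F K U"
  unfolding conv_F_def by (intro CollectI exI[of _ "{u}"] exI[of _ "\<lambda>_. 1"]) auto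

lemma conv_F_linear_ge:
  assumes f: "linear f" and c: "\<And>s. s \<in> U \<Longrightarrow> c \<le> f s" and p: "p \<in> conv_F K U"
  shows "c \<le> (f p :: real)"
proof -
  obtain S r where S: "finite S" "S \<subseteq> U" and r: "\<forall>s\<in>S. r s \<in> K \<and> 0 \<le> r s" "sum r S = 1"
    and p: "p = (\<Sum>s\<in>S. r s *\<^sub>R s)" using p unfolding conv_F_def by blast
  have "c = (\<Sum>s\<in>S. r s * c)" using r(2) by (simp flip: sum_distrib_right)
  also have "\<dots> \<le> (\<Sum>s\<in>S. r s * f s)" using S r c by (intro sum_mono mult_left_mono) auto
  also have "\<dots> = f p" unfolding p using f by (simp add: linear_sum linear_cmul)
  finally show ?thesis .
qed

lemma conv_F_linear_eq:
  assumes f: "linear f" and c: "\<And>s. s \<in> U \<Longrightarrow> f s = c" and p: "p \<in> conv_F K U"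
  shows "f p = (c :: real)"
proof -
  obtain S r where S: "finite S" "S \<subseteq> U" and r: "sum r S = 1"
    and p: "p = (\<Sum>s\<in>S. r s *\<^sub>R s)" using p unfolding conv_F_def by blast
  have "f p = (\<Sum>s\<in>S. r s * f s)" unfolding p using f by (simp add: linear_sum linear_cmul)
  also have "\<dots> = (\<Sum>s\<in>S. r s * c)" using S c by (intro sum.cong) auto
  finally show ?thesis using r by (simp flip: sum_distrib_right)
qed

lemma relint_F_positive:
  fixes U :: "'a::real_vector set"
  assumes K: "real_subfield K" and U: "finite U" "U \<noteq> {}"
    and b: "\<And>u. u \<in> U \<Longrightarrow> b u \<in> K" "\<And>u. u \<in> U \<Longrightarrow> 0 < b u" "sum b U = 1"
  shows "(\<Sum>u\<in>U. b u *\<^sub>R u) \<in> relint_F K (conv_F K U)"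
proof -
  note K0 = real_subfieldD(1,2)[OF K] and mult = real_subfieldD(4)[OF K]
    and diff = real_subfieldD(5)[OF K] and div = real_subfieldD(6)[OF K]
  note conv = conv_F_finite[OF U(1) K0(1)]
  define m where "m = Min (b ` U)"
  have "m \<in> b ` U" unfolding m_def using U by (intro Min_in) auto
  then obtain u0 where "u0 \<in> U" "m = b u0" by blast
  then have m: "m \<in> K" "0 < m" using b by simp_all
  have min: "m \<le> b u" if "u \<in> U" for u unfolding m_def using that U(1) by simp
  have m1: "m \<le> 1"
  proof -
    obtain u where u: "u \<in> U" using U by blast
    have "b u \<le> sum b U" using u U b by (intro member_le_sum) (auto intro: less_imp_le)
    then show ?thesis using min[OF u] b(3) by simp
  qed
  \<comment> \<open>Small enough for \<open>b u - t * r u\<close> to stay nonnegative; halving keeps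
    \<open>t\<close> below 1 even when \<open>U\<close> is a singleton and
    \<open>m = 1\<close>.\<close>
  define t where "t = m / 2"
  have "(2::real) \<in> K" using real_subfield_Rats[OF K] by auto
  then have t: "t \<in> K" "0 < t" "t < 1" using m m1 div by (auto simp: t_def)
  have "\<exists>z\<in>conv_F K U. \<exists>t\<in>K. 0 < t \<and> t < 1 \<and> (\<Sum>u\<in>U. b u *\<^sub>R u) = t *\<^sub>R y + (1 - t) *\<^sub>R z"
    if y: "y \<in> conv_F K U" for y
  proof -
    obtain r where r: "\<And>u. u \<in> U \<Longrightarrow> r u \<in> K" "\<And>u. u \<in> U \<Longrightarrow> 0 \<le> r u" "sum r U = 1"
      and y: "y = (\<Sum>u\<in>U. r u *\<^sub>R u)" using y unfolding conv by blast
    define q where "q u = (b u - t * r u) / (1 - t)" for u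
    have "0 \<le> q u" if u: "u \<in> U" for u
    proof -
      have "r u \<le> sum r U" using u U r by (intro member_le_sum) auto
      then have "t * r u \<le> t * 1" using t r(3) by (intro mult_left_mono) auto
      also have "\<dots> \<le> b u" using m(2) min[OF u] by (simp add: t_def)
      finally show ?thesis using t by (simp add: q_def)
    qed
    moreover have "q u \<in> K" if "u \<in> U" for u
      unfolding q_def using that b r t K0 by (intro div diff mult) auto
    moreover have "sum q U = 1"
      unfolding q_def using t b(3) r(3)
      by (simp add: sum_subtractf flip: sum_divide_distrib sum_distrib_left)
    ultimately have z: "(\<Sum>u\<in>U. q u *\<^sub>R u) \<in> conv_F K U" unfolding conv by blast
    have "t *\<^sub>R y + (1 - t) *\<^sub>R (\<Sum>u\<in>U. q u *\<^sub>R u) = (\<Sum>u\<in>U. (t * r u + (1 - t) * q u) *\<^sub>R u)"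
      by (simp add: y scaleR_sum_right sum.distrib scaleR_add_left)
    also have "\<dots> = (\<Sum>u\<in>U. b u *\<^sub>R u)"
      using t by (intro sum.cong) (auto simp: q_def)
    finally show ?thesis using z t by metis
  qed
  moreover have "(\<Sum>u\<in>U. b u *\<^sub>R u) \<in> conv_F K U"
    unfolding conv using b by (auto intro: less_imp_le)
  ultimately show ?thesis unfolding relint_F_def by blast
qed

text \<open>Farkas' lemma over \<open>\<rat>\<close>, relative to a separating \<open>\<rat>\<close>-space \<open>\<Phi>\<close> of functionals on the
  \<open>\<rat>\<close>-space \<open>E\<close>. If the functional \<open>f\<close> found for the smaller cone is negative on the new
  generator \<open>v s\<close>, everything is projected along \<open>v s\<close> onto the kernel of \<open>f\<close>.\<close>
lemma farkas_rational:
  fixes v :: "'i \<Rightarrow> 'a::real_vector"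
  assumes \<Phi>: "\<And>f. f \<in> \<Phi> \<Longrightarrow> linear f" "\<And>f x. f \<in> \<Phi> \<Longrightarrow> x \<in> E \<Longrightarrow> f x \<in> \<rat>"
      "\<And>f g c. f \<in> \<Phi> \<Longrightarrow> g \<in> \<Phi> \<Longrightarrow> c \<in> \<rat> \<Longrightarrow> (\<lambda>x. f x + c * g x) \<in> \<Phi>"
    and E: "\<And>x y c. x \<in> E \<Longrightarrow> y \<in> E \<Longrightarrow> c \<in> \<rat> \<Longrightarrow> x + c *\<^sub>R y \<in> E"
    and sep: "\<And>x. x \<in> E \<Longrightarrow> x \<noteq> 0 \<Longrightarrow> \<exists>f\<in>\<Phi>. f x \<noteq> 0"
    and I: "finite I" and v: "\<And>i. i \<in> I \<Longrightarrow> v i \<in> E" and b: "b \<in> E"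
    and cone: "\<not> (\<exists>d. (\<forall>i\<in>I. d i \<in> \<rat> \<and> 0 \<le> d i) \<and> b = (\<Sum>i\<in>I. d i *\<^sub>R v i))"
  shows "\<exists>f\<in>\<Phi>. f b < (0::real) \<and> (\<forall>i\<in>I. 0 \<le> f (v i))"
  using I v b cone
proof (induction I arbitrary: v b)
  case empty
  then obtain f where f: "f \<in> \<Phi>" "f b \<noteq> 0" using sep[of b] by auto
  show ?case
  proof (cases "f b < 0")
    case False
    have "(\<lambda>x. f x + (- 2) * f x) \<in> \<Phi>" by (rule \<Phi>(3)[OF f(1) f(1)]) simp
    then show ?thesis using f False by force
  qed (use f in blast)
next
  case (insert s I)
  have "\<not> (\<exists>d. (\<forall>i\<in>I. d i \<in> \<rat> \<and> 0 \<le> d i) \<and> b = (\<Sum>i\<in>I. d i *\<^sub>R v i))"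
  proof
    assume "\<exists>d. (\<forall>i\<in>I. d i \<in> \<rat> \<and> 0 \<le> d i) \<and> b = (\<Sum>i\<in>I. d i *\<^sub>R v i)"
    then obtain d where d: "\<And>i. i \<in> I \<Longrightarrow> d i \<in> \<rat> \<and> 0 \<le> d i" "b = (\<Sum>i\<in>I. d i *\<^sub>R v i)" by blast
    have "(\<Sum>i\<in>insert s I. (d(s := 0)) i *\<^sub>R v i) = b"
      unfolding d(2) using insert.hyps by (simp, intro sum.cong) auto
    moreover have "\<forall>i\<in>insert s I. (d(s := 0)) i \<in> \<rat> \<and> 0 \<le> (d(s := 0)) i" using d(1) by auto
    ultimately show False using insert.prems(3) by metis
  qed
  then obtain f where f: "f \<in> \<Phi>" "f b < 0" "\<And>i. i \<in> I \<Longrightarrow> 0 \<le> f (v i)"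
    using insert.IH[of v b] insert.prems by auto
  show ?case
  proof (cases "0 \<le> f (v s)")
    case True
    then show ?thesis using f by blast
  next
    case False
    have vs: "v s \<in> E" using insert.prems by simp
    define p where "p x = x + (- (f x / f (v s))) *\<^sub>R v s" for x
    have pE: "p x \<in> E" if "x \<in> E" for x
      unfolding p_def using that vs \<Phi>(2)[OF f(1)] by (intro E) auto
    have "\<not> (\<exists>d. (\<forall>i\<in>I. d i \<in> \<rat> \<and> 0 \<le> d i) \<and> p b = (\<Sum>i\<in>I. d i *\<^sub>R p (v i)))"
    proof
      assume "\<exists>d. (\<forall>i\<in>I. d i \<in> \<rat> \<and> 0 \<le> d i) \<and> p b = (\<Sum>i\<in>I. d i *\<^sub>R p (v i))"
      then obtain d where d: "\<And>i. i \<in> I \<Longrightarrow> d i \<in> \<rat>" "\<And>i. i \<in> I \<Longrightarrow> 0 \<le> d i"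
        "p b = (\<Sum>i\<in>I. d i *\<^sub>R p (v i))" by blast
      \<comment> \<open>The coefficient that \<open>v s\<close> acquires when the projection
        \<open>p\<close> is undone. It is nonnegative because \<open>f b\<close> and
        \<open>f (v s)\<close> are negative and \<open>f\<close> is nonnegative on the old
        generators.\<close>
      define e where "e = f b / f (v s) + (\<Sum>i\<in>I. d i * (- (f (v i) / f (v s))))"
      have "b = p b + (f b / f (v s)) *\<^sub>R v s" by (simp add: p_def)
      also have "\<dots> = (\<Sum>i\<in>I. d i *\<^sub>R v i) + e *\<^sub>R v s"
        unfolding d(3) by (simp add: p_def e_def scaleR_add_right sum.distrib scaleR_add_left
            scaleR_sum_left sum_subtractf scaleR_diff_right scaleR_diff_left sum_negf)
      also have "\<dots> = (\<Sum>i\<in>insert s I. (d(s := e)) i *\<^sub>R v i)"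
      proof -
        have "(\<Sum>i\<in>I. d i *\<^sub>R v i) = (\<Sum>i\<in>I. (d(s := e)) i *\<^sub>R v i)"
          using insert.hyps by (intro sum.cong) auto
        then show ?thesis using insert.hyps by (simp add: add.commute)
      qed
      finally have eq: "b = (\<Sum>i\<in>insert s I. (d(s := e)) i *\<^sub>R v i)" .
      have "e \<in> \<rat>"
        unfolding e_def using insert.prems d(1) \<Phi>(2)[OF f(1)] vs
        by (intro Rats_add Rats_divide Rats_sum Rats_mult Rats_minus_iff[THEN iffD2]) auto
      moreover have "0 \<le> e"
        unfolding e_def using f False d(2)
        by (intro add_nonneg_nonneg sum_nonneg mult_nonneg_nonneg)
          (auto simp: divide_nonneg_neg divide_nonpos_neg divide_le_0_iff zero_le_divide_iff)
      ultimately have "\<forall>i\<in>insert s I. (d(s := e)) i \<in> \<rat> \<and> 0 \<le> (d(s := e)) i" using d by auto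
      then show False using insert.prems(3) eq by blast
    qed
    then obtain g where g: "g \<in> \<Phi>" "g (p b) < 0" "\<And>i. i \<in> I \<Longrightarrow> 0 \<le> g (p (v i))"
      using insert.IH[of "\<lambda>i. p (v i)" "p b"] pE insert.prems by auto
    \<comment> \<open>This is \<open>g\<close> composed with \<open>p\<close>, written so that
      membership in \<open>\<Phi>\<close> is visible.\<close>
    define h where "h x = g x + (- (g (v s) / f (v s))) * f x" for x
    have "h \<in> \<Phi>"
      unfolding h_def using g(1) f(1) \<Phi>(2) vs by (intro \<Phi>(3)) auto
    moreover have "h x = g (p x)" for x
      using \<Phi>(1)[OF g(1)] by (simp add: h_def p_def linear_diff linear_cmul)
    moreover have "p (v s) = 0" using False by (simp add: p_def)
    moreover have "g 0 = 0" using \<Phi>(1)[OF g(1)] by (rule linear_0)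
    ultimately show ?thesis using g by (intro bexI[of _ h]) auto
  qed
qed

text \<open>\<open>\<Phi>_separates\<close> concerns rational combinations because a \<rat>-linear
  map commutes with rational coefficients. \<open>\<Phi>_nonneg\<close> is the dual form of 0 being
  a positive combination of \<open>X\<close>.\<close>

locale rational_configuration =
  fixes X :: "'a::real_vector set" and \<Phi> :: "('a \<Rightarrow> real) set"
  assumes finite_X: "finite X"
    and \<Phi>_linear: "f \<in> \<Phi> \<Longrightarrow> linear f"
    and \<Phi>_rat: "f \<in> \<Phi> \<Longrightarrow> x \<in> X \<Longrightarrow> f x \<in> \<rat>"
    and \<Phi>_closed: "f \<in> \<Phi> \<Longrightarrow> g \<in> \<Phi> \<Longrightarrow> c \<in> \<rat> \<Longrightarrow> (\<lambda>x. f x + c * g x) \<in> \<Phi>"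
    and \<Phi>_separates: "(\<And>x. x \<in> X \<Longrightarrow> w x \<in> \<rat>) \<Longrightarrow> (\<Sum>x\<in>X. w x *\<^sub>R x) \<noteq> 0 \<Longrightarrow>
      \<exists>f\<in>\<Phi>. f (\<Sum>x\<in>X. w x *\<^sub>R x) \<noteq> 0"
    and \<Phi>_nonneg: "f \<in> \<Phi> \<Longrightarrow> (\<And>x. x \<in> X \<Longrightarrow> 0 \<le> f x) \<Longrightarrow> x \<in> X \<Longrightarrow> f x = 0"
begin

definition E :: "'a set" where
  "E = {y. \<exists>c. (\<forall>x\<in>X. c x \<in> \<rat>) \<and> y = (\<Sum>x\<in>X. c x *\<^sub>R x)}"

lemma E_base: "x \<in> X \<Longrightarrow> x \<in> E"
  unfolding E_def using finite_X
  by (intro CollectI exI[of _ "\<lambda>y. if y = x then 1 else 0"]) (simp add: if_distrib[of "\<lambda>c. c *\<^sub>R _"] cong: if_cong)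

lemma E_closed:
  assumes "y \<in> E" "z \<in> E" "q \<in> \<rat>"
  shows "y + q *\<^sub>R z \<in> E"
proof -
  obtain c d where c: "\<forall>x\<in>X. c x \<in> \<rat>" "y = (\<Sum>x\<in>X. c x *\<^sub>R x)"
    and d: "\<forall>x\<in>X. d x \<in> \<rat>" "z = (\<Sum>x\<in>X. d x *\<^sub>R x)" using assms(1,2) unfolding E_def by blast
  have "y + q *\<^sub>R z = (\<Sum>x\<in>X. (c x + q * d x) *\<^sub>R x)"
    by (simp add: c d scaleR_sum_right sum.distrib scaleR_add_left)
  moreover have "\<forall>x\<in>X. c x + q * d x \<in> \<rat>" using c d assms(3) by auto
  ultimately show ?thesis unfolding E_def by (intro CollectI exI[of _ "\<lambda>x. c x + q * d x"]) simp
qed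

lemma E_diff: "y \<in> E \<Longrightarrow> z \<in> E \<Longrightarrow> y - z \<in> E"
  using E_closed[of y z "-1"] by simp

lemma \<Phi>_rat_E:
  assumes "f \<in> \<Phi>" "y \<in> E"
  shows "f y \<in> \<rat>"
proof -
  obtain c where c: "\<forall>x\<in>X. c x \<in> \<rat>" "y = (\<Sum>x\<in>X. c x *\<^sub>R x)" using assms(2) unfolding E_def by blast
  have "f y = (\<Sum>x\<in>X. c x * f x)" using \<Phi>_linear[OF assms(1)] by (simp add: c linear_sum linear_cmul)
  then show ?thesis using c(1) \<Phi>_rat[OF assms(1)] by (simp add: Rats_sum)
qed

lemma farkas:
  assumes "finite I" "\<And>i. i \<in> I \<Longrightarrow> v i \<in> E" "b \<in> E"
    and "\<not> (\<exists>d. (\<forall>i\<in>I. d i \<in> \<rat> \<and> 0 \<le> d i) \<and> b = (\<Sum>i\<in>I. d i *\<^sub>R v i))"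
  shows "\<exists>f\<in>\<Phi>. f b < 0 \<and> (\<forall>i\<in>I. 0 \<le> f (v i))"
proof (rule farkas_rational[where E = E and \<Phi> = \<Phi>])
  fix x assume "x \<in> E" "x \<noteq> 0"
  then show "\<exists>f\<in>\<Phi>. f x \<noteq> 0" using \<Phi>_separates unfolding E_def by blast
qed (fact \<Phi>_linear \<Phi>_rat_E \<Phi>_closed E_closed assms)+

lemma zero_positive_combination:
  obtains m where "\<And>x. x \<in> X \<Longrightarrow> (0::real) < m x" "(\<Sum>x\<in>X. m x *\<^sub>R x) = 0"
proof -
  have "\<exists>d. (\<forall>y\<in>X. d y \<in> \<rat> \<and> 0 \<le> d y) \<and> - x = (\<Sum>y\<in>X. d y *\<^sub>R y)" if x: "x \<in> X" for x
  proof (rule ccontr)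
    assume "\<not> ?thesis"
    moreover have "- x \<in> E" using E_closed[OF E_base[OF x] E_base[OF x], of "-2"] by (simp add: scaleR_2)
    ultimately obtain f where f: "f \<in> \<Phi>" "f (- x) < 0" "\<And>y. y \<in> X \<Longrightarrow> 0 \<le> f y"
      using farkas[of X "\<lambda>y. y" "- x"] finite_X E_base by auto
    then show False using \<Phi>_nonneg[OF f(1,3) x] \<Phi>_linear[OF f(1)] by (simp add: linear_neg)
  qed
  then obtain d where d: "\<And>x y. x \<in> X \<Longrightarrow> y \<in> X \<Longrightarrow> 0 \<le> d x y"
    "\<And>x. x \<in> X \<Longrightarrow> - x = (\<Sum>y\<in>X. d x y *\<^sub>R y)" by metis
  \<comment> \<open>Adding the relations \<open>x + (\<Sum>y\<in>X. d x y *\<^sub>R y) = 0\<close>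
    over all \<open>x\<close> makes every coefficient at least 1.\<close>
  define m where "m y = 1 + (\<Sum>x\<in>X. d x y)" for y
  have "(\<Sum>y\<in>X. m y *\<^sub>R y) = \<Sum>X + (\<Sum>y\<in>X. \<Sum>x\<in>X. d x y *\<^sub>R y)"
    by (simp add: m_def scaleR_add_left sum.distrib scaleR_sum_left)
  also have "(\<Sum>y\<in>X. \<Sum>x\<in>X. d x y *\<^sub>R y) = (\<Sum>x\<in>X. - x)"
    by (subst sum.swap) (simp add: d(2))
  finally have "(\<Sum>y\<in>X. m y *\<^sub>R y) = 0" by (simp add: sum_negf)
  moreover have "0 < m y" if "y \<in> X" for y
    using d(1) that unfolding m_def by (intro add_pos_nonneg sum_nonneg) auto
  ultimately show thesis by (rule that[rotated])
qed

text \<open>If \<open>y1 - x1\<close> were a nonnegative rational combination of differences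
  \<open>x - y\<close>, sorting the terms and dividing by their total mass \<open>M\<close> would
  exhibit one point as a combination of \<open>Y\<close> and as a combination of \<open>X\<close>
  with positive coefficient at \<open>x1\<close>. It lies in the relative interior of the hull of
  the support \<open>U\<close> of the latter, so the weak face would contain \<open>x1\<close>.
  Farkas' lemma then supplies \<open>f\<close>.\<close>

lemma weak_F_face_functional:
  assumes K: "real_subfield K" and face: "weak_F_face K X Y"
    and y1: "y1 \<in> Y" and x1: "x1 \<in> X - Y"
  shows "\<exists>f\<in>\<Phi>. f y1 < f x1 \<and> (\<forall>x\<in>X. \<forall>y\<in>Y. f y \<le> f x)"
proof -
  have YX: "Y \<subseteq> X" using face by (simp add: weak_F_face_def)
  have finY: "finite Y" using YX finite_X by (rule finite_subset)
  have ratK: "x \<in> K" if "x \<in> \<rat>" for x using that real_subfield_Rats[OF K] by blast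
  have K0: "0 \<in> K" using ratK by simp
  have "\<not> (\<exists>d. (\<forall>i\<in>X \<times> Y. d i \<in> \<rat> \<and> 0 \<le> d i)
      \<and> y1 - x1 = (\<Sum>i\<in>X \<times> Y. d i *\<^sub>R (fst i - snd i)))"
  proof
    assume "\<exists>d. (\<forall>i\<in>X \<times> Y. d i \<in> \<rat> \<and> 0 \<le> d i)
      \<and> y1 - x1 = (\<Sum>i\<in>X \<times> Y. d i *\<^sub>R (fst i - snd i))"
    then obtain d where "(\<forall>i\<in>X \<times> Y. d i \<in> \<rat> \<and> 0 \<le> d i)
      \<and> y1 - x1 = (\<Sum>i\<in>X \<times> Y. d i *\<^sub>R (fst i - snd i))" by (elim exE)
    then have dr: "\<And>x y. x \<in> X \<Longrightarrow> y \<in> Y \<Longrightarrow> d (x, y) \<in> \<rat>"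
      and d0: "\<And>x y. x \<in> X \<Longrightarrow> y \<in> Y \<Longrightarrow> 0 \<le> d (x, y)"
      and eq: "y1 - x1 = (\<Sum>i\<in>X \<times> Y. d i *\<^sub>R (fst i - snd i))" by simp_all
    define \<alpha> where "\<alpha> y = (if y = y1 then 1 else 0) + (\<Sum>x\<in>X. d (x, y))" for y
    define \<beta> where "\<beta> x = (if x = x1 then 1 else 0) + (\<Sum>y\<in>Y. d (x, y))" for x
    define M where "M = 1 + (\<Sum>x\<in>X. \<Sum>y\<in>Y. d (x, y))"
    have \<alpha>: "\<alpha> y \<in> \<rat>" "0 \<le> \<alpha> y" if "y \<in> Y" for y
      unfolding \<alpha>_def using that dr d0 by (auto intro!: Rats_add Rats_sum add_nonneg_nonneg sum_nonneg)
    have \<beta>: "\<beta> x \<in> \<rat>" "0 \<le> \<beta> x" if "x \<in> X" for x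
      unfolding \<beta>_def using that dr d0 by (auto intro!: Rats_add Rats_sum add_nonneg_nonneg sum_nonneg)
    have \<beta>1: "0 < \<beta> x1"
      unfolding \<beta>_def using x1 d0 by (auto intro!: add_pos_nonneg sum_nonneg)
    have M: "M \<in> \<rat>" "0 < M"
      unfolding M_def using dr d0 by (auto intro!: Rats_add Rats_sum add_pos_nonneg sum_nonneg)
    have sum\<alpha>: "sum \<alpha> Y = M"
      unfolding \<alpha>_def M_def using y1 finY by (simp add: sum.distrib) (rule sum.swap)
    have sum\<beta>: "sum \<beta> X = M"
      unfolding \<beta>_def M_def using x1 finite_X by (simp add: sum.distrib)
    have delta: "(\<Sum>z\<in>Z. (if z = a then 1 else 0) *\<^sub>R z) = a" if "finite Z" "a \<in> Z" for Z and a :: 'a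
      using that by (simp add: if_distrib[of "\<lambda>c. c *\<^sub>R _"] cong: if_cong)
    have A: "(\<Sum>y\<in>Y. \<alpha> y *\<^sub>R y) = y1 + (\<Sum>x\<in>X. \<Sum>y\<in>Y. d (x, y) *\<^sub>R y)"
      unfolding \<alpha>_def using delta[OF finY y1]
      by (simp add: scaleR_add_left sum.distrib scaleR_sum_left sum.swap[of _ Y X])
    have B: "(\<Sum>x\<in>X. \<beta> x *\<^sub>R x) = x1 + (\<Sum>x\<in>X. \<Sum>y\<in>Y. d (x, y) *\<^sub>R x)"
      unfolding \<beta>_def using delta[OF finite_X, of x1] x1
      by (simp add: scaleR_add_left sum.distrib scaleR_sum_left)
    have "y1 - x1 = (\<Sum>x\<in>X. \<Sum>y\<in>Y. d (x, y) *\<^sub>R x) - (\<Sum>x\<in>X. \<Sum>y\<in>Y. d (x, y) *\<^sub>R y)"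
      unfolding eq by (simp add: sum.cartesian_product scaleR_diff_right sum_subtractf case_prod_unfold)
    then have AB: "(\<Sum>y\<in>Y. \<alpha> y *\<^sub>R y) = (\<Sum>x\<in>X. \<beta> x *\<^sub>R x)"
      unfolding A B by (simp add: algebra_simps)
    define U where "U = {x \<in> X. 0 < \<beta> x}"
    have U: "finite U" "U \<subseteq> X" "x1 \<in> U" using finite_X x1 \<beta>1 by (auto simp: U_def)
    have out: "\<beta> x = 0" if "x \<in> X - U" for x using that \<beta>(2)[of x] by (auto simp: U_def)
    have "(\<Sum>y\<in>Y. (\<alpha> y / M) *\<^sub>R y) \<in> conv_F K Y"
      unfolding conv_F_finite[OF finY K0] using \<alpha> M sum\<alpha> ratK
      by (intro CollectI exI[of _ "\<lambda>y. \<alpha> y / M"]) (auto simp flip: sum_divide_distrib)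
    moreover have "(\<Sum>u\<in>U. (\<beta> u / M) *\<^sub>R u) \<in> relint_F K (conv_F K U)"
    proof (rule relint_F_positive[OF K U(1)])
      have "sum \<beta> U = sum \<beta> X" using U out finite_X by (intro sum.mono_neutral_left) auto
      then show "(\<Sum>u\<in>U. \<beta> u / M) = 1" using M sum\<beta> by (simp flip: sum_divide_distrib)
    qed (use U \<beta> M ratK in \<open>auto simp: U_def\<close>)
    moreover have "(\<Sum>u\<in>U. (\<beta> u / M) *\<^sub>R u) = (\<Sum>y\<in>Y. (\<alpha> y / M) *\<^sub>R y)"
    proof -
      have "(\<Sum>u\<in>U. (\<beta> u / M) *\<^sub>R u) = (\<Sum>x\<in>X. (\<beta> x / M) *\<^sub>R x)"
        using U out finite_X by (intro sum.mono_neutral_left) auto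
      also have "\<dots> = (1 / M) *\<^sub>R (\<Sum>x\<in>X. \<beta> x *\<^sub>R x)" by (simp add: scaleR_sum_right)
      also have "\<dots> = (\<Sum>y\<in>Y. (\<alpha> y / M) *\<^sub>R y)" unfolding AB[symmetric] by (simp add: scaleR_sum_right)
      finally show ?thesis .
    qed
    ultimately have "U \<subseteq> Y"
      using face U(2) unfolding weak_F_face_def by (metis IntI empty_iff)
    then show False using U(3) x1 by blast
  qed
  moreover have "fst i - snd i \<in> E" if "i \<in> X \<times> Y" for i
    by (rule E_diff) (use that YX in \<open>auto intro!: E_base\<close>)
  moreover have "y1 - x1 \<in> E" by (rule E_diff) (use x1 y1 YX in \<open>auto intro!: E_base\<close>)
  ultimately obtain f where f: "f \<in> \<Phi>" "f (y1 - x1) < 0" "\<And>i. i \<in> X \<times> Y \<Longrightarrow> 0 \<le> f (fst i - snd i)"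
    using farkas[of "X \<times> Y" "\<lambda>i. fst i - snd i" "y1 - x1"] finite_X finY by auto
  have fd: "f (a - b) = f a - f b" for a b using \<Phi>_linear[OF f(1)] by (rule linear_diff)
  have "f y \<le> f x" if "x \<in> X" "y \<in> Y" for x y using f(3)[of "(x, y)"] that by (simp add: fd)
  then show ?thesis using f(1,2) by (auto simp: fd)
qed

lemma convex_halfspace: "linear f \<Longrightarrow> convex {u. c \<le> (f u :: real)}"
proof (rule convexI)
  fix x y and u v :: real
  assume f: "linear f" and xy: "x \<in> {u. c \<le> f u}" "y \<in> {u. c \<le> f u}" and uv: "0 \<le> u" "0 \<le> v" "u + v = 1"
  have "c = u * c + v * c" using uv(3) by (simp flip: distrib_right)
  also have "\<dots> \<le> u * f x + v * f y" using xy uv by (intro add_mono mult_left_mono) auto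
  finally show "u *\<^sub>R x + v *\<^sub>R y \<in> {u. c \<le> f u}" using f by (simp add: linear_add linear_cmul)
qed

lemma weak_F_face_imp_face:
  assumes K: "real_subfield K" and face: "weak_F_face K X Y" and Y: "Y \<noteq> {}" "Y \<subset> X"
  shows "\<exists>F. is_face (convex hull X) F \<and> F \<noteq> convex hull X \<and> Y = F \<inter> X"
proof -
  obtain y1 where y1: "y1 \<in> Y" using Y by blast
  have "\<forall>x1\<in>X - Y. \<exists>f::'a \<Rightarrow> real. linear f \<and> f y1 < f x1 \<and> (\<forall>x\<in>X. \<forall>y\<in>Y. f y \<le> f x)"
  proof
    fix x1 assume "x1 \<in> X - Y"
    from weak_F_face_functional[OF K face y1 this] obtain f
      where "f \<in> \<Phi>" "f y1 < f x1 \<and> (\<forall>x\<in>X. \<forall>y\<in>Y. f y \<le> f x)" by (elim bexE)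
    then show "\<exists>f::'a \<Rightarrow> real. linear f \<and> f y1 < f x1 \<and> (\<forall>x\<in>X. \<forall>y\<in>Y. f y \<le> f x)"
      using \<Phi>_linear[of f] by (intro exI[of _ f] conjI) simp_all
  qed
  then obtain f :: "'a \<Rightarrow> 'a \<Rightarrow> real" where lin: "\<And>z. z \<in> X - Y \<Longrightarrow> linear (f z)"
    and strict: "\<And>z. z \<in> X - Y \<Longrightarrow> f z y1 < f z z"
    and le: "\<And>x y z. z \<in> X - Y \<Longrightarrow> x \<in> X \<Longrightarrow> y \<in> Y \<Longrightarrow> f z y \<le> f z x" by metis
  \<comment> \<open>Each \<open>f z\<close> attains its minimum over \<open>X\<close> at all points
    of \<open>Y\<close> and is larger at \<open>z\<close>; hence the sum is minimal exactly on
    \<open>Y\<close>.\<close>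
  define g where "g u = (\<Sum>z\<in>X - Y. f z u)" for u
  define c where "c = g y1"
  have g: "linear g" unfolding g_def using lin by (intro linear_compose_sum) auto
  have gle: "g y \<le> g x" if "x \<in> X" "y \<in> Y" for x y
    unfolding g_def using le that by (intro sum_mono) auto
  have gc: "g y = c" if "y \<in> Y" for y
  proof -
    have "y \<in> X" "y1 \<in> X" using that y1 Y(2) by blast+
    then show ?thesis unfolding c_def using gle that y1 by (intro order_antisym)
  qed
  have gt: "c < g x" if "x \<in> X - Y" for x
    unfolding c_def g_def using that finite_X y1 le[of _ x y1] strict
    by (intro sum_strict_mono_ex1) auto
  define F where "F = {u \<in> convex hull X. g u = c}"
  have hull: "x \<in> convex hull X" if "x \<in> X" for x using that hull_subset[of X convex] by blast
  have ge: "c \<le> g u" if "u \<in> convex hull X" for u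
  proof -
    have "convex hull X \<subseteq> {u. c \<le> g u}"
      using gle[OF _ y1] convex_halfspace[OF g, of c] by (intro hull_minimal) (auto simp: c_def)
    then show ?thesis using that by blast
  qed
  have "y1 \<in> F" using y1 Y hull gc by (auto simp: F_def)
  then have "is_face (convex hull X) F"
    unfolding is_face_def using g ge F_def by blast
  moreover obtain z where z: "z \<in> X - Y" using Y by blast
  have "z \<notin> F" using gt[OF z] by (simp add: F_def)
  then have "F \<noteq> convex hull X" using hull z by blast
  moreover have "Y = F \<inter> X" using Y gc gt hull by (force simp: F_def)
  ultimately show ?thesis by blast
qed

text \<open>Since \<open>0\<close> is a positive combination of \<open>X\<close>, it lies strictly inside every supporting
  half-space of a proper face.\<close>
lemma face_imp_pos_weak_F_face:
  assumes K: "real_subfield K" and Fface: "is_face (convex hull X) F" and proper: "F \<noteq> convex hull X"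
    and Y: "Y = F \<inter> X"
  shows "pos_weak_F_face K X Y"
proof -
  have K1: "1 \<in> K" using K by (rule real_subfieldD)
  have "\<exists>f::'a \<Rightarrow> real. \<exists>c. linear f \<and> (\<forall>u\<in>convex hull X. c \<le> f u)
      \<and> F = {u \<in> convex hull X. f u = c} \<and> F \<noteq> {}"
    by (rule disjE[OF Fface[unfolded is_face_def]]) (use proper in simp, assumption)
  then obtain f :: "'a \<Rightarrow> real" and c where "linear f \<and> (\<forall>u\<in>convex hull X. c \<le> f u)
      \<and> F = {u \<in> convex hull X. f u = c} \<and> F \<noteq> {}" by (elim exE)
  then have f: "linear f" and ge: "\<And>u. u \<in> convex hull X \<Longrightarrow> c \<le> f u"
    and F: "F = {u \<in> convex hull X. f u = c}" by blast+
  have hull: "x \<in> convex hull X" if "x \<in> X" for x using that hull_subset[of X convex] by blast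
  have geX: "c \<le> f x" if "x \<in> X" for x using ge hull that by blast
  have fY: "f p = c" if "p \<in> conv_F K Y" for p
    by (rule conv_F_linear_eq[OF f _ that]) (auto simp: Y F)
  \<comment> \<open>Otherwise \<open>f\<close> is nonnegative on \<open>X\<close>, and evaluating it
    at the positive combination 0 forces \<open>f = 0\<close> on \<open>X\<close>, so that
    \<open>F\<close> is the whole hull.\<close>
  have c0: "c < 0"
  proof (rule ccontr)
    assume c: "\<not> c < 0"
    obtain m where m: "\<And>x. x \<in> X \<Longrightarrow> (0::real) < m x" "(\<Sum>x\<in>X. m x *\<^sub>R x) = 0"
      using zero_positive_combination by blast
    have "(\<Sum>x\<in>X. m x * f x) = f (\<Sum>x\<in>X. m x *\<^sub>R x)" using f by (simp add: linear_sum linear_cmul)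
    also have "\<dots> = 0" unfolding m(2) using f by (rule linear_0)
    finally have s: "(\<Sum>x\<in>X. m x * f x) = 0" .
    have nn: "0 \<le> f x" if "x \<in> X" for x using c geX[OF that] by linarith
    have "m x * f x = 0" if "x \<in> X" for x
    proof -
      have "0 \<le> m x * f x" if "x \<in> X" for x using m(1)[OF that] nn[OF that] by simp
      then show ?thesis using s finite_X that by (simp add: sum_nonneg_eq_0_iff)
    qed
    then have z: "f x = 0" if "x \<in> X" for x using m(1) that by fastforce
    have "convex hull X \<subseteq> {u. 0 \<le> (- f u)}"
      using z convex_halfspace[OF linear_compose_neg[OF f], of 0] by (intro hull_minimal) auto
    then have "f u = c" if "u \<in> convex hull X" for u using ge[OF that] c that by force
    then show False using proper F by blast
  qed
  have weak: "weak_F_face K X Y"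
    unfolding weak_F_face_def
  proof (intro conjI allI impI subsetI)
    fix U u assume U: "U \<subseteq> X" "conv_F K Y \<inter> relint_F K (conv_F K U) \<noteq> {}" and u: "u \<in> U"
    then obtain p where p: "p \<in> conv_F K Y" "p \<in> relint_F K (conv_F K U)" by blast
    obtain z t where z: "z \<in> conv_F K U" and t: "0 < t" "t < 1" "p = t *\<^sub>R u + (1 - t) *\<^sub>R z"
      using p(2) conv_F_base[OF K1 u] unfolding relint_F_def by blast
    have "c \<le> f z" by (rule conv_F_linear_ge[OF f _ z]) (use U(1) geX in auto)
    then have "(1 - t) * c \<le> (1 - t) * f z" using t by (intro mult_left_mono) auto
    moreover have "c = t * f u + (1 - t) * f z"
      using fY[OF p(1)] f by (simp add: t(3) linear_add linear_cmul)
    moreover have "t * c = c - (1 - t) * c" by (simp add: algebra_simps)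
    ultimately have "t * f u \<le> t * c" by linarith
    then have "f u = c" using t geX[of u] U(1) u by auto
    then show "u \<in> Y" using U(1) u hull by (auto simp: Y F)
  qed (auto simp: Y)
  have "conv_F K Y \<inter> relint_F K (conv_F K (U \<union> {0})) = {}" if U: "U \<subseteq> X" for U
  proof (rule ccontr)
    assume "conv_F K Y \<inter> relint_F K (conv_F K (U \<union> {0})) \<noteq> {}"
    then obtain p where p: "p \<in> conv_F K Y" "p \<in> relint_F K (conv_F K (U \<union> {0}))" by blast
    \<comment> \<open>Testing the relative interior against the point 0 gives
      \<open>p = (1 - t) *\<^sub>R z\<close>, hence
      \<open>c = (1 - t) * f z \<ge> (1 - t) * c\<close>, which is impossible for negative
      \<open>c\<close>.\<close>
    have "0 \<in> conv_F K (U \<union> {0})" by (rule conv_F_base[OF K1]) simp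
    then obtain z t where z: "z \<in> conv_F K (U \<union> {0})" and t: "0 < t" "t < 1" "p = (1 - t) *\<^sub>R z"
      using p(2) unfolding relint_F_def by force
    have "c \<le> f z"
      by (rule conv_F_linear_ge[OF f _ z]) (use U geX c0 linear_0[OF f] in auto)
    then have "(1 - t) * c \<le> (1 - t) * f z" using t by (intro mult_left_mono) auto
    moreover have "c = (1 - t) * f z" using fY[OF p(1)] f by (simp add: t(3) linear_cmul)
    moreover have "t * c = c - (1 - t) * c" by (simp add: algebra_simps)
    ultimately have "0 \<le> t * c" by linarith
    then show False using t c0 by (simp add: zero_le_mult_iff)
  qed
  then show ?thesis unfolding pos_weak_F_face_def using weak by blast
qed

end

section \<open>Weights as a rational configuration\<close>

lemma fin_dim_fd_cspace:
  assumes "fin_dim s"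
  shows "\<exists>B. fd_cspace s B"
proof -
  interpret vector_space s using assms by (simp add: fin_dim_def)
  obtain S where S: "finite S" "span S = UNIV" using assms by (auto simp: fin_dim_def)
  obtain B where B: "B \<subseteq> S" "independent B" "S \<subseteq> span B"
    using maximal_independent_subset[of S] by blast
  have "span S \<subseteq> span B" using B(3) by (intro span_minimal subspace_span)
  then have "span B = UNIV" using S(2) by blast
  moreover have "finite B" using B(1) S(1) by (rule finite_subset)
  ultimately have "finite_dimensional_vector_space s B"
    using B(2) by unfold_locales auto
  then show ?thesis unfolding fd_cspace_def by blast
qed

lemma sum_scaleR_apply:
  fixes f :: "'i \<Rightarrow> 'g \<Rightarrow> complex"
  shows "(\<Sum>i\<in>I. w i *\<^sub>R f i) g = (\<Sum>i\<in>I. of_real (w i) * f i g)"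
  by (induction I rule: infinite_finite_induct) (auto simp: scaleR_fun_def scaleR_conv_of_real)

lemma linear_Re_evaluation: "linear (\<lambda>x::'g \<Rightarrow> complex. Re (x h))"
  by (rule linearI) (auto simp: scaleR_fun_def)

lemma complex_of_real_of_rat: "complex_of_real (of_rat r) = of_rat r"
  by (cases r) (simp add: of_rat_rat)

context weight_setting
begin

text \<open>Agreement with an evaluation is demanded on \<open>X\<close> only: on arbitrary
  functions the evaluations at \<open>h\<close> and \<open>k\<close> do not add up to the one at
  \<open>h + k\<close>, so literal evaluations would not be closed under
  \<open>f + c * g\<close>.\<close>

definition rational_evaluations :: "(('g \<Rightarrow> complex) \<Rightarrow> real) set" where
  "rational_evaluations =
    {f. linear f \<and> (\<exists>h\<in>H. \<forall>x\<in>X. x h = complex_of_real (f x) \<and> f x \<in> \<rat>)}"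

text \<open>Choose \<open>g\<close> at which the combination is nonzero and \<phi> nonzero on that
  value. \<open>weight_replica\<close> realizes the numbers \<open>\<phi> (x g)\<close> as the
  values \<open>x h\<close>, and since \<open>w\<close> is rational, \<phi> passes through the
  combination.\<close>

lemma rational_evaluations_separate:
  assumes w: "\<And>x. x \<in> X \<Longrightarrow> w x \<in> \<rat>" and n: "(\<Sum>x\<in>X. w x *\<^sub>R x) \<noteq> 0"
  shows "\<exists>f\<in>rational_evaluations. f (\<Sum>x\<in>X. w x *\<^sub>R x) \<noteq> 0"
proof -
  let ?b = "\<Sum>x\<in>X. w x *\<^sub>R x"
  obtain g where g: "?b g \<noteq> 0" using n by (auto simp: fun_eq_iff)
  have gH: "g \<in> H"
  proof (rule ccontr)
    assume "g \<notin> H"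
    then have "?b g = 0" unfolding sum_scaleR_apply by (intro sum.neutral) (simp add: weight_outside)
    then show False using g by simp
  qed
  obtain \<phi> where \<phi>: "rat_functional \<phi>" "\<phi> (?b g) \<noteq> 0" using rat_functional_separates[OF g] .
  obtain h where h: "h \<in> H" "\<And>x. x \<in> X \<Longrightarrow> x h = of_rat (\<phi> (x g))"
    using weight_replica[OF gH \<phi>(1)] by blast
  have "\<forall>x\<in>X. \<exists>q. w x = of_rat q" using w by (auto elim: Rats_cases)
  then obtain q where q: "\<And>x. x \<in> X \<Longrightarrow> w x = of_rat (q x)" by metis
  have "?b h = (\<Sum>x\<in>X. of_rat (\<phi> (x g * of_rat (q x))))"
    unfolding sum_scaleR_apply
    by (rule sum.cong[OF refl])
      (simp add: q h(2) rat_functional_scale[OF \<phi>(1)] of_rat_mult complex_of_real_of_rat mult.commute)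
  also have "\<dots> = of_rat (\<phi> (\<Sum>x\<in>X. x g * of_rat (q x)))"
    by (simp add: rat_functional_sum[OF \<phi>(1)] of_rat_sum)
  also have "(\<Sum>x\<in>X. x g * of_rat (q x)) = ?b g"
    unfolding sum_scaleR_apply by (rule sum.cong[OF refl]) (simp add: q complex_of_real_of_rat mult.commute)
  finally have bh: "?b h = of_rat (\<phi> (?b g))" .
  have "Re (?b h) \<noteq> 0" unfolding bh complex_of_real_of_rat[symmetric] using \<phi>(2) by simp
  moreover have "(\<lambda>x. Re (x h)) \<in> rational_evaluations"
    unfolding rational_evaluations_def using h(1)
    by (auto simp: linear_Re_evaluation h(2) simp flip: complex_of_real_of_rat intro!: bexI[of _ h])
  ultimately show ?thesis by (intro bexI[of _ "\<lambda>x. Re (x h)"]) simp_all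
qed

lemma rational_evaluationsE:
  assumes "f \<in> rational_evaluations"
  obtains h where "linear f" "h \<in> H" "\<And>x. x \<in> X \<Longrightarrow> x h = complex_of_real (f x)"
    "\<And>x. x \<in> X \<Longrightarrow> f x \<in> \<rat>"
  using assms by (auto simp: rational_evaluations_def)

lemma rational_configuration_weights: "rational_configuration X rational_evaluations"
proof (rule rational_configuration.intro)
  show "finite X" by (rule finite_weights)
next
  fix f assume "f \<in> rational_evaluations"
  then show "linear f" by (rule rational_evaluationsE)
next
  fix f x assume "f \<in> rational_evaluations" "x \<in> X"
  then show "f x \<in> \<rat>" by (metis rational_evaluationsE)
next
  fix f x assume f: "f \<in> rational_evaluations" and nn: "\<And>x. x \<in> X \<Longrightarrow> 0 \<le> f x" and x: "x \<in> X"
  obtain h where "h \<in> H" and fh: "\<And>x. x \<in> X \<Longrightarrow> x h = complex_of_real (f x)"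
    using rational_evaluationsE[OF f] by metis
  then have "x h = 0" using nn x by (intro weights_zero_if_nonneg) auto
  then show "f x = 0" using fh[OF x] by simp
next
  fix f g and c :: real
  assume f: "f \<in> rational_evaluations" and g: "g \<in> rational_evaluations" and c: "c \<in> \<rat>"
  obtain h where lin: "linear f" and h: "h \<in> H"
    and fh: "\<And>x. x \<in> X \<Longrightarrow> x h = complex_of_real (f x)" "\<And>x. x \<in> X \<Longrightarrow> f x \<in> \<rat>"
    using rational_evaluationsE[OF f] by metis
  obtain k where ling: "linear g" and k: "k \<in> H"
    and gk: "\<And>x. x \<in> X \<Longrightarrow> x k = complex_of_real (g x)" "\<And>x. x \<in> X \<Longrightarrow> g x \<in> \<rat>"
    using rational_evaluationsE[OF g] by metis
  have "linear (\<lambda>x. f x + c * g x)"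
    using lin ling by (intro linearI) (auto simp: linear_add linear_cmul algebra_simps)
  moreover have ck: "sg (of_real c) k \<in> H" using H_subspace k by (rule subspace_scale)
  moreover have "h + sg (of_real c) k \<in> H" using H_subspace h ck by (rule subspace_add)
  ultimately show "(\<lambda>x. f x + c * g x) \<in> rational_evaluations"
    unfolding rational_evaluations_def using c fh gk h k ck
    by (auto simp: weight_add weight_scale intro!: bexI[of _ "h + sg (of_real c) k"])
next
  show "\<exists>f\<in>rational_evaluations. f (\<Sum>x\<in>X. w x *\<^sub>R x) \<noteq> 0"
    if "\<And>x. x \<in> X \<Longrightarrow> w x \<in> \<rat>" "(\<Sum>x\<in>X. w x *\<^sub>R x) \<noteq> 0" for w
    by (rule rational_evaluations_separate[OF that])
qed

end

lemma weight_setting_exists: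
  assumes ss: "semisimple sg br" and "cartan_subalgebra sg br H"
    and mod: "lie_module sg br sv act" and "fin_dim sv"
  shows "\<exists>Bg Bv. weight_setting sg Bg br sv Bv act H"
proof -
  have lie: "lie_algebra sg br" and fin: "fin_dim sg"
    and rad: "\<And>I. lie_ideal sg br I \<Longrightarrow> lie_solvable sg br I \<Longrightarrow> I = {0}"
    using ss by (auto simp: semisimple_def)
  obtain Bg where Bg: "fd_cspace sg Bg" using fin_dim_fd_cspace[OF fin] by blast
  obtain Bv where Bv: "fd_cspace sv Bv" using fin_dim_fd_cspace[OF assms(4)] by blast
  interpret left_lie sg br by (rule left_lieI[OF lie])
  interpret V: fd_cspace sv Bv by (rule Bv)
  have lin: "act (sg a x + sg b y) v = sv a (act x v) + sv b (act y v)"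
    "act x (sv a v + sv b w) = sv a (act x v) + sv b (act x w)"
    and br: "act (br x y) v = act x (act y v) - act y (act x v)" for a b x y v w
    using mod unfolding lie_module_def by simp_all
  have act_add: "act (x + y) v = act x v + act y v" for x y v using lin(1)[of 1 x 1 y v] by simp
  have act_scale: "act (sg c x) v = sv c (act x v)" for c x v using lin(1)[of c x 0 0 v] by simp
  have lin_act: "V.lin (act x)" for x
    unfolding V.lin_def using lin(2)[of x 1 _ 1] lin(2)[of x _ _ 0 0] by simp
  have "lie_alg sg Bg br"
    by (rule lie_alg.intro[OF Bg left_lie_axioms]) (unfold_locales, rule additive_right_if_no_solvable_ideals[OF rad])
  then have "weight_setting sg Bg br sv Bv act H"
    using rad assms(2) act_add act_scale lin_act br Bv
    unfolding weight_setting_def lie_rep_def lie_rep_axioms_def cartan_def cartan_axioms_def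
      ss_lie_alg_def ss_lie_alg_axioms_def by blast
  then show ?thesis by blast
qed

theorem theorem3p1:
  fixes sg :: "complex \<Rightarrow> 'g \<Rightarrow> 'g::ab_group_add"
    and br :: "'g \<Rightarrow> 'g \<Rightarrow> 'g"
    and H :: "'g set"
    and sv :: "complex \<Rightarrow> 'v \<Rightarrow> 'v::ab_group_add"
    and act :: "'g \<Rightarrow> 'v \<Rightarrow> 'v"
    and K :: "real set"
    and Y :: "('g \<Rightarrow> complex) set"
  assumes "semisimple sg br"
    and "cartan_subalgebra sg br H"
    and "lie_module sg br sv act"
    and "fin_dim sv"
    and "weights sv act H \<noteq> {0}"
    and "real_subfield K"
    and "Y \<noteq> {}"
    and "Y \<subset> weights sv act H"
  shows "(pos_weak_F_face K (weights sv act H) Y \<longleftrightarrow> weak_F_face K (weights sv act H) Y)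
    \<and> (weak_F_face K (weights sv act H) Y \<longleftrightarrow>
        (\<exists>F. is_face (convex hull (weights sv act H)) F
             \<and> F \<noteq> convex hull (weights sv act H)
             \<and> Y = F \<inter> weights sv act H))"
proof -
  obtain Bg Bv where "weight_setting sg Bg br sv Bv act H"
    using weight_setting_exists[OF assms(1-4)] by blast
  then interpret weight_setting sg Bg br sv Bv act H .
  interpret rational_configuration "weights sv act H" rational_evaluations
    by (rule rational_configuration_weights)
  have "weak_F_face K (weights sv act H) Y" if "pos_weak_F_face K (weights sv act H) Y"
    using that by (simp add: pos_weak_F_face_def)
  then show ?thesis
    using weak_F_face_imp_face[OF assms(6) _ assms(7,8)] face_imp_pos_weak_F_face[OF assms(6)]
    by blast
qed

end
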